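(* Let $k:(0,\infty)\to[0,\infty)$ be a locally integrable function whose Laplace transform $\mathcal K(p)=\int_0^\infty e^{-pt}k(t)\,dt$ exists for all $p>0$, is a Stieltjes function, and satisfies $\mathcal K(p)\to\infty$ as $p\to 0$, $\mathcal K(p)\to 0$ as $p\to\infty$, $p\mathcal K(p)\to 0$ as $p\to 0$, and $p\mathcal K(p)\to\infty$ as $p\to\infty$. Let $\Phi(p)=p\mathcal K(p)$, and assume in addition that $$\int_1^\infty\frac{ds}{s\,\Phi(s)}<\infty.$$ Let $\lambda>0$, let $p_0(\lambda)$ be the unique positive number with $\Phi(p_0(\lambda))=\lambda$, and let $u_\lambda$ be the solution of the Cauchy problem $$(\mathbb D_{(k)}u)(t)=\lambda u(t),\quad t>0;\qquad u(0)=1.$$ Then $$u_\lambda(t)=\frac{\lambda}{\Phi'(p_0(\lambda))\,p_0(\lambda)}\,e^{p_0(\lambda)t}+o\!\left(e^{p_0(\lambda)t}\right),\quad t\to\infty.$$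
   Context: For a nonnegative locally integrable function $k$ on $(0,\infty)$, the differential-convolution operator $\mathbb D_{(k)}$ is $$(\mathbb D_{(k)}u)(t)=\frac{d}{dt}\int_0^t k(t-\tau)u(\tau)\,d\tau-k(t)u(0).$$ A function $\psi$ on $(0,\infty)$ is a Stieltjes function if it has the form $\psi(z)=\frac{a}{z}+b+\int_0^\infty\frac{1}{z+t}\,\sigma(dt)$ with $a,b\ge 0$ and $\sigma$ a Borel measure on $[0,\infty)$ such that $\int_0^\infty(1+t)^{-1}\sigma(dt)<\infty$. Under the stated limit conditions, $\mathcal K(p)=\int_0^\infty\frac{1}{p+t}\,\sigma(dt)$ and $\Phi(p)=p\mathcal K(p)=\int_0^\infty\frac{p}{p+t}\,\sigma(dt)$. Both extend holomorphically to $\mathbb C\setminus(-\infty,0]$. The function $\Phi$ is strictly increasing on $(0,\infty)$ with $\Phi'(p)\neq 0$ for all $p>0$, $\Phi(p)\to0$ as $p\to0$ and $\Phi(p)\to\infty$ as $p\to\infty$, so for each $\lambda>0$ there is a unique $p_0(\lambda)>0$ with $\Phi(p_0(\lambda))=\lambda$. The Cauchy problem has a unique absolutely continuous solution (a known result), denoted $u_\lambda$. Its Laplace transform is $$\widetilde{u_\lambda}(p)=\int_0^\infty e^{-pt}u_\lambda(t)\,dt=\frac{\mathcal K(p)}{\Phi(p)-\lambda}\quad\text{for } p>p_0(\lambda).$$ *)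

theory Defs
  imports "HOL-Analysis.Analysis" "HOL-Library.Landau_Symbols"
begin

definition locally_integrable_pos :: "(real \<Rightarrow> real) \<Rightarrow> bool" where
  "locally_integrable_pos k \<longleftrightarrow>
     (\<forall>a b. 0 < a \<longrightarrow> a \<le> b \<longrightarrow> k absolutely_integrable_on {a..b})"

(* Only used for nonnegative functions, where convergence is the same as absolute convergence. *)
definition laplace_exists :: "(real \<Rightarrow> real) \<Rightarrow> real \<Rightarrow> bool" where
  "laplace_exists k p \<longleftrightarrow> (\<lambda>t. exp (- p * t) * k t) absolutely_integrable_on {0<..}"

definition laplace :: "(real \<Rightarrow> real) \<Rightarrow> real \<Rightarrow> real" where
  "laplace k p = (LINT t:{0<..}|lebesgue. exp (- p * t) * k t)"

definition stieltjes_function :: "(real \<Rightarrow> real) \<Rightarrow> bool" where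
  "stieltjes_function \<psi> \<longleftrightarrow>
     (\<exists>a b \<sigma>. 0 \<le> a \<and> 0 \<le> b
        \<and> sets \<sigma> = sets (restrict_space borel {0::real..})
        \<and> integrable \<sigma> (\<lambda>t. 1 / (1 + t))
        \<and> (\<forall>z>0. \<psi> z = a / z + b + (\<integral>t. 1 / (z + t) \<partial>\<sigma>)))"

definition absolutely_continuous_on_interval :: "(real \<Rightarrow> real) \<Rightarrow> real \<Rightarrow> real \<Rightarrow> bool" where
  "absolutely_continuous_on_interval f a b \<longleftrightarrow>
     (\<forall>\<epsilon>>0. \<exists>\<delta>>0. \<forall>(n::nat) x y.
        (\<forall>i<n. a \<le> x i \<and> x i \<le> y i \<and> y i \<le> b) \<longrightarrow>
        disjoint_family_on (\<lambda>i. {x i<..<y i}) {..<n} \<longrightarrow>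
        (\<Sum>i<n. y i - x i) < \<delta> \<longrightarrow>
        (\<Sum>i<n. \<bar>f (y i) - f (x i)\<bar>) < \<epsilon>)"

definition convolution :: "(real \<Rightarrow> real) \<Rightarrow> (real \<Rightarrow> real) \<Rightarrow> real \<Rightarrow> real" where
  "convolution k u t = (LINT \<tau>:{0<..<t}|lebesgue. k (t - \<tau>) * u \<tau>)"

definition diff_conv :: "(real \<Rightarrow> real) \<Rightarrow> (real \<Rightarrow> real) \<Rightarrow> real \<Rightarrow> real" where
  "diff_conv k u t = deriv (convolution k u) t - k t * u 0"

(* Absolute continuity on the half-line means absolute continuity on every [0,T].  The kernel is
   only given up to null sets and the convolution is then in general only differentiable almost
   everywhere, so the equation is required for almost every t > 0; a solution in the sense
   "for every t > 0" is in particular a solution in this sense. *)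
definition cauchy_solution :: "(real \<Rightarrow> real) \<Rightarrow> real \<Rightarrow> (real \<Rightarrow> real) \<Rightarrow> bool" where
  "cauchy_solution k \<mu> u \<longleftrightarrow>
     (\<forall>T>0. absolutely_continuous_on_interval u 0 T)
     \<and> u 0 = 1
     \<and> (AE t in lebesgue. 0 < t \<longrightarrow>
          convolution k u field_differentiable at t \<and> diff_conv k u t = \<mu> * u t)"

end

theory Submission
  imports Defs "HOL-Complex_Analysis.Complex_Analysis" "HOL-Real_Asymp.Real_Asymp"
begin

text \<open>
  Write \<open>K\<close> for the Laplace transform of \<open>k\<close> and \<open>z = u - 1\<close>, extended by \<open>0\<close> to the negative
  axis. On the level of Laplace transforms the claim is a residue computation: \<open>z\<close> has the
  transform \<open>R(p) = \<mu> / (p (\<Phi>(p) - \<mu>))\<close>, whose only singularity in the right half-plane is a simple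
  pole at \<open>p0\<close>, with residue \<open>\<mu> / (\<Phi>'(p0) p0)\<close>. The condition on \<open>1 / (s \<Phi>(s))\<close> makes \<open>R\<close> absolutely
  integrable along vertical lines. Hence the inversion integral for \<open>z\<close> can be moved from a line to the
  right of \<open>p0\<close> to the line with real part \<open>p0 / 2\<close>; it picks up the residue, which is the main
  term, and the remaining integral is \<open>O(exp(p0 t / 2))\<close>. So the error is in fact exponentially
  smaller than the main term.

  Nothing is known beforehand about the growth of \<open>u\<close>, so its Laplace transform cannot be taken.
  Instead, the function \<open>r\<close> that is defined by the inversion integral is identified with \<open>z\<close> in the time domain.

  The equation for \<open>z\<close> comes from integrating the differential equation. Since \<open>u\<close> is absolutely continuous and \<open>k\<close> is
  locally integrable, the convolution of \<open>k\<close> and \<open>u\<close> is absolutely continuous, and the fundamental theorem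
  of calculus for absolutely continuous functions (\<open>absolutely_continuous_ftc\<close>) turns the equation
  almost everywhere into \<open>m * z = \<mu> t\<close> for all \<open>t > 0\<close>, where \<open>m = k - \<mu>\<close> on the positive axis
  (\<open>integrated_cauchy_equation\<close>).

  The function \<open>r\<close> solves the same equation: by Fubini, \<open>m * r\<close> is the inversion integral of
  \<open>(K(p) - \<mu>/p) R(p) = \<mu> / p\<^sup>2\<close>, which is \<open>\<mu> t\<close> (\<open>resolvent_kernel_equation\<close>).

  Such an equation has at most one solution: commuting convolutions give
  \<open>r * (m * z) = z * (m * r)\<close>, so \<open>z\<close> and \<open>r\<close> have the same convolution with \<open>t\<close> and are equal
  (\<open>first_kind_solution_unique\<close>).

  All that the complex analysis needs to know about \<open>\<Phi>\<close> comes from the Stieltjes representation of \<open>K\<close>: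
  \<open>\<Phi>(p) - \<mu> = (p - p0) Q(p)\<close>, where \<open>Q\<close> is again a Stieltjes function and therefore has positive
  real part in the right half-plane (\<open>Phi_difference\<close>, \<open>Re_transform_pos\<close>), and
  \<open>2 |\<Phi>(p)| \<ge> \<Phi>(|p|)\<close> (\<open>norm_transform_ge\<close>).
\<close>

section \<open>Absolute continuity and the fundamental theorem of calculus\<close>

text \<open>The Henstock-Kurzweil proof of the fundamental theorem needs one change: the tags in the
  exceptional null set \<open>N\<close> are not controlled by a derivative. But the indicator function of \<open>N\<close> has integral
  \<open>0\<close>, so that for a fine division the intervals with such tags have small total length, and
  absolute continuity bounds the increments of \<open>F\<close> over them.\<close>
lemma absolutely_continuous_ftc:
  fixes F g :: "real \<Rightarrow> real"
  assumes ab: "a \<le> b" and ac: "absolutely_continuous_on_interval F a b"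
    and N: "negligible N"
    and der: "\<And>x. x \<in> {a..b} - N \<Longrightarrow> (F has_real_derivative g x) (at x within {a..b})"
  shows "(g has_integral (F b - F a)) {a..b}"
proof -
  define h where "h = (\<lambda>x. if x \<in> N then 0 else g x)"
  have "(h has_integral (F b - F a)) (cbox a b)"
    unfolding has_integral
  proof (intro allI impI)
    fix e :: real assume e: "e > 0"
    from e have "e / 2 > 0" by simp
    with ac obtain \<delta> where \<delta>: "\<delta> > 0" and ac\<delta>: "\<And>(n::nat) x y.
        (\<forall>i<n. a \<le> x i \<and> x i \<le> y i \<and> y i \<le> b) \<Longrightarrow>
        disjoint_family_on (\<lambda>i. {x i<..<y i}) {..<n} \<Longrightarrow>
        (\<Sum>i<n. y i - x i) < \<delta> \<Longrightarrow>
        (\<Sum>i<n. \<bar>F (y i) - F (x i)\<bar>) < e / 2"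
      unfolding absolutely_continuous_on_interval_def by blast
    \<comment> \<open>the summand 1 keeps this positive when \<open>a = b\<close>\<close>
    define e' where "e' = e / (2 * (b - a + 1))"
    have e': "e' > 0" using e ab by (simp add: e'_def)
    have "e' * (b - a) \<le> e * (b - a) / (2 * (b - a + 1))" by (simp add: e'_def)
    also have "\<dots> \<le> e / 2" using ab e by (simp add: field_simps)
    finally have e'b: "e' * (b - a) \<le> e / 2" .
    have "\<forall>x. \<exists>d>0. x \<in> {a..b} - N \<longrightarrow>
         (\<forall>y\<in>{a..b}. \<bar>y - x\<bar> < d \<longrightarrow> \<bar>F y - F x - (y - x) * g x\<bar> \<le> e' * \<bar>y - x\<bar>)"
    proof
      fix x show "\<exists>d>0. x \<in> {a..b} - N \<longrightarrow>
         (\<forall>y\<in>{a..b}. \<bar>y - x\<bar> < d \<longrightarrow> \<bar>F y - F x - (y - x) * g x\<bar> \<le> e' * \<bar>y - x\<bar>)"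
      proof (cases "x \<in> {a..b} - N")
        case True
        from der[OF this] have "(F has_derivative (\<lambda>h. h * g x)) (at x within {a..b})"
          by (simp add: has_field_derivative_def mult_commute_abs)
        then have "\<forall>e>0. \<exists>d>0. \<forall>y\<in>{a..b}. norm (y - x) < d \<longrightarrow> norm (F y - F x - (y - x) * g x) \<le> e * norm (y - x)"
          unfolding has_derivative_within_alt by blast
        then show ?thesis using e' unfolding real_norm_def by blast
      qed (auto intro: exI[of _ 1])
    qed
    then obtain d where d: "\<And>x. 0 < d x"
       and d': "\<And>x y. \<lbrakk>x \<in> {a..b} - N; y \<in> {a..b}; \<bar>y - x\<bar> < d x\<rbrakk>
                        \<Longrightarrow> \<bar>F y - F x - (y - x) * g x\<bar> \<le> e' * \<bar>y - x\<bar>"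
      by metis
    have "((indicator N :: real \<Rightarrow> real) has_integral 0) (cbox a b)"
      using N by (simp add: negligible_def)
    from this[unfolded has_integral, rule_format, OF \<delta>]
    obtain \<gamma>0 where \<gamma>0: "gauge \<gamma>0" and \<gamma>0': "\<forall>p. p tagged_division_of cbox a b \<and> \<gamma>0 fine p \<longrightarrow>
          norm ((\<Sum>(x,K)\<in>p. measure lborel K *\<^sub>R (indicator N x :: real)) - 0) < \<delta>"
      by (elim exE conjE)
    show "\<exists>\<gamma>. gauge \<gamma> \<and> (\<forall>\<D>. \<D> tagged_division_of cbox a b \<and> \<gamma> fine \<D> \<longrightarrow>
             norm ((\<Sum>(x, K)\<in>\<D>. measure lborel K *\<^sub>R h x) - (F b - F a)) < e)"
    proof (intro exI conjI allI impI)
      show "gauge (\<lambda>x. \<gamma>0 x \<inter> ball x (d x))"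
        using \<gamma>0 d by (intro gauge_Int gauge_ball_dependent) auto
    next
      fix p assume "p tagged_division_of cbox a b \<and> (\<lambda>x. \<gamma>0 x \<inter> ball x (d x)) fine p"
      then have ptag: "p tagged_division_of cbox a b" and f1: "\<gamma>0 fine p" and f2: "(\<lambda>x. ball x (d x)) fine p"
        by (auto simp: fine_Int)
      have fin: "finite p" using ptag by blast
      have ba: "F b - F a = (\<Sum>(x,K)\<in>p. F (Sup K) - F (Inf K))"
           "b - a = (\<Sum>(x,K)\<in>p. Sup K - Inf K)"
        using additive_tagged_division_1[where f= F] additive_tagged_division_1[where f= "\<lambda>x. x"] ab ptag by auto
      have K: "\<exists>u v. K = {u..v} \<and> u \<le> v \<and> a \<le> u \<and> v \<le> b \<and> Inf K = u \<and> Sup K = v \<and> measure lborel K = v - u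
                 \<and> interior K = {u<..<v} \<and> x \<in> {u..v} \<and> x \<in> {a..b}"
        if xK: "(x, K) \<in> p" for x K
      proof -
        have "x \<in> K" "K \<subseteq> cbox a b" using ptag xK by blast+
        moreover obtain u v where "K = cbox u v" using ptag xK by blast
        ultimately show ?thesis by (intro exI[of _ u] exI[of _ v]) auto
      qed
      have K': "a \<le> Inf K \<and> Inf K \<le> Sup K \<and> Sup K \<le> b" "measure lborel K = Sup K - Inf K"
           "interior K = {Inf K<..<Sup K}" if "(x, K) \<in> p" for x K
        using K[OF that] by auto
      \<comment> \<open>\<open>P\<close> is handled by absolute continuity, \<open>Q\<close> by the derivative\<close>
      define P where "P = {(x,K) \<in> p. x \<in> N}"
      define Q where "Q = {(x,K) \<in> p. x \<notin> N}"
      have PQ: "p = P \<union> Q" "P \<inter> Q = {}" "finite P" "finite Q" "P \<subseteq> p" "Q \<subseteq> p"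
        using fin by (auto simp: P_def Q_def intro: finite_subset[OF _ fin])
      have "(\<Sum>(x,K)\<in>P. Sup K - Inf K) = (\<Sum>(x,K)\<in>P. measure lborel K *\<^sub>R (indicator N x :: real))"
      proof (intro sum.cong refl, safe)
        fix x K assume "(x, K) \<in> P"
        then have "(x, K) \<in> p" "x \<in> N" by (auto simp: P_def)
        with K'[of x K] show "Sup K - Inf K = measure lborel K *\<^sub>R (indicator N x :: real)" by auto
      qed
      also have "\<dots> = (\<Sum>(x,K)\<in>p. measure lborel K *\<^sub>R (indicator N x :: real))"
        by (rule sum.mono_neutral_left) (use PQ fin in \<open>auto simp: P_def\<close>)
      also have "\<dots> < \<delta>" using \<gamma>0'[rule_format, OF conjI[OF ptag f1]] by simp
      finally have len: "(\<Sum>(x,K)\<in>P. Sup K - Inf K) < \<delta>" .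
      obtain n :: nat and q where q: "bij_betw q {..<n} P"
        using ex_bij_betw_nat_finite[OF PQ(3)] by (auto simp: atLeast0LessThan)
      have qP: "q i \<in> p" if "i < n" for i
        using q that PQ by (auto simp: bij_betw_def)
      have "(\<Sum>i<n. \<bar>F (Sup (snd (q i))) - F (Inf (snd (q i)))\<bar>) < e / 2"
      proof (rule ac\<delta>)
        show "\<forall>i<n. a \<le> Inf (snd (q i)) \<and> Inf (snd (q i)) \<le> Sup (snd (q i)) \<and> Sup (snd (q i)) \<le> b"
        proof (intro allI impI)
          fix i assume "i < n"
          from K'(1)[of "fst (q i)" "snd (q i)"] qP[OF this]
          show "a \<le> Inf (snd (q i)) \<and> Inf (snd (q i)) \<le> Sup (snd (q i)) \<and> Sup (snd (q i)) \<le> b" by simp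
        qed
        show "disjoint_family_on (\<lambda>i. {Inf (snd (q i))<..<Sup (snd (q i))}) {..<n}"
          unfolding disjoint_family_on_def
        proof (intro ballI impI)
          fix i j assume ij: "i \<in> {..<n}" "j \<in> {..<n}" "i \<noteq> j"
          then have ne: "q i \<noteq> q j" using q by (auto simp: bij_betw_def inj_on_def)
          have "interior (snd (q i)) \<inter> interior (snd (q j)) = {}"
            using ptag qP[of i] qP[of j] ij ne by (metis lessThan_iff prod.collapse tagged_division_ofD(5))
          then show "{Inf (snd (q i))<..<Sup (snd (q i))} \<inter> {Inf (snd (q j))<..<Sup (snd (q j))} = {}"
            using K'(3)[of "fst (q i)" "snd (q i)"] K'(3)[of "fst (q j)" "snd (q j)"] qP[of i] qP[of j] ij by simp
        qed
        show "(\<Sum>i<n. Sup (snd (q i)) - Inf (snd (q i))) < \<delta>"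
          using len sum.reindex_bij_betw[OF q, of "\<lambda>(x,K). Sup K - Inf K"] by (simp add: case_prod_unfold)
      qed
      also have "(\<Sum>i<n. \<bar>F (Sup (snd (q i))) - F (Inf (snd (q i)))\<bar>) = (\<Sum>(x,K)\<in>P. \<bar>F (Sup K) - F (Inf K)\<bar>)"
        using sum.reindex_bij_betw[OF q, of "\<lambda>(x,K). \<bar>F (Sup K) - F (Inf K)\<bar>"] by (simp add: case_prod_unfold)
      finally have bP: "(\<Sum>(x,K)\<in>P. \<bar>F (Sup K) - F (Inf K)\<bar>) < e / 2" .
      have bQ: "(\<Sum>(x,K)\<in>Q. \<bar>measure lborel K * g x - (F (Sup K) - F (Inf K))\<bar>) \<le> (\<Sum>(x,K)\<in>Q. e' * (Sup K - Inf K))"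
      proof (rule sum_mono, safe)
        fix x K assume xK: "(x, K) \<in> Q"
        then have xp: "(x,K) \<in> p" and xN: "x \<notin> N" by (auto simp: Q_def)
        from K[OF xp] obtain u v where uv: "K = {u..v}" "u \<le> v" "a \<le> u" "v \<le> b" "Inf K = u" "Sup K = v"
            "measure lborel K = v - u" "x \<in> {u..v}" "x \<in> {a..b}" by blast
        have "K \<subseteq> ball x (d x)" using f2 xp by (auto simp: fine_def)
        moreover have "u \<in> K" "v \<in> K" using uv by auto
        ultimately have "u \<in> ball x (d x)" "v \<in> ball x (d x)" by blast+
        then have "\<bar>u - x\<bar> < d x" "\<bar>v - x\<bar> < d x" by (simp_all add: dist_real_def abs_minus_commute)
        then have 1: "\<bar>F u - F x - (u - x) * g x\<bar> \<le> e' * \<bar>u - x\<bar>" "\<bar>F v - F x - (v - x) * g x\<bar> \<le> e' * \<bar>v - x\<bar>"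
          using uv(2,3,4,9) xN by (auto intro!: d')
        have "\<bar>(v - u) * g x - (F v - F u)\<bar> = \<bar>(F u - F x - (u - x) * g x) - (F v - F x - (v - x) * g x)\<bar>"
          by (simp add: algebra_simps)
        also have "\<dots> \<le> e' * \<bar>u - x\<bar> + e' * \<bar>v - x\<bar>" using 1 by linarith
        also have "\<dots> = e' * (v - u)" using uv by (simp add: algebra_simps)
        finally show "\<bar>measure lborel K * g x - (F (Sup K) - F (Inf K))\<bar> \<le> e' * (Sup K - Inf K)" using uv by simp
      qed
      also have "\<dots> \<le> (\<Sum>(x,K)\<in>p. e' * (Sup K - Inf K))"
      proof (intro sum_mono2 fin PQ)
        fix z assume "z \<in> p - Q"
        then have "(fst z, snd z) \<in> p" by simp
        from K'(1)[OF this] e' show "0 \<le> (case z of (x, K) \<Rightarrow> e' * (Sup K - Inf K))"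
          by (auto simp: case_prod_unfold)
      qed
      also have "\<dots> = e' * (b - a)" unfolding ba by (simp add: sum_distrib_left case_prod_unfold)
      finally have bQ: "(\<Sum>(x,K)\<in>Q. \<bar>measure lborel K * g x - (F (Sup K) - F (Inf K))\<bar>) \<le> e / 2" using e'b by simp
      have "(\<Sum>(x, K)\<in>p. measure lborel K *\<^sub>R h x) - (F b - F a) = (\<Sum>(x,K)\<in>p. measure lborel K * h x - (F (Sup K) - F (Inf K)))"
        unfolding ba by (simp add: case_prod_unfold sum_subtractf)
      also have "\<dots> = (\<Sum>(x,K)\<in>P. measure lborel K * h x - (F (Sup K) - F (Inf K))) + (\<Sum>(x,K)\<in>Q. measure lborel K * h x - (F (Sup K) - F (Inf K)))"
        unfolding PQ(1) by (rule sum.union_disjoint[OF PQ(3,4,2)])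
      also have "(\<Sum>(x,K)\<in>P. measure lborel K * h x - (F (Sup K) - F (Inf K))) = (\<Sum>(x,K)\<in>P. - (F (Sup K) - F (Inf K)))"
        by (rule sum.cong) (auto simp: P_def h_def)
      also have "(\<Sum>(x,K)\<in>Q. measure lborel K * h x - (F (Sup K) - F (Inf K))) = (\<Sum>(x,K)\<in>Q. measure lborel K * g x - (F (Sup K) - F (Inf K)))"
        by (rule sum.cong) (auto simp: Q_def h_def)
      finally have eq: "(\<Sum>(x, K)\<in>p. measure lborel K *\<^sub>R h x) - (F b - F a) = 
         (\<Sum>(x,K)\<in>P. - (F (Sup K) - F (Inf K))) + (\<Sum>(x,K)\<in>Q. measure lborel K * g x - (F (Sup K) - F (Inf K)))" .
      have "\<bar>\<Sum>(x,K)\<in>P. - (F (Sup K) - F (Inf K))\<bar> < e / 2"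
        by (rule le_less_trans[OF sum_abs]) (use bP in \<open>simp add: case_prod_unfold abs_minus_commute\<close>)
      moreover have "\<bar>\<Sum>(x,K)\<in>Q. measure lborel K * g x - (F (Sup K) - F (Inf K))\<bar> \<le> e / 2"
        by (rule order_trans[OF sum_abs]) (use bQ in \<open>simp add: case_prod_unfold\<close>)
      ultimately show "norm ((\<Sum>(x, K)\<in>p. measure lborel K *\<^sub>R h x) - (F b - F a)) < e"
        unfolding eq real_norm_def by linarith
    qed
  qed
  then have "(h has_integral (F b - F a)) {a..b}" by simp
  then show ?thesis
    by (rule has_integral_spike[OF N, rotated]) (auto simp: h_def)
qed

lemma absolutely_continuous_add:
  assumes "absolutely_continuous_on_interval f a b" "absolutely_continuous_on_interval g a b"
  shows "absolutely_continuous_on_interval (\<lambda>x. f x + g x) a b"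
  unfolding absolutely_continuous_on_interval_def
proof (intro allI impI)
  fix \<epsilon> :: real assume "\<epsilon> > 0"
  then have e2: "\<epsilon> / 2 > 0" by simp
  obtain d1 where d1: "d1 > 0" "\<forall>(n::nat) x y.
        (\<forall>i<n. a \<le> x i \<and> x i \<le> y i \<and> y i \<le> b) \<longrightarrow>
        disjoint_family_on (\<lambda>i. {x i<..<y i}) {..<n} \<longrightarrow>
        (\<Sum>i<n. y i - x i) < d1 \<longrightarrow> (\<Sum>i<n. \<bar>f (y i) - f (x i)\<bar>) < \<epsilon> / 2"
    using assms(1)[unfolded absolutely_continuous_on_interval_def, rule_format, OF e2] by blast
  obtain d2 where d2: "d2 > 0" "\<forall>(n::nat) x y.
        (\<forall>i<n. a \<le> x i \<and> x i \<le> y i \<and> y i \<le> b) \<longrightarrow>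
        disjoint_family_on (\<lambda>i. {x i<..<y i}) {..<n} \<longrightarrow>
        (\<Sum>i<n. y i - x i) < d2 \<longrightarrow> (\<Sum>i<n. \<bar>g (y i) - g (x i)\<bar>) < \<epsilon> / 2"
    using assms(2)[unfolded absolutely_continuous_on_interval_def, rule_format, OF e2] by blast
  show "\<exists>\<delta>>0. \<forall>(n::nat) x y.
        (\<forall>i<n. a \<le> x i \<and> x i \<le> y i \<and> y i \<le> b) \<longrightarrow>
        disjoint_family_on (\<lambda>i. {x i<..<y i}) {..<n} \<longrightarrow>
        (\<Sum>i<n. y i - x i) < \<delta> \<longrightarrow> (\<Sum>i<n. \<bar>f (y i) + g (y i) - (f (x i) + g (x i))\<bar>) < \<epsilon>"
  proof (intro exI conjI allI impI)
    show "min d1 d2 > 0" using d1 d2 by simp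
    fix n :: nat and x y
    assume H: "\<forall>i<n. a \<le> x i \<and> x i \<le> y i \<and> y i \<le> b"
        "disjoint_family_on (\<lambda>i. {x i<..<y i}) {..<n}" "(\<Sum>i<n. y i - x i) < min d1 d2"
    have "(\<Sum>i<n. \<bar>f (y i) + g (y i) - (f (x i) + g (x i))\<bar>) \<le> (\<Sum>i<n. \<bar>f (y i) - f (x i)\<bar> + \<bar>g (y i) - g (x i)\<bar>)"
      by (intro sum_mono) arith
    also have "\<dots> = (\<Sum>i<n. \<bar>f (y i) - f (x i)\<bar>) + (\<Sum>i<n. \<bar>g (y i) - g (x i)\<bar>)" by (rule sum.distrib)
    also have "\<dots> < \<epsilon> / 2 + \<epsilon> / 2"
      using d1(2)[rule_format, of n x y] d2(2)[rule_format, of n x y] H by (intro add_strict_mono) auto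
    finally show "(\<Sum>i<n. \<bar>f (y i) + g (y i) - (f (x i) + g (x i))\<bar>) < \<epsilon>" by simp
  qed
qed

text \<open>The part of \<open>f\<close> above a high level \<open>N\<close> has small integral over the whole line, and the rest
  contributes at most \<open>N\<close> times the total length of the intervals.\<close>
lemma absolutely_continuous_indefinite_integral:
  fixes f :: "real \<Rightarrow> real"
  assumes f: "integrable lborel f" and nonneg: "\<And>x. 0 \<le> f x"
  shows "absolutely_continuous_on_interval (\<lambda>t. \<integral>s. indicator {..t} s * f s \<partial>lborel) a b"
  unfolding absolutely_continuous_on_interval_def
proof (intro allI impI)
  fix \<epsilon> :: real assume e: "\<epsilon> > 0"
  have [measurable]: "f \<in> borel_measurable borel" using f by auto
  have fi: "integrable lborel (\<lambda>s. indicator A s * f s)" if "A \<in> sets borel" for A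
    using integrable_mult_indicator[of A lborel f] f that by simp
  have "(\<lambda>n. \<integral>s. f s - min (f s) (real n) \<partial>lborel) \<longlonglongrightarrow> (\<integral>s. 0 \<partial>(lborel :: real measure))"
  proof (rule integral_dominated_convergence[where w=f])
    show "AE s in lborel. (\<lambda>n. f s - min (f s) (real n)) \<longlonglongrightarrow> 0"
    proof (rule AE_I2)
      fix s
      have "\<forall>\<^sub>F n in sequentially. f s - min (f s) (real n) = 0"
        using eventually_ge_at_top[of "nat \<lceil>f s\<rceil>"] by eventually_elim linarith
      then show "(\<lambda>n. f s - min (f s) (real n)) \<longlonglongrightarrow> 0" by (rule tendsto_eventually)
    qed
    show "\<And>n. AE s in lborel. norm (f s - min (f s) (real n)) \<le> f s"
      using nonneg by (intro AE_I2) (simp add: min_def)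
  qed (use f in auto)
  then have "(\<lambda>n. \<integral>s. f s - min (f s) (real n) \<partial>lborel) \<longlonglongrightarrow> 0" by simp
  from order_tendstoD(2)[OF this, of "\<epsilon>/2"] e
  obtain N :: nat where N: "(\<integral>s. f s - min (f s) (real N) \<partial>lborel) < \<epsilon> / 2"
    by (auto simp: eventually_sequentially)
  define \<delta> where "\<delta> = \<epsilon> / (2 * (real N + 1))"
  have d: "\<delta> > 0" using e by (simp add: \<delta>_def)
  have Nd: "real N * \<delta> \<le> \<epsilon> / 2" using e by (simp add: \<delta>_def field_simps)
  have minint: "integrable lborel (\<lambda>s. f s - min (f s) (real N))"
    by (rule Bochner_Integration.integrable_bound[OF f]) (use nonneg in \<open>auto simp: min_def\<close>)
  show "\<exists>\<delta>>0. \<forall>(n::nat) x y.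
        (\<forall>i<n. a \<le> x i \<and> x i \<le> y i \<and> y i \<le> b) \<longrightarrow>
        disjoint_family_on (\<lambda>i. {x i<..<y i}) {..<n} \<longrightarrow>
        (\<Sum>i<n. y i - x i) < \<delta> \<longrightarrow>
        (\<Sum>i<n. \<bar>(\<integral>s. indicator {..y i} s * f s \<partial>lborel) - (\<integral>s. indicator {..x i} s * f s \<partial>lborel)\<bar>) < \<epsilon>"
  proof (intro exI conjI allI impI)
    show "\<delta> > 0" by fact
    fix n :: nat and x y :: "nat \<Rightarrow> real"
    assume xy: "\<forall>i<n. a \<le> x i \<and> x i \<le> y i \<and> y i \<le> b"
      and dis: "disjoint_family_on (\<lambda>i. {x i<..<y i}) {..<n}" and len: "(\<Sum>i<n. y i - x i) < \<delta>"
    have fin: "emeasure lborel {x i<..<y i} < top" for i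
      using emeasure_bounded_finite[of "{x i<..<y i}"] by simp
    have ind1: "(\<Sum>i<n. indicator {x i<..<y i} s :: real) \<le> 1" for s
    proof (cases "\<exists>i<n. s \<in> {x i<..<y i}")
      case True
      then obtain i where i: "i < n" "s \<in> {x i<..<y i}" by blast
      have "(\<Sum>j<n. indicator {x j<..<y j} s :: real) = (\<Sum>j<n. if j = i then 1 else 0)"
      proof (intro sum.cong refl)
        fix j assume "j \<in> {..<n}"
        then have "j \<noteq> i \<Longrightarrow> s \<notin> {x j<..<y j}"
          using dis i unfolding disjoint_family_on_def by blast
        then show "indicator {x j<..<y j} s = (if j = i then 1 else 0 :: real)"
          using i by (simp add: indicator_def)
      qed
      then show ?thesis using i by simp
    next
      case False
      then have "(\<Sum>j<n. indicator {x j<..<y j} s :: real) = 0"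
        by (intro sum.neutral) (auto simp: indicator_def)
      then show ?thesis by simp
    qed
    have "(\<Sum>i<n. \<bar>(\<integral>s. indicator {..y i} s * f s \<partial>lborel) - (\<integral>s. indicator {..x i} s * f s \<partial>lborel)\<bar>)
        = (\<Sum>i<n. \<integral>s. indicator {x i<..<y i} s * f s \<partial>lborel)"
    proof (rule sum.cong)
      fix i assume "i \<in> {..<n}"
      then have i: "x i \<le> y i" using xy by auto
      have "(\<integral>s. indicator {..y i} s * f s \<partial>lborel) - (\<integral>s. indicator {..x i} s * f s \<partial>lborel)
          = (\<integral>s. indicator {..y i} s * f s - indicator {..x i} s * f s \<partial>lborel)"
        by (rule Bochner_Integration.integral_diff[symmetric]) (auto intro: fi)
      also have "\<dots> = (\<integral>s. indicator {x i<..<y i} s * f s \<partial>lborel)"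
      proof (rule integral_cong_AE)
        show "AE s in lborel. indicator {..y i} s * f s - indicator {..x i} s * f s = indicator {x i<..<y i} s * f s"
          using AE_lborel_singleton[of "y i"] by eventually_elim (use i in \<open>auto simp: indicator_def\<close>)
      qed auto
      finally show "\<bar>(\<integral>s. indicator {..y i} s * f s \<partial>lborel) - (\<integral>s. indicator {..x i} s * f s \<partial>lborel)\<bar>
           = (\<integral>s. indicator {x i<..<y i} s * f s \<partial>lborel)"
        using nonneg by (simp add: integral_nonneg_AE)
    qed auto
    also have "\<dots> \<le> (\<Sum>i<n. \<integral>s. indicator {x i<..<y i} s * real N + indicator {x i<..<y i} s * (f s - min (f s) (real N)) \<partial>lborel)"
    proof (intro sum_mono integral_mono)
      fix i
      show "integrable lborel (\<lambda>s. indicator {x i<..<y i} s * real N + indicator {x i<..<y i} s * (f s - min (f s) (real N)))"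
        using integrable_mult_indicator[of "{x i<..<y i}" lborel "\<lambda>s. f s - min (f s) (real N)"] minint fin[of i]
        by (intro Bochner_Integration.integrable_add integrable_mult_left integrable_real_indicator) auto
      show "integrable lborel (\<lambda>s. indicator {x i<..<y i} s * f s)" by (rule fi) simp
    qed (auto simp: indicator_def)
    also have "\<dots> = (\<Sum>i<n. real N * (y i - x i) + (\<integral>s. indicator {x i<..<y i} s * (f s - min (f s) (real N)) \<partial>lborel))"
    proof (rule sum.cong)
      fix i assume i: "i \<in> {..<n}"
      have "(\<integral>s. indicator {x i<..<y i} s * real N + indicator {x i<..<y i} s * (f s - min (f s) (real N)) \<partial>lborel)
        = (\<integral>s. indicator {x i<..<y i} s * real N \<partial>lborel) + (\<integral>s. indicator {x i<..<y i} s * (f s - min (f s) (real N)) \<partial>lborel)"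
        using integrable_mult_indicator[of "{x i<..<y i}" lborel "\<lambda>s. f s - min (f s) (real N)"] minint fin[of i]
        by (intro Bochner_Integration.integral_add integrable_mult_left integrable_real_indicator) auto
      also have "(\<integral>s. indicator {x i<..<y i} s * real N \<partial>lborel) = real N * (y i - x i)"
        using i xy by simp
      finally show "(\<integral>s. indicator {x i<..<y i} s * real N + indicator {x i<..<y i} s * (f s - min (f s) (real N)) \<partial>lborel)
        = real N * (y i - x i) + (\<integral>s. indicator {x i<..<y i} s * (f s - min (f s) (real N)) \<partial>lborel)" .
    qed auto
    also have "\<dots> = real N * (\<Sum>i<n. y i - x i) + (\<Sum>i<n. \<integral>s. indicator {x i<..<y i} s * (f s - min (f s) (real N)) \<partial>lborel)"
      by (simp only: sum.distrib sum_distrib_left)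
    also have "(\<Sum>i<n. \<integral>s. indicator {x i<..<y i} s * (f s - min (f s) (real N)) \<partial>lborel)
       = (\<integral>s. (\<Sum>i<n. indicator {x i<..<y i} s * (f s - min (f s) (real N))) \<partial>lborel)"
      by (rule Bochner_Integration.integral_sum[symmetric])
         (use integrable_mult_indicator[of _ lborel "\<lambda>s. f s - min (f s) (real N)"] minint in auto)
    also have "\<dots> \<le> (\<integral>s. f s - min (f s) (real N) \<partial>lborel)"
    proof (rule integral_mono)
      show "integrable lborel (\<lambda>s. \<Sum>i<n. indicator {x i<..<y i} s * (f s - min (f s) (real N)))"
        by (rule Bochner_Integration.integrable_sum)
          (use integrable_mult_indicator[of _ lborel "\<lambda>s. f s - min (f s) (real N)"] minint in auto)
      fix s
      have "(\<Sum>i<n. indicator {x i<..<y i} s * (f s - min (f s) (real N))) =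
        (\<Sum>i<n. indicator {x i<..<y i} s) * (f s - min (f s) (real N))"
        by (simp only: sum_distrib_right)
      also have "\<dots> \<le> 1 * (f s - min (f s) (real N))"
        by (rule mult_right_mono[OF ind1]) simp
      finally show "(\<Sum>i<n. indicator {x i<..<y i} s * (f s - min (f s) (real N))) \<le> f s - min (f s) (real N)" by simp
    qed (rule minint)
    also have "real N * (\<Sum>i<n. y i - x i) \<le> real N * \<delta>"
      using len by (intro mult_left_mono) auto
    finally show "(\<Sum>i<n. \<bar>(\<integral>s. indicator {..y i} s * f s \<partial>lborel) - (\<integral>s. indicator {..x i} s * f s \<partial>lborel)\<bar>) < \<epsilon>"
      using N Nd by linarith
  qed
qed

text \<open>
  Used for \<open>u\<close>, to have a function on the whole line that can be translated inside the convolution.\<close>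
lemma absolutely_continuous_extend_left:
  assumes ac: "absolutely_continuous_on_interval u 0 T" and T: "0 \<le> T"
  shows "absolutely_continuous_on_interval (\<lambda>x. u (max 0 x)) a T"
  unfolding absolutely_continuous_on_interval_def
proof (intro allI impI)
  fix \<epsilon> :: real assume e: "\<epsilon> > 0"
  obtain d where d: "d > 0" "\<forall>(n::nat) x y.
        (\<forall>i<n. 0 \<le> x i \<and> x i \<le> y i \<and> y i \<le> T) \<longrightarrow>
        disjoint_family_on (\<lambda>i. {x i<..<y i}) {..<n} \<longrightarrow>
        (\<Sum>i<n. y i - x i) < d \<longrightarrow> (\<Sum>i<n. \<bar>u (y i) - u (x i)\<bar>) < \<epsilon>"
    using ac[unfolded absolutely_continuous_on_interval_def, rule_format, OF e] by blast
  show "\<exists>\<delta>>0. \<forall>(n::nat) x y.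
        (\<forall>i<n. a \<le> x i \<and> x i \<le> y i \<and> y i \<le> T) \<longrightarrow>
        disjoint_family_on (\<lambda>i. {x i<..<y i}) {..<n} \<longrightarrow>
        (\<Sum>i<n. y i - x i) < \<delta> \<longrightarrow> (\<Sum>i<n. \<bar>u (max 0 (y i)) - u (max 0 (x i))\<bar>) < \<epsilon>"
  proof (intro exI conjI allI impI)
    show "d > 0" by (rule d)
    fix n :: nat and x y :: "nat \<Rightarrow> real"
    assume xy: "\<forall>i<n. a \<le> x i \<and> x i \<le> y i \<and> y i \<le> T"
        and dis: "disjoint_family_on (\<lambda>i. {x i<..<y i}) {..<n}" and len: "(\<Sum>i<n. y i - x i) < d"
    have sub: "{max 0 (x i)<..<max 0 (y i)} \<subseteq> {x i<..<y i}" for i by auto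
    show "(\<Sum>i<n. \<bar>u (max 0 (y i)) - u (max 0 (x i))\<bar>) < \<epsilon>"
    proof (rule d(2)[rule_format])
      show "\<And>i. i < n \<Longrightarrow> 0 \<le> max 0 (x i) \<and> max 0 (x i) \<le> max 0 (y i) \<and> max 0 (y i) \<le> T"
        using xy T by (auto simp: max_def)
      show "disjoint_family_on (\<lambda>i. {max 0 (x i)<..<max 0 (y i)}) {..<n}"
        using dis sub unfolding disjoint_family_on_def by (meson disjoint_iff subsetD)
      have "(\<Sum>i<n. max 0 (y i) - max 0 (x i)) \<le> (\<Sum>i<n. y i - x i)"
        by (intro sum_mono) (use xy in \<open>auto simp: max_def\<close>)
      then show "(\<Sum>i<n. max 0 (y i) - max 0 (x i)) < d" using len by simp
    qed
  qed
qed

lemma absolutely_continuous_imp_continuous_on: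
  assumes "absolutely_continuous_on_interval f a b"
  shows "continuous_on {a..b} f"
  unfolding continuous_on_iff
proof (intro ballI allI impI)
  fix x e assume x: "x \<in> {a..b}" and e: "0 < (e::real)"
  obtain d where d: "d > 0" "\<forall>(n::nat) x y.
        (\<forall>i<n. a \<le> x i \<and> x i \<le> y i \<and> y i \<le> b) \<longrightarrow>
        disjoint_family_on (\<lambda>i. {x i<..<y i}) {..<n} \<longrightarrow>
        (\<Sum>i<n. y i - x i) < d \<longrightarrow> (\<Sum>i<n. \<bar>f (y i) - f (x i)\<bar>) < e"
    using assms[unfolded absolutely_continuous_on_interval_def, rule_format, OF e] by blast
  have one: "\<bar>f q - f p\<bar> < e" if "a \<le> p" "p \<le> q" "q \<le> b" "q - p < d" for p q
    using d(2)[rule_format, of 1 "\<lambda>_. p" "\<lambda>_. q"] that by (simp add: disjoint_family_on_def)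
  show "\<exists>d>0. \<forall>x'\<in>{a..b}. dist x' x < d \<longrightarrow> dist (f x') (f x) < e"
  proof (intro exI conjI ballI impI)
    fix x' assume x': "x' \<in> {a..b}" "dist x' x < d"
    show "dist (f x') (f x) < e"
      using one[of x x'] one[of x' x] x x' by (cases "x \<le> x'") (auto simp: dist_real_def)
  qed (rule d)
qed

lemma continuous_bounded_on_Icc:
  fixes f :: "real \<Rightarrow> 'a :: real_normed_vector"
  assumes "continuous_on UNIV f"
  obtains B where "0 \<le> B" "\<And>s. a \<le> s \<Longrightarrow> s \<le> b \<Longrightarrow> norm (f s) \<le> B"
proof -
  have "bounded (f ` {a..b})"
    by (intro compact_imp_bounded compact_continuous_image) (auto intro: continuous_on_subset[OF assms])
  then obtain B where "\<forall>s\<in>{a..b}. norm (f s) \<le> B" by (auto simp: bounded_iff)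
  then show ?thesis by (intro that[of "max B 0"]) (auto simp: le_max_iff_disj)
qed

lemma integrable_mult_continuous:
  fixes f g :: "real \<Rightarrow> real"
  assumes f: "integrable lborel (\<lambda>s. indicator {a<..<b} s * f s)" and g: "continuous_on UNIV g"
  shows "integrable lborel (\<lambda>s. indicator {a<..<b} s * f s * g s)"
proof -
  obtain B where B: "\<And>s. a \<le> s \<Longrightarrow> s \<le> b \<Longrightarrow> norm (g s) \<le> B"
    using continuous_bounded_on_Icc[OF g] by blast
  have [measurable]: "g \<in> borel_measurable borel" using g by (rule borel_measurable_continuous_onI)
  have m: "(\<lambda>s. indicator {a<..<b} s * f s) \<in> borel_measurable lborel" using f by auto
  show ?thesis
  proof (rule Bochner_Integration.integrable_bound[OF integrable_mult_right[OF f, of B]])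
    show "(\<lambda>s. indicator {a<..<b} s * f s * g s) \<in> borel_measurable lborel"
      using m by measurable
    show "AE s in lborel. norm (indicator {a<..<b} s * f s * g s) \<le> norm (B * (indicator {a<..<b} s * f s))"
    proof (rule AE_I2)
      fix s
      show "norm (indicator {a<..<b} s * f s * g s) \<le> norm (B * (indicator {a<..<b} s * f s))"
      proof (cases "s \<in> {a<..<b}")
        case True
        then have "\<bar>g s\<bar> \<le> \<bar>B\<bar>" using B[of s] by auto
        then show ?thesis using mult_left_mono[of "\<bar>g s\<bar>" "\<bar>B\<bar>" "\<bar>f s\<bar>"] True
          by (simp add: abs_mult mult.commute)
      qed simp
    qed
  qed
qed

text \<open>A system of short intervals stays one under translation, so that the total increment of \<open>z\<close>
  over it is small uniformly in the translation \<open>s\<close>; this bound is integrated against \<open>\<kappa>\<close>. The interval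
  \<open>[-T, T]\<close> contains all translates that matter.\<close>
lemma absolutely_continuous_convolution:
  fixes \<kappa> z :: "real \<Rightarrow> real"
  assumes \<kappa>: "integrable lborel (\<lambda>t. indicator {0<..<T} t * \<kappa> t)" "\<And>t. 0 \<le> \<kappa> t" "\<And>t. t \<le> 0 \<Longrightarrow> \<kappa> t = 0"
    and z: "continuous_on UNIV z" "\<And>t. t \<le> 0 \<Longrightarrow> z t = 0"
    and ac: "absolutely_continuous_on_interval z (-T) T" and T: "0 < T"
  shows "absolutely_continuous_on_interval (\<lambda>t. \<integral>s. \<kappa> s * z (t - s) \<partial>lborel) 0 T"
  unfolding absolutely_continuous_on_interval_def
proof (intro allI impI)
  fix \<epsilon> :: real assume e: "\<epsilon> > 0"
  define K where "K = (\<integral>t. indicator {0<..<T} t * \<kappa> t \<partial>lborel)"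
  have K: "K \<ge> 0" unfolding K_def using \<kappa> by (intro integral_nonneg_AE) auto
  define e' where "e' = \<epsilon> / (K + 1)"
  have e': "e' > 0" using e K by (simp add: e'_def)
  have e'K: "e' * K < \<epsilon>" using e K by (simp add: e'_def field_simps)
  have [measurable]: "z \<in> borel_measurable borel" using z(1) by (rule borel_measurable_continuous_onI)
  note int = integrable_mult_continuous[OF \<kappa>(1)]
  have zc: "continuous_on UNIV (\<lambda>s. z (t - s))" for t
    by (rule continuous_on_compose2[OF z(1)]) (auto intro!: continuous_intros)
  have conv: "(\<integral>s. \<kappa> s * z (t - s) \<partial>lborel) = (\<integral>s. indicator {0<..<T} s * \<kappa> s * z (t - s) \<partial>lborel)" if "t \<le> T" for t
  proof (rule Bochner_Integration.integral_cong[OF refl])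
    fix s
    show "\<kappa> s * z (t - s) = indicator {0<..<T} s * \<kappa> s * z (t - s)"
      using \<kappa>(3)[of s] z(2)[of "t - s"] that by (cases "s \<le> 0"; cases "T \<le> s") auto
  qed
  obtain d where d: "d > 0" "\<forall>(n::nat) x y.
        (\<forall>i<n. -T \<le> x i \<and> x i \<le> y i \<and> y i \<le> T) \<longrightarrow>
        disjoint_family_on (\<lambda>i. {x i<..<y i}) {..<n} \<longrightarrow>
        (\<Sum>i<n. y i - x i) < d \<longrightarrow> (\<Sum>i<n. \<bar>z (y i) - z (x i)\<bar>) < e'"
    using ac[unfolded absolutely_continuous_on_interval_def, rule_format, OF e'] by blast
  show "\<exists>\<delta>>0. \<forall>(n::nat) x y.
        (\<forall>i<n. 0 \<le> x i \<and> x i \<le> y i \<and> y i \<le> T) \<longrightarrow>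
        disjoint_family_on (\<lambda>i. {x i<..<y i}) {..<n} \<longrightarrow>
        (\<Sum>i<n. y i - x i) < \<delta> \<longrightarrow>
        (\<Sum>i<n. \<bar>(\<integral>s. \<kappa> s * z (y i - s) \<partial>lborel) - (\<integral>s. \<kappa> s * z (x i - s) \<partial>lborel)\<bar>) < \<epsilon>"
  proof (intro exI conjI allI impI)
    show "d > 0" by (rule d)
    fix n :: nat and x y :: "nat \<Rightarrow> real"
    assume xy: "\<forall>i<n. 0 \<le> x i \<and> x i \<le> y i \<and> y i \<le> T"
        and dis: "disjoint_family_on (\<lambda>i. {x i<..<y i}) {..<n}" and len: "(\<Sum>i<n. y i - x i) < d"
    let ?D = "\<lambda>i s. indicator {0<..<T} s * \<kappa> s * \<bar>z (y i - s) - z (x i - s)\<bar>"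
    have cD: "continuous_on UNIV (\<lambda>s. \<bar>z (y i - s) - z (x i - s)\<bar>)" for i
      by (intro continuous_intros zc)
    have "(\<Sum>i<n. \<bar>(\<integral>s. \<kappa> s * z (y i - s) \<partial>lborel) - (\<integral>s. \<kappa> s * z (x i - s) \<partial>lborel)\<bar>)
        \<le> (\<Sum>i<n. \<integral>s. ?D i s \<partial>lborel)"
    proof (rule sum_mono)
      fix i assume "i \<in> {..<n}"
      then have i: "x i \<le> T" "y i \<le> T" using xy by force+
      have eq: "(\<integral>s. \<kappa> s * z (y i - s) \<partial>lborel) - (\<integral>s. \<kappa> s * z (x i - s) \<partial>lborel) =
         (\<integral>s. indicator {0<..<T} s * \<kappa> s * z (y i - s) - indicator {0<..<T} s * \<kappa> s * z (x i - s) \<partial>lborel)"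
        unfolding conv[OF i(1)] conv[OF i(2)]
        by (rule Bochner_Integration.integral_diff[symmetric]) (intro int zc)+
      have "\<bar>(\<integral>s. \<kappa> s * z (y i - s) \<partial>lborel) - (\<integral>s. \<kappa> s * z (x i - s) \<partial>lborel)\<bar>
          \<le> (\<integral>s. \<bar>indicator {0<..<T} s * \<kappa> s * z (y i - s) - indicator {0<..<T} s * \<kappa> s * z (x i - s)\<bar> \<partial>lborel)"
        unfolding eq by (rule integral_abs_bound)
      also have "\<dots> = (\<integral>s. ?D i s \<partial>lborel)"
        by (intro Bochner_Integration.integral_cong refl)
           (use \<kappa>(2) in \<open>simp add: right_diff_distrib[symmetric] abs_mult\<close>)
      finally show "\<bar>(\<integral>s. \<kappa> s * z (y i - s) \<partial>lborel) - (\<integral>s. \<kappa> s * z (x i - s) \<partial>lborel)\<bar> \<le> (\<integral>s. ?D i s \<partial>lborel)" .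
    qed
    also have "\<dots> = (\<integral>s. (\<Sum>i<n. ?D i s) \<partial>lborel)"
      by (rule Bochner_Integration.integral_sum[symmetric]) (intro int cD)
    also have "\<dots> \<le> (\<integral>s. e' * (indicator {0<..<T} s * \<kappa> s) \<partial>lborel)"
    proof (rule integral_mono)
      show "integrable lborel (\<lambda>s. \<Sum>i<n. ?D i s)" by (intro Bochner_Integration.integrable_sum int cD)
      show "integrable lborel (\<lambda>s. e' * (indicator {0<..<T} s * \<kappa> s))" using \<kappa>(1) by simp
      fix s
      show "(\<Sum>i<n. ?D i s) \<le> e' * (indicator {0<..<T} s * \<kappa> s)"
      proof (cases "s \<in> {0<..<T}")
        case True
        have "(\<Sum>i<n. \<bar>z (y i - s) - z (x i - s)\<bar>) < e'"
        proof (rule d(2)[rule_format])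
          show "\<And>i. i < n \<Longrightarrow> - T \<le> x i - s \<and> x i - s \<le> y i - s \<and> y i - s \<le> T"
            using xy True by force
          show "disjoint_family_on (\<lambda>i. {x i - s<..<y i - s}) {..<n}"
            unfolding disjoint_family_on_def
          proof (intro ballI impI equals0I)
            fix i j r assume ij: "i \<in> {..<n}" "j \<in> {..<n}" "i \<noteq> j" "r \<in> {x i - s<..<y i - s} \<inter> {x j - s<..<y j - s}"
            then have "r + s \<in> {x i<..<y i} \<inter> {x j<..<y j}" by auto
            then show False using dis ij unfolding disjoint_family_on_def by blast
          qed
        qed (use len in simp)
        then have "\<kappa> s * (\<Sum>i<n. \<bar>z (y i - s) - z (x i - s)\<bar>) \<le> \<kappa> s * e'"
          using \<kappa>(2) by (intro mult_left_mono) auto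
        then show ?thesis using True by (simp add: sum_distrib_left mult.commute)
      qed simp
    qed
    also have "\<dots> = e' * K" by (simp add: K_def)
    finally show "(\<Sum>i<n. \<bar>(\<integral>s. \<kappa> s * z (y i - s) \<partial>lborel) - (\<integral>s. \<kappa> s * z (x i - s) \<partial>lborel)\<bar>) < \<epsilon>"
      using e'K by simp
  qed
qed

section \<open>The integrated equation\<close>

text \<open>The kernel is only Lebesgue measurable, and its values on the negative axis are arbitrary. For
  Fubini and for substitutions in the convolution it is replaced by a Borel function that vanishes
  outside the positive axis.\<close>
lemma borel_version_of_kernel:
  fixes k :: "real \<Rightarrow> real"
  assumes nonneg: "\<And>t. 0 < t \<Longrightarrow> 0 \<le> k t"
    and lap: "\<And>p. 0 < p \<Longrightarrow> laplace_exists k p"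
  obtains \<kappa> where "\<kappa> \<in> borel_measurable borel" "\<And>t. 0 \<le> \<kappa> t" "\<And>t. t \<le> 0 \<Longrightarrow> \<kappa> t = 0"
    "AE t in lborel. 0 < t \<longrightarrow> k t = \<kappa> t"
    "\<And>p. 0 < p \<Longrightarrow> integrable lborel (\<lambda>t. exp (- p * t) * \<kappa> t)"
    "\<And>p. 0 < p \<Longrightarrow> (\<integral>t. exp (- p * t) * \<kappa> t \<partial>lborel) = laplace k p"
proof -
  have int: "integrable lebesgue (\<lambda>t. indicator {0<..} t *\<^sub>R (exp (- p * t) * k t))" if "p > 0" for p
    using lap[OF that] unfolding laplace_exists_def set_integrable_def .
  obtain f where f[measurable]: "f \<in> borel_measurable lborel"
    and f': "AE t in lborel. indicator {0<..} t *\<^sub>R (exp (- 1 * t) * k t) = f t"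
    using completion_ex_borel_measurable_real[OF borel_measurable_integrable[OF int[of 1]]] by auto
  define \<kappa> where "\<kappa> = (\<lambda>t. if 0 < t then max 0 (exp t * f t) else 0)"
  have m[measurable]: "\<kappa> \<in> borel_measurable borel"
    using f unfolding \<kappa>_def by simp
  have ae: "AE t in lborel. 0 < t \<longrightarrow> k t = \<kappa> t"
    using f'
  proof eventually_elim
    case (elim t)
    show ?case
    proof
      assume t: "0 < t"
      then have "f t = exp (-t) * k t" using elim by simp
      then have "exp t * f t = k t" by (simp add: mult.assoc[symmetric] exp_add[symmetric])
      then show "k t = \<kappa> t" using nonneg[OF t] t by (simp add: \<kappa>_def)
    qed
  qed
  have eq: "AE t in lebesgue. indicator {0<..} t *\<^sub>R (exp (- p * t) * k t) = exp (- p * t) * \<kappa> t" for p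
    using AE_completion[OF ae] by eventually_elim (auto simp: \<kappa>_def)
  have meas: "(\<lambda>t. exp (- p * t) * \<kappa> t) \<in> borel_measurable lborel" for p by simp
  have intk: "integrable lebesgue (\<lambda>t. exp (- p * t) * \<kappa> t)" if "p > 0" for p
    by (rule integrable_cong_AE_imp[OF int[OF that] measurable_completion[OF meas] eq])
  show ?thesis
  proof (rule that[of \<kappa>])
    fix p :: real assume p: "0 < p"
    show "integrable lborel (\<lambda>t. exp (- p * t) * \<kappa> t)"
      using intk[OF p] integrable_completion[OF meas] by blast
    have "laplace k p = (\<integral>t. exp (- p * t) * \<kappa> t \<partial>lebesgue)"
      unfolding laplace_def set_lebesgue_integral_def
      by (rule integral_cong_AE[OF borel_measurable_integrable[OF int[OF p]] measurable_completion[OF meas] eq])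
    then show "(\<integral>t. exp (- p * t) * \<kappa> t \<partial>lborel) = laplace k p"
      using integral_completion[OF meas, of p] by simp
  qed (use m ae in \<open>auto simp: \<kappa>_def\<close>)
qed

lemma AE_reflect:
  fixes P :: "real \<Rightarrow> bool"
  assumes "AE x in lborel. P x"
  shows "AE x in lborel. P (t - x)"
proof -
  from assms obtain N where N: "{x \<in> space lborel. \<not> P x} \<subseteq> N" "emeasure lborel N = 0" "N \<in> sets lborel"
    by (rule AE_E)
  have "AE x in lborel. x \<notin> N" using N by (intro AE_not_in) auto
  then have "AE x in lborel. t + (-1) * x \<notin> N"
    using N(3) by (intro AE_borel_affine) (auto simp: pred_def)
  then show ?thesis by eventually_elim (use N(1) in auto)
qed

text \<open>Splitting \<open>u = z + 1\<close> separates a term in which \<open>z\<close> is continuous on the whole line from the indefinite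
  integral of the kernel, whose derivative cancels the term \<open>k t * u 0\<close> of the differential operator.\<close>
lemma convolution_eq_kernel_integral:
  fixes k \<kappa> u :: "real \<Rightarrow> real"
  defines "z \<equiv> \<lambda>t. u (max 0 t) - 1"
  assumes \<kappa>[measurable]: "\<kappa> \<in> borel_measurable borel" and \<kappa>0: "\<And>t. t \<le> 0 \<Longrightarrow> \<kappa> t = 0"
    and ae: "AE t in lborel. 0 < t \<longrightarrow> k t = \<kappa> t"
    and int: "integrable lborel (\<lambda>s. indicator {0<..<T} s * \<kappa> s)"
    and z: "continuous_on UNIV z" "\<And>t. t \<le> 0 \<Longrightarrow> z t = 0"
    and t: "0 \<le> t" "t \<le> T"
  shows "convolution k u t = (\<integral>s. \<kappa> s * z (t - s) \<partial>lborel)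
            + (\<integral>s. indicator {..t} s * (indicator {0<..<T} s * \<kappa> s) \<partial>lborel)"
proof -
  have [measurable]: "z \<in> borel_measurable borel" using z(1) by (rule borel_measurable_continuous_onI)
  have zc: "continuous_on UNIV (\<lambda>s. z (t - s))" for t
    by (rule continuous_on_compose2[OF z(1)]) (auto intro!: continuous_intros)
  let ?g = "\<lambda>s. indicator {0<..<t} s * (\<kappa> (t - s) * (z s + 1))"
  have gm: "?g \<in> borel_measurable lborel" by measurable
  have "AE s in lborel. 0 < t - s \<longrightarrow> k (t - s) = \<kappa> (t - s)"
    by (rule AE_reflect[OF ae])
  then have "AE s in lborel. ?g s = indicator {0<..<t} s *\<^sub>R (k (t - s) * u s)"
    by eventually_elim (auto simp: indicator_def z_def max_def)
  then have eqAE: "AE s in lebesgue. ?g s = indicator {0<..<t} s *\<^sub>R (k (t - s) * u s)"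
    by (rule AE_completion)
  have gm': "?g \<in> borel_measurable lebesgue" by (rule measurable_completion[OF gm])
  have "convolution k u t = (\<integral>s. ?g s \<partial>lebesgue)"
    unfolding convolution_def set_lebesgue_integral_def
    by (rule integral_cong_AE[symmetric, OF gm' borel_measurable_AE[OF gm' eqAE] eqAE])
  also have "\<dots> = (\<integral>s. ?g s \<partial>lborel)" by (rule integral_completion[OF gm])
  also have "\<dots> = (\<integral>s. ?g (t + (-1) * s) \<partial>lborel)"
    by (subst lborel_integral_real_affine[where c="-1" and t=t]) auto
  also have "\<dots> = (\<integral>s. indicator {0<..<T} s * \<kappa> s * z (t - s) + indicator {..t} s * (indicator {0<..<T} s * \<kappa> s) \<partial>lborel)"
  proof (rule integral_cong_AE)
    show "AE s in lborel. ?g (t + (-1) * s) = indicator {0<..<T} s * \<kappa> s * z (t - s) + indicator {..t} s * (indicator {0<..<T} s * \<kappa> s)"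
      using AE_lborel_singleton[of t]
    proof eventually_elim
      case (elim s)
      show ?case using elim t \<kappa>0[of s] z(2)[of "t - s"]
        by (cases "s \<le> 0"; cases "t \<le> s") (auto simp: indicator_def algebra_simps)
    qed
  qed measurable
  also have "\<dots> = (\<integral>s. indicator {0<..<T} s * \<kappa> s * z (t - s) \<partial>lborel)
        + (\<integral>s. indicator {..t} s * (indicator {0<..<T} s * \<kappa> s) \<partial>lborel)"
    using integrable_mult_indicator[OF _ int, of "{..t}"]
    by (intro Bochner_Integration.integral_add integrable_mult_continuous int zc) auto
  also have "(\<integral>s. indicator {0<..<T} s * \<kappa> s * z (t - s) \<partial>lborel) = (\<integral>s. \<kappa> s * z (t - s) \<partial>lborel)"
  proof (rule Bochner_Integration.integral_cong[OF refl])
    fix s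
    show "indicator {0<..<T} s * \<kappa> s * z (t - s) = \<kappa> s * z (t - s)"
      using \<kappa>0[of s] z(2)[of "t - s"] t by (cases "s \<le> 0"; cases "T \<le> s") auto
  qed
  finally show ?thesis .
qed

text \<open>Both sides of the differential equation are integrated over \<open>[0, T]\<close>. The contributions of \<open>k\<close> alone cancel.\<close>
lemma integrated_cauchy_equation:
  fixes k \<kappa> u :: "real \<Rightarrow> real"
  defines "z \<equiv> \<lambda>t. u (max 0 t) - 1"
  assumes \<kappa>[measurable]: "\<kappa> \<in> borel_measurable borel" and \<kappa>_nonneg: "\<And>t. 0 \<le> \<kappa> t"
    and \<kappa>0: "\<And>t. t \<le> 0 \<Longrightarrow> \<kappa> t = 0"
    and ae: "AE t in lborel. 0 < t \<longrightarrow> k t = \<kappa> t"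
    and int: "\<And>T. integrable lborel (\<lambda>s. indicator {0<..<T} s * \<kappa> s)"
    and sol: "cauchy_solution k \<mu> u"
  shows "continuous_on UNIV z" "\<And>t. t \<le> 0 \<Longrightarrow> z t = 0"
    "\<And>T. 0 < T \<Longrightarrow> (\<integral>s. \<kappa> s * z (T - s) \<partial>lborel) = \<mu> * (\<integral>s. indicator {0<..} s * z (T - s) \<partial>lborel) + \<mu> * T"
proof -
  have u0: "u 0 = 1" and ac: "\<And>T. 0 < T \<Longrightarrow> absolutely_continuous_on_interval u 0 T"
    and eq: "AE t in lebesgue. 0 < t \<longrightarrow> convolution k u field_differentiable at t \<and> diff_conv k u t = \<mu> * u t"
    using sol by (auto simp: cauchy_solution_def)
  show z0: "\<And>t. t \<le> 0 \<Longrightarrow> z t = 0" by (simp add: z_def u0 max_def)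
  have zac: "absolutely_continuous_on_interval z (-T) T" if "0 < T" for T
    using absolutely_continuous_extend_left[OF ac[OF that], of "-T"] that
    unfolding z_def absolutely_continuous_on_interval_def by simp
  show zc: "continuous_on UNIV z"
    unfolding continuous_on_eq_continuous_at[OF open_UNIV]
  proof
    fix x
    have "continuous_on {-(\<bar>x\<bar>+1)<..<\<bar>x\<bar>+1} z"
      using absolutely_continuous_imp_continuous_on[OF zac[of "\<bar>x\<bar>+1"]]
      by (rule continuous_on_subset) auto
    then show "isCont z x" by (rule continuous_on_interior) (auto simp: interior_open)
  qed
  have [measurable]: "z \<in> borel_measurable borel" using zc by (rule borel_measurable_continuous_onI)
  fix T :: real assume T: "0 < T"
  define A where "A = (\<lambda>t. \<integral>s. \<kappa> s * z (t - s) \<partial>lborel)"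
  define I where "I = (\<lambda>t. \<integral>s. indicator {..t} s * (indicator {0<..<T} s * \<kappa> s) \<partial>lborel)"
  have conv: "convolution k u t = A t + I t" if "0 \<le> t" "t \<le> T" for t
    unfolding A_def I_def z_def
    by (rule convolution_eq_kernel_integral[OF \<kappa> \<kappa>0 ae int _ _ that])
       (use zc z0 in \<open>auto simp: z_def\<close>)
  have acF: "absolutely_continuous_on_interval (\<lambda>t. A t + I t) 0 T"
    unfolding A_def I_def
    by (intro absolutely_continuous_add absolutely_continuous_convolution absolutely_continuous_indefinite_integral
          int zc z0 \<kappa>0 \<kappa>_nonneg zac T mult_nonneg_nonneg) (auto simp: \<kappa>_nonneg)
  from eq obtain N where N: "{t \<in> space lebesgue. \<not> (0 < t \<longrightarrow> convolution k u field_differentiable at t \<and> diff_conv k u t = \<mu> * u t)} \<subseteq> N"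
    "emeasure lebesgue N = 0" "N \<in> sets lebesgue" by (rule AE_E)
  from AE_completion[OF ae] obtain N' where N': "{t \<in> space lebesgue. \<not> (0 < t \<longrightarrow> k t = \<kappa> t)} \<subseteq> N'"
    "emeasure lebesgue N' = 0" "N' \<in> sets lebesgue" by (rule AE_E)
  have neg: "negligible N" "negligible N'" "negligible {0,T}"
    using N N' by (auto simp: negligible_iff_null_sets)
  have "((\<lambda>t. k t + \<mu> * u t) has_integral ((A T + I T) - (A 0 + I 0))) {0..T}"
  proof (rule absolutely_continuous_ftc[OF less_imp_le[OF T] acF])
    show "negligible (N \<union> {0,T})" by (rule negligible_Un[OF neg(1,3)])
    fix t assume "t \<in> {0..T} - (N \<union> {0,T})"
    then have t: "0 < t" "t < T" "t \<notin> N" by auto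
    then have "convolution k u field_differentiable at t" "diff_conv k u t = \<mu> * u t"
      using N(1) by auto
    then have "(convolution k u has_real_derivative (k t + \<mu> * u t)) (at t)"
      using u0 by (auto simp: diff_conv_def field_differentiable_derivI algebra_simps
          dest!: field_differentiable_derivI)
    then have "((\<lambda>t. A t + I t) has_real_derivative (k t + \<mu> * u t)) (at t)"
      by (rule has_field_derivative_transform_within_open[where S="{0<..<T}"]) (use t conv in auto)
    then show "((\<lambda>t. A t + I t) has_real_derivative (k t + \<mu> * u t)) (at t within {0..T})"
      by (rule has_field_derivative_at_within)
  qed
  moreover have "A 0 = 0" unfolding A_def
  proof (rule integral_eq_zero_AE, rule AE_I2)
    fix s show "\<kappa> s * z (0 - s) = 0" using \<kappa>0[of s] z0[of "0 - s"] by (cases "s \<le> 0") auto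
  qed
  moreover have "I 0 = 0" unfolding I_def
    by (rule integral_eq_zero_AE, rule AE_I2) (auto simp: indicator_def)
  ultimately have 1: "((\<lambda>t. k t + \<mu> * u t) has_integral (A T + I T)) {0..T}" by simp
  have IT: "I T = (\<integral>s. indicator {0<..<T} s * \<kappa> s \<partial>lborel)"
    unfolding I_def by (rule Bochner_Integration.integral_cong) (auto simp: indicator_def)
  have "((\<lambda>s. indicator {0<..<T} s * \<kappa> s) has_integral I T) UNIV"
    unfolding IT by (rule has_integral_integral_lborel[OF int])
  then have "((\<lambda>s. if s \<in> {0..T} then \<kappa> s else 0) has_integral I T) UNIV"
    by (rule has_integral_spike[OF neg(3), rotated]) (auto simp: indicator_def)
  then have "(\<kappa> has_integral I T) {0..T}" by (simp only: has_integral_restrict_UNIV)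
  then have k: "(k has_integral I T) {0..T}"
  proof (rule has_integral_spike[OF negligible_Un[OF neg(2,3)], rotated])
    fix x assume "x \<in> {0..T} - (N' \<union> {0,T})"
    then have "0 < x" "x \<notin> N'" by auto
    then show "k x = \<kappa> x" using N'(1) by auto
  qed
  define J where "J = integral {0..T} z"
  have "(z has_integral J) {0..T}"
    unfolding J_def by (intro integrable_integral integrable_continuous_interval continuous_on_subset[OF zc]) auto
  from has_integral_add[OF this has_integral_const_real[of 1 0 T]]
  have "((\<lambda>t. z t + 1) has_integral (J + T)) {0..T}" using T by simp
  then have "(u has_integral (J + T)) {0..T}"
    by (rule has_integral_eq[rotated]) (auto simp: z_def max_def)
  from has_integral_add[OF k has_integral_mult_right[OF this, of \<mu>]]
  have 2: "((\<lambda>t. k t + \<mu> * u t) has_integral (I T + \<mu> * (J + T))) {0..T}" .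
  have AT: "A T = \<mu> * (J + T)" using has_integral_unique[OF 1 2] by simp
  have "(\<integral>s. indicator {0<..} s * z (T - s) \<partial>lborel) = (\<integral>s. indicator {0<..} (T + (-1) * s) * z (T - (T + (-1) * s)) \<partial>lborel)"
    by (subst lborel_integral_real_affine[where c="-1" and t=T]) auto
  also have "\<dots> = (LINT s:{0..T}|lborel. z s)"
    unfolding set_lebesgue_integral_def
  proof (rule integral_cong_AE)
    show "AE s in lborel. indicator {0<..} (T + (-1) * s) * z (T - (T + (-1) * s)) = indicator {0..T} s *\<^sub>R z s"
      using AE_lborel_singleton[of T] by eventually_elim (use z0 in \<open>auto simp: indicator_def\<close>)
  qed auto
  also have "\<dots> = J" unfolding J_def
    by (intro set_borel_integral_eq_integral(2) borel_integrable_atLeastAtMost' continuous_on_subset[OF zc]) auto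
  finally show "(\<integral>s. \<kappa> s * z (T - s) \<partial>lborel) = \<mu> * (\<integral>s. indicator {0<..} s * z (T - s) \<partial>lborel) + \<mu> * T"
    using AT by (simp add: A_def algebra_simps)
qed

section \<open>Uniqueness for convolution equations of the first kind\<close>

lemma fubini_product_bound:
  fixes F :: "real \<Rightarrow> real \<Rightarrow> complex" and a b :: "real \<Rightarrow> real"
  assumes F[measurable]: "(\<lambda>(x, y). F x y) \<in> borel_measurable (lborel \<Otimes>\<^sub>M lborel)"
    and a: "integrable lborel a" and b: "integrable lborel b"
    and bound: "\<And>x y. norm (F x y) \<le> a x * b y"
  shows "(\<integral>x. \<integral>y. F x y \<partial>lborel \<partial>lborel) = (\<integral>y. \<integral>x. F x y \<partial>lborel \<partial>lborel)"
proof -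
  have [measurable]: "a \<in> borel_measurable borel" "b \<in> borel_measurable borel" using a b by auto
  have ab: "integrable (lborel \<Otimes>\<^sub>M lborel) (\<lambda>(x, y). a x * b y)"
  proof (rule lborel_pair.Fubini_integrable)
    show "(\<lambda>(x, y). a x * b y) \<in> borel_measurable (lborel \<Otimes>\<^sub>M lborel)" by measurable
    show "integrable lborel (\<lambda>x. \<integral>y. norm (case (x, y) of (x, y) \<Rightarrow> a x * b y) \<partial>lborel)"
      using a b by (simp add: abs_mult)
    show "AE x in lborel. integrable lborel (\<lambda>y. case (x, y) of (x, y) \<Rightarrow> a x * b y)"
      using b by simp
  qed
  have "integrable (lborel \<Otimes>\<^sub>M lborel) (\<lambda>(x, y). F x y)"
    by (rule Bochner_Integration.integrable_bound[OF ab F]) (use bound in \<open>auto intro!: AE_I2 order_trans[OF bound]\<close>)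
  from lborel_pair.Fubini_integral[OF this] show ?thesis by simp
qed

lemma lborel_integral_reflect:
  fixes f :: "real \<Rightarrow> 'a :: {banach, second_countable_topology}"
  shows "(\<integral>s. f (t - s) \<partial>lborel) = (\<integral>s. f s \<partial>lborel)"
  by (subst (2) lborel_integral_real_affine[where c="-1" and t=t]) auto

text \<open>Only the region \<open>0 < \<tau> < s < T\<close> contributes, where \<open>f\<close> and \<open>g\<close> are bounded. This gives a majorant of
  product form without any growth condition at infinity.\<close>
lemma convolution_interchange:
  fixes m :: "real \<Rightarrow> real" and f g :: "real \<Rightarrow> complex"
  assumes m[measurable]: "m \<in> borel_measurable borel" and m0: "\<And>s. s \<le> 0 \<Longrightarrow> m s = 0"
    and mint: "integrable lborel (\<lambda>s. indicator {0<..<T} s * m s)"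
    and f: "continuous_on UNIV f" "\<And>s. s \<le> 0 \<Longrightarrow> f s = 0"
    and g: "continuous_on UNIV g" "\<And>s. s \<le> 0 \<Longrightarrow> g s = 0"
  shows "(\<integral>s. g (T - s) * (\<integral>\<tau>. of_real (m \<tau>) * f (s - \<tau>) \<partial>lborel) \<partial>lborel) =
         (\<integral>\<tau>. of_real (m \<tau>) * (\<integral>s. g (T - s) * f (s - \<tau>) \<partial>lborel) \<partial>lborel)"
proof -
  have [measurable]: "f \<in> borel_measurable borel" "g \<in> borel_measurable borel"
    using f(1) g(1) by (auto intro: borel_measurable_continuous_onI)
  obtain Bf where Bf: "0 \<le> Bf" "\<And>s. 0 \<le> s \<Longrightarrow> s \<le> T \<Longrightarrow> norm (f s) \<le> Bf"
    using continuous_bounded_on_Icc[OF f(1), of 0 T] by blast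
  obtain Bg where Bg: "0 \<le> Bg" "\<And>s. 0 \<le> s \<Longrightarrow> s \<le> T \<Longrightarrow> norm (g s) \<le> Bg"
    using continuous_bounded_on_Icc[OF g(1), of 0 T] by blast
  have "(\<integral>s. g (T - s) * (\<integral>\<tau>. of_real (m \<tau>) * f (s - \<tau>) \<partial>lborel) \<partial>lborel) =
        (\<integral>s. \<integral>\<tau>. of_real (m \<tau>) * (g (T - s) * f (s - \<tau>)) \<partial>lborel \<partial>lborel)"
    by (subst integral_mult_right_zero[symmetric]) (simp add: mult_ac)
  also have "\<dots> = (\<integral>\<tau>. \<integral>s. of_real (m \<tau>) * (g (T - s) * f (s - \<tau>)) \<partial>lborel \<partial>lborel)"
  proof (rule fubini_product_bound)
    show "(\<lambda>(s, \<tau>). of_real (m \<tau>) * (g (T - s) * f (s - \<tau>))) \<in> borel_measurable (lborel \<Otimes>\<^sub>M lborel)"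
      by measurable
    show "integrable lborel (\<lambda>s. Bg * Bf * indicator {0<..<T} s)"
      using emeasure_bounded_finite[of "{0<..<T}"] by (intro integrable_mult_right integrable_real_indicator) auto
    show "integrable lborel (\<lambda>s. \<bar>indicator {0<..<T} s * m s\<bar>)" using mint by (rule integrable_abs)
    fix s \<tau>
    show "norm (of_real (m \<tau>) * (g (T - s) * f (s - \<tau>))) \<le> Bg * Bf * indicator {0<..<T} s * \<bar>indicator {0<..<T} \<tau> * m \<tau>\<bar>"
    proof (cases "0 < \<tau> \<and> \<tau> < s \<and> s < T")
      case True
      then have "norm (g (T - s)) * norm (f (s - \<tau>)) \<le> Bg * Bf"
        by (intro mult_mono Bg Bf) auto
      then have "\<bar>m \<tau>\<bar> * (norm (g (T - s)) * norm (f (s - \<tau>))) \<le> \<bar>m \<tau>\<bar> * (Bg * Bf)"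
        by (rule mult_left_mono) simp
      then show ?thesis using True by (simp add: norm_mult mult_ac)
    next
      case False
      then have "m \<tau> = 0 \<or> g (T - s) = 0 \<or> f (s - \<tau>) = 0"
        using m0[of \<tau>] g(2)[of "T - s"] f(2)[of "s - \<tau>"] by linarith
      then show ?thesis using Bf(1) Bg(1) by (auto intro!: mult_nonneg_nonneg)
    qed
  qed
  finally show ?thesis by simp
qed

text \<open>With \<open>P\<close> and \<open>Q\<close> the indefinite integrals of \<open>d(s)\<close> and \<open>s d(s)\<close>, the hypothesis says \<open>T P(T) = Q(T)\<close>.
  Differentiating this cancels \<open>T d(T)\<close> and leaves \<open>P = 0\<close>.\<close>
lemma convolution_with_identity_zero:
  fixes d :: "real \<Rightarrow> complex"
  assumes d: "continuous_on UNIV d" "\<And>s. s \<le> 0 \<Longrightarrow> d s = 0"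
    and eq: "\<And>T. 0 < T \<Longrightarrow> (\<integral>s. d (T - s) * of_real (max 0 s) \<partial>lborel) = 0"
  shows "d t = 0"
proof (cases "t > 0")
  case True
  define P where "P = (\<lambda>x. integral {0..x} d)"
  define Q where "Q = (\<lambda>x. integral {0..x} (\<lambda>s. of_real s * d s))"
  have ci: "continuous_on A d" for A by (rule continuous_on_subset[OF d(1)]) auto
  have ci2: "continuous_on A (\<lambda>s. of_real s * d s)" for A by (intro continuous_intros ci)
  have PQ: "of_real T * P T - Q T = 0" if T: "0 < T" for T
  proof -
    have "(\<integral>s. d (T - s) * of_real (max 0 s) \<partial>lborel) = (\<integral>s. d s * of_real (max 0 (T - s)) \<partial>lborel)"
      using lborel_integral_reflect[of "\<lambda>s. d s * of_real (max 0 (T - s))" T] by simp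
    also have "\<dots> = (LINT s:{0..T}|lborel. of_real (T - s) * d s)"
      unfolding set_lebesgue_integral_def
    proof (rule Bochner_Integration.integral_cong[OF refl])
      fix s show "d s * of_real (max 0 (T - s)) = indicat_real {0..T} s *\<^sub>R (of_real (T - s) * d s)"
        using d(2)[of s] by (cases "s \<le> 0"; cases "T \<le> s") (auto simp: indicator_def)
    qed
    also have "\<dots> = integral {0..T} (\<lambda>s. of_real (T - s) * d s)"
      by (intro set_borel_integral_eq_integral(2) borel_integrable_atLeastAtMost' continuous_intros ci)
    also have "\<dots> = integral {0..T} (\<lambda>s. of_real T * d s - of_real s * d s)"
      by (simp add: algebra_simps)
    also have "\<dots> = of_real T * P T - Q T"
      unfolding P_def Q_def
      by (subst Henstock_Kurzweil_Integration.integral_diff)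
         (auto intro!: integrable_continuous_interval continuous_intros ci)
    finally show ?thesis using eq[OF T] by simp
  qed
  have DP: "(P has_vector_derivative d x) (at x)" if "0 < x" for x
  proof -
    have "(P has_vector_derivative d x) (at x within {0..x+1})"
      unfolding P_def by (rule integral_has_vector_derivative[OF ci]) (use that in auto)
    then have "(P has_vector_derivative d x) (at x within {0<..<x+1})"
      by (rule has_vector_derivative_within_subset) auto
    then show ?thesis using that by (simp add: at_within_open[of x "{0<..<x+1}"])
  qed
  have DQ: "(Q has_vector_derivative (of_real x * d x)) (at x)" if "0 < x" for x
  proof -
    have "(Q has_vector_derivative (of_real x * d x)) (at x within {0..x+1})"
      unfolding Q_def by (rule integral_has_vector_derivative[OF ci2]) (use that in auto)
    then have "(Q has_vector_derivative (of_real x * d x)) (at x within {0<..<x+1})"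
      by (rule has_vector_derivative_within_subset) auto
    then show ?thesis using that by (simp add: at_within_open[of x "{0<..<x+1}"])
  qed
  have P0: "P x = 0" if x: "0 < x" for x
  proof -
    have "((\<lambda>x. x *\<^sub>R P x - Q x) has_vector_derivative ((x *\<^sub>R d x + 1 *\<^sub>R P x) - of_real x * d x)) (at x)"
      by (intro has_vector_derivative_diff has_vector_derivative_scaleR DP DQ DERIV_ident x)
    then have "((\<lambda>x. x *\<^sub>R P x - Q x) has_vector_derivative P x) (at x)"
      by (simp add: scaleR_conv_of_real)
    then have "((\<lambda>x. 0) has_vector_derivative P x) (at x)"
      by (rule has_vector_derivative_transform_within_open[where S="{0<..}"])
         (use x PQ in \<open>auto simp: scaleR_conv_of_real\<close>)
    then show ?thesis using vector_derivative_unique_at[OF _ has_vector_derivative_const] by blast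
  qed
  have "((\<lambda>x. 0) has_vector_derivative d t) (at t)"
    by (rule has_vector_derivative_transform_within_open[OF DP[OF True], where S="{0<..}"])
       (use True P0 in auto)
  then show ?thesis using vector_derivative_unique_at[OF _ has_vector_derivative_const] by blast
qed (use d in auto)

text \<open>The inner integral in \<open>convolution_interchange\<close> is symmetric in \<open>f\<close> and \<open>g\<close> up to a reflection. Hence
  \<open>g * (m * f) = f * (m * g)\<close>, and \<open>f\<close> and \<open>g\<close> have the same convolution with the function \<open>c t\<close>. The existence
  of one solution thus implies its uniqueness.\<close>
lemma first_kind_solution_unique:
  fixes m :: "real \<Rightarrow> real" and f g :: "real \<Rightarrow> complex"
  assumes m: "m \<in> borel_measurable borel" "\<And>s. s \<le> 0 \<Longrightarrow> m s = 0"
        "\<And>T. integrable lborel (\<lambda>s. indicator {0<..<T} s * m s)"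
    and f: "continuous_on UNIV f" "\<And>s. s \<le> 0 \<Longrightarrow> f s = 0"
    and g: "continuous_on UNIV g" "\<And>s. s \<le> 0 \<Longrightarrow> g s = 0"
    and c: "c \<noteq> 0"
    and ef: "\<And>t. 0 < t \<Longrightarrow> (\<integral>s. of_real (m s) * f (t - s) \<partial>lborel) = of_real (c * t)"
    and eg: "\<And>t. 0 < t \<Longrightarrow> (\<integral>s. of_real (m s) * g (t - s) \<partial>lborel) = of_real (c * t)"
  shows "f = g"
proof
  fix t
  have E: "(\<integral>s. of_real (m s) * h (t - s) \<partial>lborel) = of_real (c * max 0 t)"
    if "\<And>s. s \<le> 0 \<Longrightarrow> h s = 0" "\<And>t. 0 < t \<Longrightarrow> (\<integral>s. of_real (m s) * h (t - s) \<partial>lborel) = of_real (c * t)"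
    for h :: "real \<Rightarrow> complex" and t
  proof (cases "0 < t")
    case False
    have "(\<integral>s. of_real (m s) * h (t - s) \<partial>lborel) = 0"
    proof (rule integral_eq_zero_AE, rule AE_I2)
      fix s show "of_real (m s) * h (t - s) = 0"
        using m(2)[of s] that(1)[of "t - s"] False by (cases "s \<le> 0") auto
    qed
    then show ?thesis using False by (simp add: max_def)
  qed (use that in simp)
  have [measurable]: "f \<in> borel_measurable borel" "g \<in> borel_measurable borel"
    using f(1) g(1) by (auto intro: borel_measurable_continuous_onI)
  have swap: "(\<integral>s. g (T - s) * f (s - \<tau>) \<partial>lborel) = (\<integral>s. f (T - s) * g (s - \<tau>) \<partial>lborel)" for T \<tau>
    using lborel_integral_reflect[of "\<lambda>s. f (T - s) * g (s - \<tau>)" "T + \<tau>"]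
    by (simp add: algebra_simps)
  have int: "integrable lborel (\<lambda>s. h (T - s) * of_real (max 0 s))"
    if h: "continuous_on UNIV h" "\<And>s. s \<le> 0 \<Longrightarrow> h s = 0" for h :: "real \<Rightarrow> complex" and T
  proof -
    have "continuous_on A (\<lambda>s. h (T - s))" for A
      by (rule continuous_on_compose2[OF h(1)]) (auto intro!: continuous_intros)
    then have "integrable lborel (\<lambda>s. indicator {0..T} s *\<^sub>R (h (T - s) * of_real (max 0 s)))"
      by (intro borel_integrable_compact continuous_intros) auto
    moreover have "indicator {0..T} s *\<^sub>R (h (T - s) * of_real (max 0 s)) = h (T - s) * of_real (max 0 s)" for s
      using h(2)[of "T - s"] by (cases "s \<le> 0"; cases "T \<le> s") (auto simp: indicator_def)
    ultimately show ?thesis by simp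
  qed
  have "(\<lambda>s. f s - g s) t = 0"
  proof (rule convolution_with_identity_zero)
    show "continuous_on UNIV (\<lambda>s. f s - g s)" by (intro continuous_intros f g)
    fix T :: real assume T: "0 < T"
    have "(\<integral>s. g (T - s) * of_real (c * max 0 s) \<partial>lborel) = (\<integral>s. f (T - s) * of_real (c * max 0 s) \<partial>lborel)"
      using convolution_interchange[OF m(1,2) m(3)[of T] f g] convolution_interchange[OF m(1,2) m(3)[of T] g f]
      by (simp only: E[OF f(2) ef] E[OF g(2) eg] swap)
    then have "of_real c * (\<integral>s. g (T - s) * of_real (max 0 s) \<partial>lborel) = of_real c * (\<integral>s. f (T - s) * of_real (max 0 s) \<partial>lborel)"
      by (simp add: mult_ac)
    then have "(\<integral>s. g (T - s) * of_real (max 0 s) \<partial>lborel) = (\<integral>s. f (T - s) * of_real (max 0 s) \<partial>lborel)"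
      using c by simp
    then show "(\<integral>s. (f (T - s) - g (T - s)) * of_real (max 0 s) \<partial>lborel) = 0"
      by (simp add: left_diff_distrib int[OF f] int[OF g])
  qed (use f g in auto)
  then show "f t = g t" by simp
qed

section \<open>Holomorphic integrals and Stieltjes functions\<close>

text \<open>Dominated convergence for the difference quotients, which the mean value inequality bounds by
  the dominating function \<open>g\<close> of the derivatives.\<close>
lemma holomorphic_on_parametric_integral:
  fixes f f' :: "complex \<Rightarrow> 'a \<Rightarrow> complex"
  assumes S: "open S"
    and der: "\<And>p x. p \<in> S \<Longrightarrow> x \<in> space M \<Longrightarrow> ((\<lambda>p. f p x) has_field_derivative f' p x) (at p)"
    and int: "\<And>p. p \<in> S \<Longrightarrow> integrable M (f p)"
    and meas: "\<And>p. p \<in> S \<Longrightarrow> f' p \<in> borel_measurable M"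
    and dom: "\<And>p. p \<in> S \<Longrightarrow> \<exists>r>0. \<exists>g. integrable M g \<and> ball p r \<subseteq> S \<and> (\<forall>q\<in>ball p r. \<forall>x\<in>space M. norm (f' q x) \<le> g x)"
  shows "(\<lambda>p. \<integral>x. f p x \<partial>M) holomorphic_on S"
  unfolding holomorphic_on_open[OF S]
proof
  fix p assume p: "p \<in> S"
  obtain r g where r: "r > 0" and g: "integrable M g" and sub: "ball p r \<subseteq> S"
    and bd: "\<And>q x. q \<in> ball p r \<Longrightarrow> x \<in> space M \<Longrightarrow> norm (f' q x) \<le> g x"
    using dom[OF p] by blast
  define F where "F = (\<lambda>p. \<integral>x. f p x \<partial>M)"
  have "((\<lambda>q. (F q - F p) / (q - p)) \<longlongrightarrow> (\<integral>x. f' p x \<partial>M)) (at p)"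
    unfolding tendsto_at_iff_sequentially
  proof (intro allI impI)
    fix X assume X: "\<forall>i. X i \<in> UNIV - {p}" "X \<longlonglongrightarrow> p"
    have "\<forall>\<^sub>F n in sequentially. X n \<in> ball p r"
      using topological_tendstoD[OF X(2), of "ball p r"] r by simp
    then obtain N where N: "\<And>n. n \<ge> N \<Longrightarrow> X n \<in> ball p r" by (auto simp: eventually_sequentially)
    define Y where "Y = (\<lambda>n. X (n + N))"
    have Yb: "Y n \<in> ball p r" and Yp: "Y n \<noteq> p" for n using N X(1) by (auto simp: Y_def)
    have Yl: "Y \<longlonglongrightarrow> p" unfolding Y_def using X(2) by (rule LIMSEQ_ignore_initial_segment)
    have "(\<lambda>n. \<integral>x. (f (Y n) x - f p x) / (Y n - p) \<partial>M) \<longlonglongrightarrow> (\<integral>x. f' p x \<partial>M)"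
    proof (rule integral_dominated_convergence[where w=g])
      show "f' p \<in> borel_measurable M" by (rule meas[OF p])
      show "\<And>i. (\<lambda>x. (f (Y i) x - f p x) / (Y i - p)) \<in> borel_measurable M"
        using Yb sub
        by (intro borel_measurable_divide borel_measurable_diff borel_measurable_const
              borel_measurable_integrable int p) blast
      show "integrable M g" by fact
      show "AE x in M. (\<lambda>n. (f (Y n) x - f p x) / (Y n - p)) \<longlonglongrightarrow> f' p x"
      proof (rule AE_I2)
        fix x assume x: "x \<in> space M"
        have "((\<lambda>q. (f q x - f p x) / (q - p)) \<longlongrightarrow> f' p x) (at p)"
          using der[OF p x] by (simp add: has_field_derivative_iff)
        then show "(\<lambda>n. (f (Y n) x - f p x) / (Y n - p)) \<longlonglongrightarrow> f' p x"
          unfolding tendsto_at_iff_sequentially o_def using Yp Yl by auto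
      qed
      fix n
      show "AE x in M. norm ((f (Y n) x - f p x) / (Y n - p)) \<le> g x"
      proof (rule AE_I2)
        fix x assume x: "x \<in> space M"
        have "norm (f (Y n) x - f p x) \<le> g x * norm (Y n - p)"
        proof (rule field_differentiable_bound[of "ball p r" _ "\<lambda>q. f' q x"])
          show "\<And>z. z \<in> ball p r \<Longrightarrow> ((\<lambda>p. f p x) has_field_derivative f' z x) (at z within ball p r)"
            using der[OF _ x] sub by (blast intro: has_field_derivative_at_within)
        qed (use bd x Yb r in auto)
        then show "norm ((f (Y n) x - f p x) / (Y n - p)) \<le> g x"
          using Yp[of n] by (simp add: norm_divide divide_le_eq)
      qed
    qed
    also have "(\<lambda>n. \<integral>x. (f (Y n) x - f p x) / (Y n - p) \<partial>M) = (\<lambda>n. (F (Y n) - F p) / (Y n - p))"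
    proof
      fix n
      have "Y n \<in> S" using Yb sub by blast
      then show "(\<integral>x. (f (Y n) x - f p x) / (Y n - p) \<partial>M) = (F (Y n) - F p) / (Y n - p)"
        by (simp add: F_def int p)
    qed
    finally show "((\<lambda>q. (F q - F p) / (q - p)) \<circ> X) \<longlonglongrightarrow> (\<integral>x. f' p x \<partial>M)"
      unfolding Y_def o_def by (rule LIMSEQ_offset)
  qed
  then have "(F has_field_derivative (\<integral>x. f' p x \<partial>M)) (at p)" by (simp add: has_field_derivative_iff)
  then show "\<exists>f'. ((\<lambda>p. \<integral>x. f p x \<partial>M) has_field_derivative f') (at p)"
    unfolding F_def by blast
qed

lemma ball_half_Re:
  assumes "q \<in> ball p (Re p / 2)"
  shows "Re p / 2 < Re q"
proof -
  have "\<bar>Re (p - q)\<bar> < Re p / 2"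
    using assms abs_Re_le_cmod[of "p - q"] by (simp add: dist_norm)
  then have "\<bar>Re p - Re q\<bar> < Re p / 2" by simp
  then show ?thesis by linarith
qed

lemma open_right_half_plane: "open {p. 0 < Re p}"
  by (rule open_halfspace_Re_gt)

lemma integrable_complex_laplace:
  fixes m :: "real \<Rightarrow> real"
  assumes m: "m \<in> borel_measurable borel" "\<And>t. t \<le> 0 \<Longrightarrow> m t = 0"
    and int: "integrable lborel (\<lambda>t. exp (- Re p * t) * m t)"
  shows "integrable lborel (\<lambda>t. exp (- p * of_real t) * of_real (m t))"
proof (rule Bochner_Integration.integrable_bound[OF int])
  note [measurable] = m(1)
  show "(\<lambda>t. exp (- p * of_real t) * of_real (m t)) \<in> borel_measurable lborel" by measurable
qed (auto simp: norm_mult intro!: AE_I2)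

lemma complex_laplace_holomorphic:
  fixes m :: "real \<Rightarrow> real"
  assumes m[measurable]: "m \<in> borel_measurable borel" and m0: "\<And>t. t \<le> 0 \<Longrightarrow> m t = 0" "\<And>t. 0 \<le> m t"
    and int: "\<And>a. 0 < a \<Longrightarrow> integrable lborel (\<lambda>t. exp (- a * t) * m t)"
  shows "(\<lambda>p. \<integral>t. exp (- p * of_real t) * of_real (m t) \<partial>lborel) holomorphic_on {p. 0 < Re p}"
proof (rule holomorphic_on_parametric_integral[where f' = "\<lambda>p t. - of_real t * exp (- p * of_real t) * of_real (m t)", OF open_right_half_plane])
  fix p assume "p \<in> {p. 0 < Re p}"
  then have p: "0 < Re p" by simp
  show "integrable lborel (\<lambda>t. exp (- p * of_real t) * of_real (m t))"
    by (rule integrable_complex_laplace[OF m m0(1) int[OF p]])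
  define a where "a = Re p / 2"
  have a: "a > 0" using p by (simp add: a_def)
  show "\<exists>r>0. \<exists>g. integrable lborel g \<and> ball p r \<subseteq> {p. 0 < Re p} \<and>
           (\<forall>q\<in>ball p r. \<forall>x\<in>space lborel. norm (- of_real x * exp (- q * of_real x) * of_real (m x)) \<le> g x)"
  proof (intro exI conjI ballI)
    show "a > 0" by fact
    show "integrable lborel (\<lambda>t. 2 / a * (exp (- (a / 2) * t) * m t))"
      using a by (intro integrable_mult_right int) simp
    show "ball p a \<subseteq> {p. 0 < Re p}" using ball_half_Re[of _ p] a unfolding a_def by fastforce
    fix q x assume "q \<in> ball p a"
    then have q: "a < Re q" unfolding a_def by (rule ball_half_Re)
    show "norm (- of_real x * exp (- q * of_real x) * of_real (m x) :: complex) \<le> 2 / a * (exp (- (a / 2) * x) * m x)"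
    proof (cases "x \<le> 0")
      case False
      then have x: "x > 0" by simp
      have "x * a / 2 \<le> exp (x * a / 2)" using exp_ge_add_one_self[of "x * a / 2"] by linarith
      then have 1: "x \<le> 2 / a * exp (x * a / 2)" using a by (simp add: field_simps)
      have "x * exp (- (Re q * x)) \<le> (2 / a * exp (x * a / 2)) * exp (- (a * x))"
        using x q a by (intro mult_mono 1) auto
      also have "\<dots> = 2 / a * exp (- (a / 2) * x)" by (simp add: exp_add[symmetric])
      finally have "(x * exp (- (Re q * x))) * m x \<le> (2 / a * exp (- (a / 2) * x)) * m x"
        by (rule mult_right_mono) (rule m0)
      then show ?thesis using x m0(2)[of x] by (simp add: norm_mult)
    qed (simp add: m0)
  qed
qed (auto intro!: derivative_eq_intros)

text \<open>Extends identities between Laplace and Stieltjes transforms, which are known for real arguments, to the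
  half-plane.\<close>
lemma holomorphic_eq_on_right_half_plane:
  assumes f: "f holomorphic_on {p. 0 < Re p}" and g: "g holomorphic_on {p. 0 < Re p}"
    and eq: "\<And>x. 0 < x \<Longrightarrow> f (of_real x) = g (of_real x)" and p: "0 < Re p"
  shows "f p = g p"
proof -
  have "(\<lambda>p. f p - g p) p = 0"
  proof (rule analytic_continuation[where f="\<lambda>p. f p - g p" and w=p and S="{p. 0 < Re p}" and U="of_real ` {0<..}" and \<xi>=1])
    show "(\<lambda>p. f p - g p) holomorphic_on {p. 0 < Re p}" by (intro holomorphic_intros f g)
    show "connected {p. 0 < Re p}" by (intro convex_connected convex_halfspace_Re_gt)
    show "1 islimpt complex_of_real ` {0<..}"
    proof -
      have "(1::real) islimpt {0<..}" by (rule interior_limit_point) (simp add: interior_open)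
      then have "\<exists>X. (\<forall>n. X n \<in> {0<..} - {1::real}) \<and> X \<longlonglongrightarrow> 1" unfolding islimpt_sequential .
      then obtain X where X: "\<forall>n. X n \<in> {0<..} - {1::real}" "X \<longlonglongrightarrow> 1" by blast
      show ?thesis unfolding islimpt_sequential
      proof (intro exI conjI)
        show "\<forall>n. complex_of_real (X n) \<in> complex_of_real ` {0<..} - {1}" using X(1) by auto
        show "(\<lambda>n. complex_of_real (X n)) \<longlonglongrightarrow> 1" using tendsto_of_real[OF X(2)] by simp
      qed
    qed
  qed (use p eq in \<open>auto intro: open_right_half_plane\<close>)
  then show ?thesis by simp
qed

locale stieltjes_measure =
  fixes \<sigma> :: "real measure"
  assumes sets_\<sigma>: "sets \<sigma> = sets (restrict_space borel {0::real..})"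
    and integrable_\<sigma>: "integrable \<sigma> (\<lambda>t. 1 / (1 + t))"
begin

lemma space_\<sigma>: "space \<sigma> = {0..}"
  using sets_eq_imp_space_eq[OF sets_\<sigma>] by (simp add: space_restrict_space)

lemma borel_measurable_\<sigma>: "f \<in> borel_measurable borel \<Longrightarrow> f \<in> borel_measurable \<sigma>"
  unfolding measurable_cong_sets[OF sets_\<sigma> refl] by (rule measurable_restrict_space1)

definition transform :: "(real \<Rightarrow> real) \<Rightarrow> complex \<Rightarrow> complex" where
  "transform w p = (\<integral>s. of_real (w s) / (p + of_real s) \<partial>\<sigma>)"

lemma norm_add_of_real_ge:
  assumes "a \<le> Re p"
  shows "a + s \<le> norm (p + of_real s)"
  using complex_Re_le_cmod[of "p + of_real s"] assms by simp

lemma inverse_shift_le: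
  fixes a s :: real
  assumes "0 < a" "0 \<le> s"
  shows "1 / (a + s) \<le> max 1 (1 / a) * (1 / (1 + s))"
proof -
  have "1 * s \<le> max 1 (1 / a) * s" using assms by (intro mult_right_mono) auto
  moreover have "1 / a * a \<le> max 1 (1 / a) * a" using assms by (intro mult_right_mono) auto
  ultimately have "1 + s \<le> max 1 (1 / a) * (a + s)" using assms by (simp add: algebra_simps)
  then show ?thesis using assms by (simp add: field_simps)
qed

lemma integrable_transform:
  assumes w: "w \<in> borel_measurable borel" "\<And>s. 0 \<le> s \<Longrightarrow> 0 \<le> w s \<and> w s \<le> 1" and p: "0 < Re p"
  shows "integrable \<sigma> (\<lambda>s. of_real (w s) / (p + of_real s))"
proof (rule Bochner_Integration.integrable_bound[OF integrable_mult_right[OF integrable_\<sigma>, of "max 1 (1 / Re p)"]])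
  note [measurable] = w(1)
  show "(\<lambda>s. of_real (w s) / (p + of_real s)) \<in> borel_measurable \<sigma>"
    by (rule borel_measurable_\<sigma>) measurable
  show "AE s in \<sigma>. norm (of_real (w s) / (p + of_real s)) \<le> norm (max 1 (1 / Re p) * (1 / (1 + s)))"
  proof (rule AE_I2)
    fix s assume "s \<in> space \<sigma>"
    then have s: "0 \<le> s" by (simp add: space_\<sigma>)
    have "norm (of_real (w s) / (p + of_real s)) = w s / norm (p + of_real s)"
      using w(2)[OF s] by (simp add: norm_divide)
    also have "\<dots> \<le> 1 / (Re p + s)"
      using w(2)[OF s] p s norm_add_of_real_ge[of "Re p" p s] by (intro frac_le) auto
    also have "\<dots> \<le> max 1 (1 / Re p) * (1 / (1 + s))" by (rule inverse_shift_le[OF p s])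
    finally show "norm (of_real (w s) / (p + of_real s)) \<le> norm (max 1 (1 / Re p) * (1 / (1 + s)))"
      using s by simp
  qed
qed

lemma transform_holomorphic:
  assumes w: "w \<in> borel_measurable borel" "\<And>s. 0 \<le> s \<Longrightarrow> 0 \<le> w s \<and> w s \<le> 1"
  shows "transform w holomorphic_on {p. 0 < Re p}"
  unfolding transform_def[abs_def]
proof (rule holomorphic_on_parametric_integral[where f' = "\<lambda>p s. - of_real (w s) / (p + of_real s)\<^sup>2", OF open_right_half_plane])
  note [measurable] = w(1)
  fix p assume "p \<in> {p. 0 < Re p}"
  then have p: "0 < Re p" by simp
  show "integrable \<sigma> (\<lambda>s. of_real (w s) / (p + of_real s))" by (rule integrable_transform[OF w p])
  show "(\<lambda>s. - of_real (w s) / (p + of_real s)\<^sup>2) \<in> borel_measurable \<sigma>"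
    by (rule borel_measurable_\<sigma>) measurable
  show "((\<lambda>p. of_real (w s) / (p + of_real s)) has_field_derivative - of_real (w s) / (p + of_real s)\<^sup>2) (at p)"
    if "s \<in> space \<sigma>" for s
  proof -
    have "p + of_real s \<noteq> 0" using p that by (auto simp: space_\<sigma> complex_eq_iff)
    then show ?thesis by (auto intro!: derivative_eq_intros simp: power2_eq_square)
  qed
  define a where "a = Re p / 2"
  have a: "a > 0" using p by (simp add: a_def)
  show "\<exists>r>0. \<exists>g. integrable \<sigma> g \<and> ball p r \<subseteq> {p. 0 < Re p} \<and>
           (\<forall>q\<in>ball p r. \<forall>s\<in>space \<sigma>. norm (- of_real (w s) / (q + of_real s)\<^sup>2) \<le> g s)"
  proof (intro exI conjI ballI)
    show "a > 0" by fact
    show "integrable \<sigma> (\<lambda>s. 1 / a * (max 1 (1 / a) * (1 / (1 + s))))"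
      using integrable_\<sigma> by (intro integrable_mult_right)
    show "ball p a \<subseteq> {p. 0 < Re p}" using ball_half_Re[of _ p] a unfolding a_def by fastforce
    fix q s assume "q \<in> ball p a" "s \<in> space \<sigma>"
    then have q: "a < Re q" and s: "0 \<le> s" using ball_half_Re[of q p] by (simp_all add: a_def space_\<sigma>)
    have n: "a + s \<le> norm (q + of_real s)" by (rule norm_add_of_real_ge) (use q in simp)
    have "norm (- of_real (w s) / (q + of_real s)\<^sup>2) = w s / (norm (q + of_real s))\<^sup>2"
      using w(2)[OF s] by (simp add: norm_divide norm_power)
    also have "\<dots> \<le> 1 / (a + s)\<^sup>2"
      using w(2)[OF s] a s n by (intro frac_le power_mono) auto
    also have "\<dots> = 1 / (a + s) * (1 / (a + s))" by (simp add: power2_eq_square)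
    also have "\<dots> \<le> 1 / a * (max 1 (1 / a) * (1 / (1 + s)))"
      using a s by (intro mult_mono inverse_shift_le frac_le) auto
    finally show "norm (- of_real (w s) / (q + of_real s)\<^sup>2) \<le> 1 / a * (max 1 (1 / a) * (1 / (1 + s)))" .
  qed
qed

lemma integrable_real_transform:
  assumes w: "w \<in> borel_measurable borel" "\<And>s. 0 \<le> s \<Longrightarrow> 0 \<le> w s \<and> w s \<le> 1" and x: "0 < x"
  shows "integrable \<sigma> (\<lambda>s. w s / (x + s))"
    and "transform w (of_real x) = of_real (\<integral>s. w s / (x + s) \<partial>\<sigma>)"
proof -
  have eq: "(of_real (w s) / (of_real x + of_real s) :: complex) = of_real (w s / (x + s))" for s by simp
  have "integrable \<sigma> (\<lambda>s. complex_of_real (w s / (x + s)))"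
    using integrable_transform[OF w, of "of_real x"] x by simp
  then show "integrable \<sigma> (\<lambda>s. w s / (x + s))" by (simp only: complex_of_real_integrable_eq)
  show "transform w (of_real x) = of_real (\<integral>s. w s / (x + s) \<partial>\<sigma>)"
    unfolding transform_def eq by (rule integral_complex_of_real)
qed

text \<open>The real part of \<open>1 / (p + s)\<close> is positive for all \<open>s \<ge> 0\<close>.\<close>
lemma Re_transform_pos:
  assumes w: "w \<in> borel_measurable borel" "\<And>s. 0 \<le> s \<Longrightarrow> 0 \<le> w s \<and> w s \<le> 1" and p: "0 < Re p"
    and nz: "\<not> (AE s in \<sigma>. w s = 0)"
  shows "0 < Re (transform w p)"
proof -
  note int = integrable_transform[OF w p]
  let ?f = "\<lambda>s. Re (of_real (w s) / (p + of_real s))"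
  have f: "?f s = w s * (Re p + s) / (norm (p + of_real s))\<^sup>2" for s
    by (simp add: Re_divide cmod_power2)
  have ne: "0 < (norm (p + of_real s))\<^sup>2" if "0 \<le> s" for s
    using p that by (auto simp: complex_eq_iff)
  have eq: "Re (transform w p) = (\<integral>s. ?f s \<partial>\<sigma>)"
    unfolding transform_def by (rule integral_Re[symmetric, OF int])
  have nonneg: "AE s in \<sigma>. 0 \<le> ?f s"
    by (rule AE_I2) (use w p in \<open>auto simp: f space_\<sigma>\<close>)
  have "(\<integral>s. ?f s \<partial>\<sigma>) \<noteq> 0"
  proof
    assume "(\<integral>s. ?f s \<partial>\<sigma>) = 0"
    then have "AE s in \<sigma>. ?f s = 0"
      using integral_nonneg_eq_0_iff_AE[OF integrable_Re[OF int] nonneg] by blast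
    then have "AE s in \<sigma>. w s = 0"
      using AE_space
    proof eventually_elim
      case (elim s)
      then have s: "0 \<le> s" by (simp add: space_\<sigma>)
      show ?case using elim(1) ne[OF s] p s unfolding f by auto
    qed
    with nz show False ..
  qed
  moreover have "0 \<le> (\<integral>s. ?f s \<partial>\<sigma>)" by (rule integral_nonneg_AE[OF nonneg])
  ultimately show ?thesis unfolding eq by linarith
qed

text \<open>As \<open>s\<close> varies, the values \<open>1 / (p + s)\<close> stay in one quadrant. So there is no cancellation in the sum of the absolute values
  of the real and the imaginary part, and this sum is at least \<open>1 / |p + s| \<ge> 1 / (|p| + s)\<close> for each \<open>s\<close>.\<close>
lemma norm_transform_ge:
  assumes p: "0 < Re p"
  shows "(\<integral>s. 1 / (norm p + s) \<partial>\<sigma>) \<le> 2 * norm (transform (\<lambda>_. 1) p)"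
proof -
  \<comment> \<open>the sign that makes \<open>- e * Im (1 / (p + s))\<close> nonnegative\<close>
  define e :: real where "e = (if Im p \<ge> 0 then 1 else -1)"
  have e: "\<bar>e\<bar> = 1" by (simp add: e_def)
  have int: "integrable \<sigma> (\<lambda>s. 1 / (p + of_real s))" using integrable_transform[of "\<lambda>_. 1", OF _ _ p] by simp
  have np: "0 < norm p" using p by auto
  have "(\<integral>s. 1 / (norm p + s) \<partial>\<sigma>) \<le> (\<integral>s. Re (1 / (p + of_real s)) - e * Im (1 / (p + of_real s)) \<partial>\<sigma>)"
  proof (rule integral_mono)
    show "integrable \<sigma> (\<lambda>s. 1 / (norm p + s))"
      using integrable_real_transform(1)[of "\<lambda>_. 1" "norm p"] np by simp
    show "integrable \<sigma> (\<lambda>s. Re (1 / (p + of_real s)) - e * Im (1 / (p + of_real s)))"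
      by (intro Bochner_Integration.integrable_diff integrable_mult_right integrable_Re integrable_Im int)
    fix s assume "s \<in> space \<sigma>"
    then have s: "0 \<le> s" by (simp add: space_\<sigma>)
    let ?n = "norm (p + of_real s)"
    have n: "0 < ?n" using p s by (auto simp: complex_eq_iff)
    have n1: "?n \<le> norm p + s" using norm_triangle_ineq[of p "of_real s"] s by simp
    have n2: "?n \<le> (Re p + s) + \<bar>Im p\<bar>" using cmod_le[of "p + of_real s"] p s by simp
    have "1 / (norm p + s) \<le> 1 / ?n" using n n1 by (intro frac_le) auto
    also have "\<dots> = ?n / ?n\<^sup>2" using n by (simp add: power2_eq_square)
    also have "\<dots> \<le> ((Re p + s) + \<bar>Im p\<bar>) / ?n\<^sup>2" by (intro divide_right_mono n2) simp
    also have "\<dots> = Re (1 / (p + of_real s)) - e * Im (1 / (p + of_real s))"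
      by (simp add: Re_divide Im_divide cmod_power2 e_def add_divide_distrib)
    finally show "1 / (norm p + s) \<le> Re (1 / (p + of_real s)) - e * Im (1 / (p + of_real s))" .
  qed
  also have "\<dots> = Re (transform (\<lambda>_. 1) p) - e * Im (transform (\<lambda>_. 1) p)"
    unfolding transform_def using int by simp
  also have "\<dots> \<le> \<bar>Re (transform (\<lambda>_. 1) p)\<bar> + \<bar>e\<bar> * \<bar>Im (transform (\<lambda>_. 1) p)\<bar>"
    unfolding abs_mult[symmetric] by arith
  also have "\<dots> \<le> 2 * norm (transform (\<lambda>_. 1) p)"
    using abs_Re_le_cmod[of "transform (\<lambda>_. 1) p"] abs_Im_le_cmod[of "transform (\<lambda>_. 1) p"] e by simp
  finally show ?thesis .
qed

text \<open>Factors out the zero of \<open>\<Phi>(p) - \<Phi>(p0)\<close> explicitly. The remaining factor is a transform of the same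
  kind, so that its zero-freeness, the simplicity of the zero at \<open>p0\<close> and the value of \<open>\<Phi>'(p0)\<close>
  can all be read off from it.\<close>
lemma Phi_difference:
  assumes p0: "0 < p0" and p: "0 < Re p"
  shows "p * transform (\<lambda>_. 1) p - of_real p0 * transform (\<lambda>_. 1) (of_real p0)
       = (p - of_real p0) * transform (\<lambda>s. s / (p0 + s)) p"
proof -
  have i1: "integrable \<sigma> (\<lambda>s. p * (1 / (p + of_real s)))"
    using integrable_transform[of "\<lambda>_. 1", OF _ _ p] by (intro integrable_mult_right) simp
  have i2: "integrable \<sigma> (\<lambda>s. of_real p0 * (1 / (of_real p0 + of_real s)) :: complex)"
    using integrable_transform[of "\<lambda>_. 1" "of_real p0"] p0 by (intro integrable_mult_right) simp
  have "p * transform (\<lambda>_. 1) p - of_real p0 * transform (\<lambda>_. 1) (of_real p0)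
     = (\<integral>s. p * (1 / (p + of_real s)) - of_real p0 * (1 / (of_real p0 + of_real s)) \<partial>\<sigma>)"
    unfolding transform_def Bochner_Integration.integral_diff[OF i1 i2] by (simp only: integral_mult_right_zero of_real_1)
  also have "\<dots> = (\<integral>s. (p - of_real p0) * (of_real (s / (p0 + s)) / (p + of_real s)) \<partial>\<sigma>)"
  proof (rule Bochner_Integration.integral_cong[OF refl])
    fix s assume "s \<in> space \<sigma>"
    then have s: "0 \<le> s" by (simp add: space_\<sigma>)
    have 1: "p + of_real s \<noteq> 0" using p s by (auto simp: complex_eq_iff)
    have 2: "complex_of_real p0 + of_real s \<noteq> 0" using p0 s by (auto simp: complex_eq_iff)
    show "p * (1 / (p + of_real s)) - of_real p0 * (1 / (of_real p0 + of_real s)) =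
        (p - of_real p0) * (of_real (s / (p0 + s)) / (p + of_real s))"
      using 1 2 by (simp add: divide_simps) (simp add: algebra_simps)
  qed
  also have "\<dots> = (p - of_real p0) * transform (\<lambda>s. s / (p0 + s)) p"
    unfolding transform_def by (rule integral_mult_right_zero)
  finally show ?thesis .
qed

end

text \<open>The constant term \<open>b\<close> is at most the limit of \<open>K\<close> at infinity, and \<open>a\<close> at most the limit of
  \<open>p K(p)\<close> at \<open>0\<close>.\<close>
lemma stieltjes_representation:
  assumes K: "stieltjes_function K" and top: "(K \<longlongrightarrow> 0) at_top"
    and zero: "((\<lambda>p. p * K p) \<longlongrightarrow> 0) (at_right 0)"
  obtains \<sigma> where "stieltjes_measure \<sigma>" "\<And>z. 0 < z \<Longrightarrow> K z = (\<integral>t. 1 / (z + t) \<partial>\<sigma>)"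
proof -
  obtain a b \<sigma> where ab: "0 \<le> a" "0 \<le> b" and \<sigma>: "sets \<sigma> = sets (restrict_space borel {0::real..})"
     "integrable \<sigma> (\<lambda>t. 1 / (1 + t))" and Kz: "\<And>z. 0 < z \<Longrightarrow> K z = a / z + b + (\<integral>t. 1 / (z + t) \<partial>\<sigma>)"
    using K unfolding stieltjes_function_def by blast
  interpret stieltjes_measure \<sigma> by unfold_locales (rule \<sigma>)+
  have pos: "0 \<le> (\<integral>t. 1 / (z + t) \<partial>\<sigma>)" if "0 < z" for z
    using that by (intro integral_nonneg_AE AE_I2) (auto simp: space_\<sigma>)
  have "b \<le> 0"
  proof (rule tendsto_lowerbound[OF top])
    show "\<forall>\<^sub>F z in at_top. b \<le> K z"
      using eventually_gt_at_top[of 0]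
    proof eventually_elim
      case (elim z)
      then show ?case using Kz[of z] pos[of z] ab by simp
    qed
  qed simp
  moreover have "a \<le> 0"
  proof (rule tendsto_lowerbound[OF zero])
    show "\<forall>\<^sub>F z in at_right 0. a \<le> z * K z"
      using eventually_at_right_less[of 0]
    proof eventually_elim
      case (elim z)
      then have "z * (a / z) \<le> z * K z" using Kz[of z] pos[of z] ab by (intro mult_left_mono) auto
      then show ?case using elim by simp
    qed
  qed simp
  ultimately have "a = 0" "b = 0" using ab by auto
  then show ?thesis using that[of \<sigma>] Kz stieltjes_measure_axioms by simp
qed

lemma integrable_laplace_local:
  fixes \<kappa> :: "real \<Rightarrow> real"
  assumes "integrable lborel (\<lambda>t. exp (- 1 * t) * \<kappa> t)" "\<And>t. 0 \<le> \<kappa> t" and [measurable]: "\<kappa> \<in> borel_measurable borel"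
  shows "integrable lborel (\<lambda>t. indicator {0<..<T} t * \<kappa> t)"
proof (rule Bochner_Integration.integrable_bound[OF integrable_mult_right[OF assms(1), of "exp T"]])
  show "AE t in lborel. norm (indicator {0<..<T} t * \<kappa> t) \<le> norm (exp T * (exp (- 1 * t) * \<kappa> t))"
  proof (rule AE_I2)
    fix t
    have "1 * \<kappa> t \<le> exp (T - t) * \<kappa> t" if "t < T" using that assms(2) by (intro mult_right_mono) auto
    then show "norm (indicator {0<..<T} t * \<kappa> t) \<le> norm (exp T * (exp (- 1 * t) * \<kappa> t))"
      using assms(2)[of t] by (auto simp: indicator_def exp_diff exp_minus field_simps)
  qed
qed measurable

section \<open>Integrals along vertical lines\<close>

lemma integral_symmetric_intervals_tendsto:
  fixes f :: "real \<Rightarrow> complex"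
  assumes "integrable lborel f"
  shows "(\<lambda>n::nat. integral {-real n..real n} f) \<longlonglongrightarrow> (\<integral>y. f y \<partial>lborel)"
proof -
  have U: "(\<Union>n::nat. {-real n..real n}) = UNIV"
  proof (intro set_eqI iffI)
    fix x :: real
    obtain n :: nat where "\<bar>x\<bar> \<le> real n" using real_arch_simple by blast
    then show "x \<in> (\<Union>n::nat. {-real n..real n})" by (intro UN_I[of n]) auto
  qed auto
  have S: "set_integrable lborel A f" if "A \<in> sets lborel" for A
    using assms that unfolding set_integrable_def by (rule integrable_mult_indicator[rotated])
  have "(\<lambda>n::nat. LINT y:{-real n..real n}|lborel. f y) \<longlonglongrightarrow> (LINT y:(\<Union>n::nat. {-real n..real n})|lborel. f y)"
    by (intro set_integral_cont_up S) (auto simp: incseq_def U)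
  moreover have "(LINT y:{-real n..real n}|lborel. f y) = integral {-real n..real n} f" for n :: nat
    by (rule set_borel_integral_eq_integral(2)[OF S]) auto
  ultimately show ?thesis by (simp add: U set_lebesgue_integral_def)
qed

text \<open>On a convex domain \<open>G\<close> has a primitive \<open>P\<close>, so that the difference of the two integrals is
  \<open>P(b + iY) - P(a + iY)\<close> minus the same expression at \<open>-Y\<close>. Each of these is bounded by \<open>b - a\<close> times the
  supremum of \<open>|G|\<close> on a horizontal segment.\<close>
lemma vertical_lines_tendsto:
  fixes G :: "complex \<Rightarrow> complex"
  assumes S: "open S" "convex S" "G holomorphic_on S"
    and ab: "a \<le> b" and strip: "\<And>x y. a \<le> x \<Longrightarrow> x \<le> b \<Longrightarrow> Complex x y \<in> S"
    and decay: "\<And>e. e > 0 \<Longrightarrow> \<exists>Y. \<forall>x y. a \<le> x \<longrightarrow> x \<le> b \<longrightarrow> Y \<le> \<bar>y\<bar> \<longrightarrow> norm (G (Complex x y)) \<le> e"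
  shows "(\<lambda>n::nat. integral {-real n..real n} (\<lambda>y. G (Complex b y))
                  - integral {-real n..real n} (\<lambda>y. G (Complex a y))) \<longlonglongrightarrow> 0"
proof -
  obtain P where P: "\<And>z. z \<in> S \<Longrightarrow> (P has_field_derivative G z) (at z)"
    using holomorphic_convex_primitive'[OF S(2,1,3)] at_within_open[OF _ S(1)] by metis
  have int: "integral {-Y..Y} (\<lambda>y. G (Complex c y)) = (P (Complex c Y) - P (Complex c (-Y))) / \<i>"
    if "a \<le> c" "c \<le> b" "0 \<le> Y" for c Y
  proof -
    have "((\<lambda>y. \<i> * G (Complex c y)) has_integral (P (Complex c Y) - P (Complex c (-Y)))) {-Y..Y}"
    proof (rule fundamental_theorem_of_calculus)
      fix y assume "y \<in> {-Y..Y}"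
      have D: "(Complex c has_vector_derivative \<i>) (at y within {-Y..Y})"
        unfolding has_vector_derivative_complex_iff by (auto intro!: derivative_eq_intros)
      show "((\<lambda>y. P (Complex c y)) has_vector_derivative \<i> * G (Complex c y)) (at y within {-Y..Y})"
        using field_vector_diff_chain_within[OF D has_field_derivative_at_within[OF P[OF strip[OF that(1,2)]]]]
        by (simp add: o_def)
    qed (use that in auto)
    from has_integral_mult_right[OF this, of "1/\<i>"]
    have "((\<lambda>y. G (Complex c y)) has_integral ((P (Complex c Y) - P (Complex c (-Y))) / \<i>)) {-Y..Y}"
      by (simp add: field_simps)
    then show ?thesis by (rule integral_unique)
  qed
  have bd: "norm (P (Complex b y) - P (Complex a y)) \<le> e * (b - a)"
    if "\<And>x. a \<le> x \<Longrightarrow> x \<le> b \<Longrightarrow> norm (G (Complex x y)) \<le> e" for y e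
  proof -
    have seg: "\<exists>x. a \<le> x \<and> x \<le> b \<and> z = Complex x y" if zs: "z \<in> closed_segment (Complex a y) (Complex b y)" for z
    proof -
      obtain u where u: "0 \<le> u" "u \<le> 1" "z = (1 - u) *\<^sub>R Complex a y + u *\<^sub>R Complex b y"
        using zs by (auto simp: in_segment)
      have "z = Complex ((1-u)*a + u*b) y" using u by (simp add: complex_eq_iff algebra_simps)
      moreover have "(1-u)*a + u*b \<in> {a..b}"
        using u ab convex_closed_interval[of a b]
        by (metis atLeastAtMost_iff convexD_alt convex_real_interval(5) order_refl real_scaleR_def)
      ultimately show ?thesis by auto
    qed
    have "norm (P (Complex b y) - P (Complex a y)) \<le> e * norm (Complex b y - Complex a y)"
    proof (rule field_differentiable_bound[of "closed_segment (Complex a y) (Complex b y)" _ G])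
      fix z assume "z \<in> closed_segment (Complex a y) (Complex b y)"
      from seg[OF this] obtain x where x: "a \<le> x" "x \<le> b" "z = Complex x y" by blast
      show "(P has_field_derivative G z) (at z within closed_segment (Complex a y) (Complex b y))"
        using P[OF strip[OF x(1,2)]] x(3) has_field_derivative_at_within by blast
      show "norm (G z) \<le> e" using that x by simp
    qed auto
    also have "norm (Complex b y - Complex a y) = b - a"
      using ab by (simp add: cmod_def)
    finally show ?thesis .
  qed
  show ?thesis unfolding LIMSEQ_iff
  proof (intro allI impI)
    fix r :: real assume r: "r > 0"
    define e0 where "e0 = r / (2 * (b - a) + 1)"
    define e where "e = e0 / 2"
    have e: "e > 0" using r ab by (simp add: e_def e0_def)
    from decay[OF e] obtain Y where Y: "\<And>x y. a \<le> x \<Longrightarrow> x \<le> b \<Longrightarrow> Y \<le> \<bar>y\<bar> \<Longrightarrow> norm (G (Complex x y)) \<le> e" by blast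
    obtain N :: nat where N: "Y \<le> real N" using real_arch_simple by blast
    have lt: "2 * e * (b - a) < r"
    proof -
      have "2 * e * (b - a) = e0 * (b - a)" by (simp add: e_def)
      also have "\<dots> = r * ((b - a) / (2 * (b - a) + 1))" unfolding e0_def by simp
      also have "\<dots> < r * 1" using r ab by (intro mult_strict_left_mono) (auto simp: divide_simps)
      finally show ?thesis by simp
    qed
    show "\<exists>no. \<forall>n\<ge>no. norm (integral {-real n..real n} (\<lambda>y. G (Complex b y))
                  - integral {-real n..real n} (\<lambda>y. G (Complex a y)) - 0) < r"
    proof (intro exI allI impI)
      fix n assume "N \<le> n"
      then have n: "Y \<le> real n" using N by simp
      have "integral {-real n..real n} (\<lambda>y. G (Complex b y)) - integral {-real n..real n} (\<lambda>y. G (Complex a y)) =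
        ((P (Complex b n) - P (Complex a n)) - (P (Complex b (-n)) - P (Complex a (-n)))) / \<i>"
        using ab by (simp add: int algebra_simps)
      also have "norm \<dots> \<le> norm (P (Complex b n) - P (Complex a n)) + norm (P (Complex b (-n)) - P (Complex a (-n)))"
        by (simp only: norm_divide norm_ii div_by_1 norm_triangle_ineq4)
      also have "\<dots> \<le> e * (b - a) + e * (b - a)"
        by (intro add_mono bd Y) (use n in auto)
      also have "\<dots> < r" using lt by simp
      finally show "norm (integral {-real n..real n} (\<lambda>y. G (Complex b y))
                  - integral {-real n..real n} (\<lambda>y. G (Complex a y)) - 0) < r" by simp
    qed
  qed
qed

lemma vertical_lines_equal:
  fixes G :: "complex \<Rightarrow> complex"
  assumes "open S" "convex S" "G holomorphic_on S"
    and "a \<le> b" and "\<And>x y. a \<le> x \<Longrightarrow> x \<le> b \<Longrightarrow> Complex x y \<in> S"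
    and "\<And>e. e > 0 \<Longrightarrow> \<exists>Y. \<forall>x y. a \<le> x \<longrightarrow> x \<le> b \<longrightarrow> Y \<le> \<bar>y\<bar> \<longrightarrow> norm (G (Complex x y)) \<le> e"
    and ia: "integrable lborel (\<lambda>y. G (Complex a y))" and ib: "integrable lborel (\<lambda>y. G (Complex b y))"
  shows "(\<integral>y. G (Complex b y) \<partial>lborel) = (\<integral>y. G (Complex a y) \<partial>lborel)"
proof -
  have "(\<integral>y. G (Complex b y) \<partial>lborel) - (\<integral>y. G (Complex a y) \<partial>lborel) = 0"
    by (rule LIMSEQ_unique[OF tendsto_diff[OF integral_symmetric_intervals_tendsto[OF ib] integral_symmetric_intervals_tendsto[OF ia]]
        vertical_lines_tendsto[OF assms(1-6)]])
  then show ?thesis by simp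
qed

text \<open>The integral of \<open>1 / (d + iy)\<close> is not absolutely convergent, but its symmetric truncations are
  \<open>2 arctan (n / d)\<close>. The jump of this limit by \<open>2 \<pi>\<close> at \<open>d = 0\<close> is what makes the residue appear.\<close>
lemma principal_value_inverse:
  fixes d :: real
  assumes "d \<noteq> 0"
  shows "(\<lambda>n::nat. integral {-real n..real n} (\<lambda>y. 1 / Complex d y)) \<longlonglongrightarrow> of_real (sgn d * pi)"
proof -
  have I: "integral {-Y..Y} (\<lambda>y. 1 / Complex d y) = of_real (2 * arctan (Y / d))" if "0 \<le> Y" for Y
  proof -
    let ?F = "\<lambda>y. Complex (arctan (y / d)) (- ln (d\<^sup>2 + y\<^sup>2) / 2)"
    have "((\<lambda>y. 1 / Complex d y) has_integral (?F Y - ?F (-Y))) {-Y..Y}"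
    proof (rule fundamental_theorem_of_calculus)
      fix y
      have pos: "d\<^sup>2 + y\<^sup>2 > 0" using assms by (simp add: sum_power2_gt_zero_iff)
      have p2: "1 + (y/d)\<^sup>2 = (d\<^sup>2 + y\<^sup>2) / d\<^sup>2" using assms by (simp add: field_simps power2_eq_square)
      have "inverse (1 + (y / d)\<^sup>2) * (1 / d) = d / (d\<^sup>2 + y\<^sup>2)"
        unfolding p2 using assms pos by (simp add: field_simps power2_eq_square)
      then show "(?F has_vector_derivative 1 / Complex d y) (at y within {-Y..Y})"
        unfolding has_vector_derivative_complex_iff
        using assms pos by (auto intro!: derivative_eq_intros simp: Re_divide Im_divide field_simps)
    qed (use that in auto)
    moreover have "?F Y - ?F (-Y) = of_real (2 * arctan (Y / d))"
      by (simp add: complex_eq_iff arctan_minus)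
    ultimately show ?thesis by (simp add: integral_unique)
  qed
  have "(\<lambda>n::nat. arctan (real n / d)) \<longlonglongrightarrow> sgn d * (pi / 2)"
  proof (cases "d > 0")
    case True
    have "(\<lambda>n::nat. arctan (real n / d)) \<longlonglongrightarrow> pi / 2"
      by (rule filterlim_compose[OF tendsto_arctan_at_top])
         (use True in \<open>real_asymp\<close>)
    then show ?thesis using True by simp
  next
    case False
    then have d: "d < 0" using assms by simp
    have "(\<lambda>n::nat. arctan (real n / d)) \<longlonglongrightarrow> - (pi / 2)"
      by (rule filterlim_compose[OF tendsto_arctan_at_bot])
         (use d in \<open>real_asymp\<close>)
    then show ?thesis using d by simp
  qed
  from tendsto_of_real[OF tendsto_mult[OF tendsto_const[of 2] this]]
  have "(\<lambda>n::nat. of_real (2 * arctan (real n / d)) :: complex) \<longlonglongrightarrow> of_real (2 * (sgn d * (pi / 2)))" .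
  then show ?thesis by (simp add: I)
qed

text \<open>Subtracting \<open>c / (z - q)\<close> with the residue \<open>c = g(q)\<close> leaves a function \<open>H\<close> without a pole, whose truncated integrals over
  the two lines agree in the limit. The subtracted term contributes
  \<open>c \<pi>\<close> on the right of the pole and \<open>- c \<pi>\<close> on the left.\<close>
lemma vertical_lines_cross_pole:
  fixes g :: "complex \<Rightarrow> complex"
  assumes S: "open S" "convex S" and g: "g holomorphic_on S"
    and ab: "a < q" "q < b" and strip: "\<And>x y. a \<le> x \<Longrightarrow> x \<le> b \<Longrightarrow> Complex x y \<in> S"
    and decay: "\<And>e. e > 0 \<Longrightarrow> \<exists>Y. \<forall>x y. a \<le> x \<longrightarrow> x \<le> b \<longrightarrow> Y \<le> \<bar>y\<bar> \<longrightarrow>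
          norm (g (Complex x y) / (Complex x y - of_real q)) \<le> e"
    and ia: "integrable lborel (\<lambda>y. g (Complex a y) / (Complex a y - of_real q))"
    and ib: "integrable lborel (\<lambda>y. g (Complex b y) / (Complex b y - of_real q))"
  shows "(\<integral>y. g (Complex b y) / (Complex b y - of_real q) \<partial>lborel) =
         (\<integral>y. g (Complex a y) / (Complex a y - of_real q) \<partial>lborel) + 2 * pi * g (of_real q)"
proof -
  define G where "G = (\<lambda>z. g z / (z - of_real q))"
  define H where "H = (\<lambda>z. if z = of_real q then deriv g (of_real q) else (g z - g (of_real q)) / (z - of_real q))"
  define c where "c = g (of_real q)"
  have H: "H holomorphic_on S" unfolding H_def by (rule pole_lemma_open[OF g S(1)])
  have HG: "H z = G z - c * (1 / (z - of_real q))" if "z \<noteq> of_real q" for z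
    using that by (simp add: H_def G_def c_def diff_divide_distrib)
  have HGl: "H (Complex x y) = G (Complex x y) - c * (1 / Complex (x - q) y)" if "x \<noteq> q" for x y
  proof -
    have "Complex x y \<noteq> of_real q" "Complex x y - of_real q = Complex (x - q) y"
      using that by (auto simp: complex_eq_iff)
    then show ?thesis using HG[of "Complex x y"] by simp
  qed
  have lim: "(\<lambda>n::nat. integral {-real n..real n} (\<lambda>y. H (Complex b y))
                  - integral {-real n..real n} (\<lambda>y. H (Complex a y))) \<longlonglongrightarrow> 0"
  proof (rule vertical_lines_tendsto[OF S H _ strip])
    show "a \<le> b" using ab by simp
    fix e :: real assume e: "e > 0"
    obtain Y where Y: "\<And>x y. a \<le> x \<Longrightarrow> x \<le> b \<Longrightarrow> Y \<le> \<bar>y\<bar> \<Longrightarrow> norm (G (Complex x y)) \<le> e / 2"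
      using decay[of "e/2"] e unfolding G_def by auto
    show "\<exists>Y. \<forall>x y. a \<le> x \<longrightarrow> x \<le> b \<longrightarrow> Y \<le> \<bar>y\<bar> \<longrightarrow> norm (H (Complex x y)) \<le> e"
    proof (intro exI allI impI)
      fix x y assume x: "a \<le> x" "x \<le> b" and y: "max Y (max 1 (2 * norm c / e)) \<le> \<bar>y\<bar>"
      then have y': "Y \<le> \<bar>y\<bar>" "1 \<le> \<bar>y\<bar>" "2 * norm c / e \<le> \<bar>y\<bar>" by auto
      let ?z = "Complex x y"
      have ne: "?z \<noteq> of_real q" using y' by (auto simp: complex_eq_iff)
      have yz: "\<bar>y\<bar> \<le> norm (?z - of_real q)" using abs_Im_le_cmod[of "?z - of_real q"] by simp
      have "norm (H ?z) \<le> norm (G ?z) + norm (c * (1 / (?z - of_real q)))"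
        unfolding HG[OF ne] by (rule norm_triangle_ineq4)
      also have "norm (c * (1 / (?z - of_real q))) = norm c / norm (?z - of_real q)"
        by (simp add: norm_divide)
      also have "\<dots> \<le> norm c / \<bar>y\<bar>"
        using yz y' by (intro divide_left_mono mult_pos_pos) auto
      also have "\<dots> \<le> e / 2" using y' e by (simp add: field_simps)
      finally show "norm (H ?z) \<le> e" using Y[OF x y'(1)] by simp
    qed
  qed auto
  have Hint: "integral {-real n..real n} (\<lambda>y. H (Complex x y)) = integral {-real n..real n} (\<lambda>y. G (Complex x y))
      - c * integral {-real n..real n} (\<lambda>y. 1 / Complex (x - q) y)"
    if x: "x \<noteq> q" and G: "integrable lborel (\<lambda>y. G (Complex x y))" for x and n :: nat
  proof -
    have "set_integrable lborel {-real n..real n} (\<lambda>y. G (Complex x y))"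
      using G unfolding set_integrable_def by (intro integrable_mult_indicator) auto
    then have 1: "(\<lambda>y. G (Complex x y)) integrable_on {-real n..real n}"
      by (rule set_borel_integral_eq_integral(1))
    have "continuous_on {-real n..real n} (\<lambda>y. 1 / Complex (x - q) y)"
      using x by (intro continuous_intros) (auto simp: complex_eq_iff)
    then have 2: "(\<lambda>y. 1 / Complex (x - q) y) integrable_on {-real n..real n}"
      by (rule integrable_continuous_interval)
    have "integral {-real n..real n} (\<lambda>y. H (Complex x y)) =
        integral {-real n..real n} (\<lambda>y. G (Complex x y) - c * (1 / Complex (x - q) y))"
      using x by (simp add: HGl)
    also have "\<dots> = integral {-real n..real n} (\<lambda>y. G (Complex x y)) - integral {-real n..real n} (\<lambda>y. c * (1 / Complex (x - q) y))"
      using 1 integrable_on_mult_right[OF 2] by (rule Henstock_Kurzweil_Integration.integral_diff)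
    also have "integral {-real n..real n} (\<lambda>y. c * (1 / Complex (x - q) y)) = c * integral {-real n..real n} (\<lambda>y. 1 / Complex (x - q) y)"
      by (rule integral_mult_right)
    finally show ?thesis .
  qed
  have L: "(\<lambda>n::nat. integral {-real n..real n} (\<lambda>y. H (Complex x y))) \<longlonglongrightarrow>
      (\<integral>y. G (Complex x y) \<partial>lborel) - c * of_real (sgn (x - q) * pi)"
    if x: "x \<noteq> q" and G: "integrable lborel (\<lambda>y. G (Complex x y))" for x
    unfolding Hint[OF that]
    by (intro tendsto_diff tendsto_mult tendsto_const integral_symmetric_intervals_tendsto principal_value_inverse G) (use x in auto)
  have "((\<integral>y. G (Complex b y) \<partial>lborel) - c * of_real (sgn (b - q) * pi)) -
        ((\<integral>y. G (Complex a y) \<partial>lborel) - c * of_real (sgn (a - q) * pi)) = 0"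
    by (rule LIMSEQ_unique[OF tendsto_diff[OF L L] lim]) (use ab ia ib in \<open>auto simp: G_def\<close>)
  then show ?thesis using ab by (simp add: G_def c_def algebra_simps)
qed

text \<open>Produces majorants on vertical lines: a bounded part near the real axis and a decreasing function of
  \<open>|y|\<close> away from it.\<close>
lemma integrable_even_tail:
  fixes B :: "real \<Rightarrow> real"
  assumes a: "0 < a" and B: "integrable lborel (\<lambda>y. indicator {a..} y * B y)"
  shows "integrable lborel (\<lambda>y. if \<bar>y\<bar> < a then M else B \<bar>y\<bar>)"
proof -
  have "integrable lborel (\<lambda>y. indicator {a..} (0 + (-1) * y) * B (0 + (-1) * y))"
    by (rule lborel_integrable_real_affine[OF B]) simp
  moreover have "integrable lborel (\<lambda>y. indicator {-a<..<a} y * M)"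
    using emeasure_bounded_finite[of "{-a<..<a}"] by (intro integrable_mult_left integrable_real_indicator) auto
  ultimately have "integrable lborel (\<lambda>y. indicator {-a<..<a} y * M + (indicator {a..} y * B y + indicator {a..} (0 + (-1) * y) * B (0 + (-1) * y)))"
    using B by (intro Bochner_Integration.integrable_add)
  moreover have "(indicator {-a<..<a} y * M + (indicator {a..} y * B y + indicator {a..} (0 + (-1) * y) * B (0 + (-1) * y))) =
      (if \<bar>y\<bar> < a then M else B \<bar>y\<bar>)" for y
    using a by (auto simp: indicator_def abs_if)
  ultimately show ?thesis by simp
qed

text \<open>The line can be pushed off to \<open>+\<infinity>\<close> without changing the integral, and there dominated convergence applies.\<close>
lemma vertical_integral_eq_zero:
  fixes G :: "complex \<Rightarrow> complex" and D :: "real \<Rightarrow> real"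
  assumes hol: "G holomorphic_on {p. \<alpha> < Re p}" and c: "\<alpha> < c"
    and bound: "\<And>x y. c \<le> x \<Longrightarrow> norm (G (Complex x y)) \<le> D y"
    and D: "integrable lborel D"
    and decay: "\<And>e. e > 0 \<Longrightarrow> \<exists>Y. \<forall>y. Y \<le> \<bar>y\<bar> \<longrightarrow> D y \<le> e"
    and lim: "\<And>y. (\<lambda>n. G (Complex (c + real n) y)) \<longlonglongrightarrow> 0"
  shows "integrable lborel (\<lambda>y. G (Complex c y))" "(\<integral>y. G (Complex c y) \<partial>lborel) = 0"
proof -
  have meas: "(\<lambda>y. G (Complex x y)) \<in> borel_measurable lborel" if "c \<le> x" for x
  proof -
    have "continuous_on UNIV (\<lambda>y. G (Complex x y))"
      by (rule continuous_on_compose2[OF holomorphic_on_imp_continuous_on[OF hol]])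
         (use that c in \<open>auto intro!: continuous_intros\<close>)
    then show ?thesis by (simp add: borel_measurable_continuous_onI)
  qed
  have int: "integrable lborel (\<lambda>y. G (Complex x y))" if "c \<le> x" for x
    by (rule Bochner_Integration.integrable_bound[OF D meas[OF that]])
       (use bound[OF that] in \<open>auto intro!: AE_I2 intro: order_trans[OF _ abs_ge_self]\<close>)
  then show "integrable lborel (\<lambda>y. G (Complex c y))" by simp
  have eq: "(\<integral>y. G (Complex (c + real n) y) \<partial>lborel) = (\<integral>y. G (Complex c y) \<partial>lborel)" for n
  proof (rule vertical_lines_equal[where S="{p. \<alpha> < Re p}"])
    fix e :: real assume "e > 0"
    from decay[OF this] obtain Y where "\<forall>y. Y \<le> \<bar>y\<bar> \<longrightarrow> D y \<le> e" by blast
    then show "\<exists>Y. \<forall>x y. c \<le> x \<longrightarrow> x \<le> c + real n \<longrightarrow> Y \<le> \<bar>y\<bar> \<longrightarrow> norm (G (Complex x y)) \<le> e"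
      by (intro exI[of _ Y]) (use bound order_trans in blast)
  qed (use hol c int in \<open>auto intro: convex_halfspace_Re_gt open_halfspace_Re_gt\<close>)
  have "(\<lambda>n. \<integral>y. G (Complex (c + real n) y) \<partial>lborel) \<longlonglongrightarrow> (\<integral>y. 0 \<partial>(lborel :: real measure))"
    by (rule integral_dominated_convergence[where w=D])
       (use meas D lim bound in \<open>auto intro!: AE_I2\<close>)
  then show "(\<integral>y. G (Complex c y) \<partial>lborel) = 0"
    unfolding eq by (simp add: LIMSEQ_const_iff)
qed

lemma integrable_inverse_square_tail:
  "integrable lborel (\<lambda>y. indicator {1..} y * (C / y\<^sup>2 :: real))"
proof -
  have "((\<lambda>x::real. - (1 / x)) \<longlongrightarrow> 0) at_top" by real_asymp
  then have "(\<integral>\<^sup>+x. ennreal (1 / x\<^sup>2) * indicator {1 ..} x \<partial>lborel) = ennreal (0 - (- (1 / 1)))"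
    by (intro nn_integral_FTC_atLeast) (auto intro!: derivative_eq_intros simp: power2_eq_square)
  then have "(\<integral>\<^sup>+x. ennreal (indicator {1 ..} x * (1 / x\<^sup>2)) \<partial>lborel) = ennreal 1"
    by (simp add: indicator_mult_ennreal mult.commute)
  then have "has_bochner_integral lborel (\<lambda>x::real. indicator {1 ..} x * (1 / x\<^sup>2)) 1"
    by (intro has_bochner_integral_nn_integral) auto
  then have "integrable lborel (\<lambda>x::real. C * (indicator {1 ..} x * (1 / x\<^sup>2)))"
    by (intro integrable_mult_right) (auto simp: has_bochner_integral_iff)
  then show ?thesis by (simp add: mult_ac)
qed

lemma inverse_square_decay:
  fixes C :: real
  assumes "e > 0" "0 \<le> C"
  shows "\<exists>Y. \<forall>y. Y \<le> \<bar>y\<bar> \<longrightarrow> (if \<bar>y\<bar> < 1 then M else C / \<bar>y\<bar>\<^sup>2) \<le> e"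
proof (intro exI allI impI)
  fix y :: real assume "max 1 (C / e) \<le> \<bar>y\<bar>"
  then have y: "1 \<le> \<bar>y\<bar>" "C / e \<le> \<bar>y\<bar>" by auto
  have "C \<le> e * \<bar>y\<bar>" using y(2) assms by (simp add: field_simps)
  also have "\<bar>y\<bar> * 1 \<le> \<bar>y\<bar> * \<bar>y\<bar>" using y(1) by (intro mult_left_mono) auto
  then have "e * \<bar>y\<bar> \<le> e * \<bar>y\<bar>\<^sup>2" using assms by (intro mult_left_mono) (auto simp: power2_eq_square)
  finally have "C / \<bar>y\<bar>\<^sup>2 \<le> e" using y(1) by (simp add: divide_le_eq)
  then show "(if \<bar>y\<bar> < 1 then M else C / \<bar>y\<bar>\<^sup>2) \<le> e" using y by simp
qed

lemma norm_Complex_sq_ge: "y\<^sup>2 \<le> (norm (Complex x y))\<^sup>2" "x\<^sup>2 \<le> (norm (Complex x y))\<^sup>2"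
  by (simp_all add: cmod_power2)

lemma vertical_integral_over_square_zero:
  fixes G :: "complex \<Rightarrow> complex" and C :: real
  assumes hol: "G holomorphic_on {p. 0 < Re p}" and C: "0 \<le> C"
    and G: "\<And>p. 0 < Re p \<Longrightarrow> norm (G p) \<le> C / (norm p)\<^sup>2" and c: "0 < c"
  shows "integrable lborel (\<lambda>y. G (Complex c y))" "(\<integral>y. G (Complex c y) \<partial>lborel) = 0"
proof -
  define D where "D = (\<lambda>y::real. if \<bar>y\<bar> < 1 then C / c\<^sup>2 else C / \<bar>y\<bar>\<^sup>2)"
  have bd: "norm (G (Complex x y)) \<le> D y" if x: "c \<le> x" for x y
  proof -
    have "norm (G (Complex x y)) \<le> C / (norm (Complex x y))\<^sup>2" using x c by (intro G) simp
    also have "\<dots> \<le> D y"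
    proof (cases "\<bar>y\<bar> < 1")
      case True
      have "c\<^sup>2 \<le> x\<^sup>2" using x c by (intro power_mono) auto
      then have "c\<^sup>2 \<le> (norm (Complex x y))\<^sup>2" using norm_Complex_sq_ge(2)[of x y] by linarith
      then show ?thesis using C c True by (auto simp: D_def intro!: frac_le)
    next
      case False
      then show ?thesis using C c norm_Complex_sq_ge(1)[of y x] by (auto simp: D_def intro!: frac_le)
    qed
    finally show ?thesis .
  qed
  have lim: "(\<lambda>n. G (Complex (c + real n) y)) \<longlonglongrightarrow> 0" for y
  proof (rule Lim_null_comparison)
    show "(\<lambda>n::nat. C / (c + real n)\<^sup>2) \<longlonglongrightarrow> 0" by real_asymp
    show "\<forall>\<^sub>F n in sequentially. norm (G (Complex (c + real n) y)) \<le> C / (c + real n)\<^sup>2"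
    proof (intro always_eventually allI)
      fix n
      have "norm (G (Complex (c + real n) y)) \<le> C / (norm (Complex (c + real n) y))\<^sup>2" using c by (intro G) simp
      also have "\<dots> \<le> C / (c + real n)\<^sup>2"
        using C c norm_Complex_sq_ge(2)[of "c + real n" y] by (intro frac_le) auto
      finally show "norm (G (Complex (c + real n) y)) \<le> C / (c + real n)\<^sup>2" .
    qed
  qed
  have D: "integrable lborel D"
    unfolding D_def by (rule integrable_even_tail[OF _ integrable_inverse_square_tail]) simp
  have decay: "\<exists>Y. \<forall>y. Y \<le> \<bar>y\<bar> \<longrightarrow> D y \<le> e" if "e > 0" for e
    unfolding D_def by (rule inverse_square_decay[OF that C])
  show "integrable lborel (\<lambda>y. G (Complex c y))" "(\<integral>y. G (Complex c y) \<partial>lborel) = 0"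
    using vertical_integral_eq_zero[OF hol c bd D decay lim] by auto
qed

text \<open>The inverse Laplace transform of \<open>1 / p\<^sup>2\<close>. With \<open>g(p) = (exp (t p) - 1) / p\<close>, the quotient \<open>g(p) / p\<close> has a
  simple pole at \<open>0\<close> with residue \<open>t\<close>. Its integral vanishes on lines to the left of \<open>0\<close>, because the
  exponential is bounded there, and the difference \<open>1 / p\<^sup>2\<close> to the original integrand contributes nothing
  on lines to the right.\<close>
lemma vertical_integral_exp_over_square:
  fixes t c :: real
  assumes t: "0 \<le> t" and c: "0 < c"
  shows "(\<integral>y. exp (of_real t * Complex c y) / (Complex c y)\<^sup>2 \<partial>lborel) = complex_of_real (2 * pi * t)"
proof -
  define g where "g = (\<lambda>p::complex. if p = 0 then of_real t else (exp (of_real t * p) - 1) / p)"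
  have g: "g holomorphic_on UNIV"
  proof -
    have d: "deriv (\<lambda>p. exp (of_real t * p)) 0 = complex_of_real t"
      by (rule DERIV_imp_deriv) (auto intro!: derivative_eq_intros)
    have "(\<lambda>p. exp (of_real t * p)) holomorphic_on UNIV" by (intro holomorphic_intros)
    from pole_lemma_open[OF this open_UNIV, of 0]
    have "(\<lambda>p. if p = 0 then of_real t else (exp (of_real t * p) - exp (of_real t * 0)) / (p - 0)) holomorphic_on UNIV"
      unfolding d .
    also have "(\<lambda>p. if p = 0 then of_real t else (exp (of_real t * p) - exp (of_real t * 0)) / (p - 0)) = g"
      by (auto simp: g_def)
    finally show ?thesis .
  qed
  have E: "norm (exp (of_real t * p) - 1) \<le> exp (t * x) + 1" if "Re p \<le> x" for p x
  proof -
    have "norm (exp (of_real t * p) - 1) \<le> norm (exp (of_real t * p)) + norm (1::complex)" by (rule norm_triangle_ineq4)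
    also have "norm (exp (of_real t * p)) \<le> exp (t * x)" using that t by (simp add: mult_left_mono)
    finally show ?thesis by simp
  qed
  have gb: "norm (g p / p) \<le> (exp (t * x) + 1) / (norm p)\<^sup>2" if "p \<noteq> 0" "Re p \<le> x" for p x
    using E[OF that(2)] that(1) by (simp add: g_def norm_divide norm_mult power2_eq_square divide_right_mono)
  \<comment> \<open>the reflection of the lines to the left of the pole into the right half-plane\<close>
  define L where "L = (\<lambda>p. g (-p) / (-p))"
  have Lh: "L holomorphic_on {p. 0 < Re p}"
    unfolding L_def by (intro holomorphic_intros holomorphic_on_compose_gen[OF _ g, unfolded o_def]) auto
  have Lb: "norm (L p) \<le> 2 / (norm p)\<^sup>2" if "0 < Re p" for p
    using gb[of "-p" 0] that unfolding L_def by force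
  have L0: "integrable lborel (\<lambda>y. L (Complex c y))" "(\<integral>y. L (Complex c y) \<partial>lborel) = 0"
    using vertical_integral_over_square_zero[OF Lh _ Lb c] by auto
  have LC: "L (Complex c (0 - y)) = g (Complex (-c) y) / Complex (-c) y" for y
  proof -
    have "- Complex c (0 - y) = Complex (-c) y" by (simp add: complex_eq_iff)
    then show ?thesis by (simp only: L_def)
  qed
  have left: "integrable lborel (\<lambda>y. g (Complex (-c) y) / Complex (-c) y)"
     "(\<integral>y. g (Complex (-c) y) / Complex (-c) y \<partial>lborel) = 0"
    using lborel_integrable_real_affine[OF L0(1), of "-1" 0] lborel_integral_reflect[of "\<lambda>y. L (Complex c y)" 0] L0(2)
    unfolding LC by (simp_all add: LC[simplified])
  have sq: "integrable lborel (\<lambda>y. 1 / (Complex c y)\<^sup>2)" "(\<integral>y. 1 / (Complex c y)\<^sup>2 \<partial>lborel) = 0"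
    by (rule vertical_integral_over_square_zero[where C=1, OF _ _ _ c]; auto intro!: holomorphic_intros simp: norm_divide norm_power)+
  define D where "D = (\<lambda>y::real. if \<bar>y\<bar> < 1 then (exp (t * c) + 1) / c\<^sup>2 else (exp (t * c) + 1) / \<bar>y\<bar>\<^sup>2)"
  have Dint: "integrable lborel D"
    unfolding D_def by (rule integrable_even_tail[OF _ integrable_inverse_square_tail]) simp
  have right: "integrable lborel (\<lambda>y. g (Complex c y) / Complex c y)"
  proof (rule Bochner_Integration.integrable_bound[OF Dint])
    have "continuous_on UNIV (\<lambda>y. g (Complex c y) / Complex c y)"
      by (intro continuous_intros continuous_on_compose2[OF holomorphic_on_imp_continuous_on[OF g]])
         (use c in \<open>auto simp: complex_eq_iff\<close>)
    then show "(\<lambda>y. g (Complex c y) / Complex c y) \<in> borel_measurable lborel"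
      by (simp add: borel_measurable_continuous_onI)
    show "AE y in lborel. norm (g (Complex c y) / Complex c y) \<le> norm (D y)"
    proof (rule AE_I2)
      fix y
      have "norm (g (Complex c y) / Complex c y) \<le> (exp (t * c) + 1) / (norm (Complex c y))\<^sup>2"
        using c by (intro gb) (auto simp: complex_eq_iff)
      also have "\<dots> \<le> D y"
        using norm_Complex_sq_ge[of y c] norm_Complex_sq_ge[of c y] c
        by (auto simp: D_def intro!: frac_le add_nonneg_nonneg)
      finally show "norm (g (Complex c y) / Complex c y) \<le> norm (D y)" by simp
    qed
  qed
  have "(\<integral>y. g (Complex c y) / (Complex c y - of_real 0) \<partial>lborel) =
         (\<integral>y. g (Complex (-c) y) / (Complex (-c) y - of_real 0) \<partial>lborel) + 2 * pi * g (of_real 0)"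
  proof (rule vertical_lines_cross_pole[OF open_UNIV convex_UNIV g])
    fix e :: real assume e: "e > 0"
    obtain Y where Y: "\<And>y. Y \<le> \<bar>y\<bar> \<Longrightarrow> (if \<bar>y\<bar> < 1 then 0 else (exp (t * c) + 1) / \<bar>y\<bar>\<^sup>2) \<le> e"
      using inverse_square_decay[OF e, of "exp (t * c) + 1" 0] by (auto simp: add_nonneg_nonneg)
    show "\<exists>Y. \<forall>x y. -c \<le> x \<longrightarrow> x \<le> c \<longrightarrow> Y \<le> \<bar>y\<bar> \<longrightarrow> norm (g (Complex x y) / (Complex x y - of_real 0)) \<le> e"
    proof (intro exI allI impI)
      fix x y assume x: "x \<le> c" and y: "max Y 1 \<le> \<bar>y\<bar>"
      have "norm (g (Complex x y) / Complex x y) \<le> (exp (t * c) + 1) / (norm (Complex x y))\<^sup>2"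
        using x y by (intro gb) (auto simp: complex_eq_iff)
      also have "\<dots> \<le> (exp (t * c) + 1) / \<bar>y\<bar>\<^sup>2"
        using norm_Complex_sq_ge(1)[of y x] y by (intro frac_le) (auto simp: add_nonneg_nonneg)
      also have "\<dots> \<le> e" using Y[of y] y by simp
      finally show "norm (g (Complex x y) / (Complex x y - of_real 0)) \<le> e" by simp
    qed
  qed (use c left right in auto)
  then have "(\<integral>y. g (Complex c y) / Complex c y \<partial>lborel) = complex_of_real (2 * pi * t)"
    using left by (simp add: g_def)
  moreover have "exp (of_real t * Complex c y) / (Complex c y)\<^sup>2 = g (Complex c y) / Complex c y + 1 / (Complex c y)\<^sup>2" for y
    using c by (auto simp: g_def complex_eq_iff[of _ 0] power2_eq_square diff_divide_distrib)
  ultimately show ?thesis using right sq by simp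
qed

lemma complex_laplace_one:
  fixes a :: real
  assumes p: "0 < Re p"
  shows "(\<integral>t. exp (- p * of_real t) * of_real (indicator {0<..} t) \<partial>lborel) = 1 / p"
    and "0 < a \<Longrightarrow> integrable lborel (\<lambda>t. exp (- a * t) * indicator {0<..} t)"
proof -
  have hb: "has_bochner_integral lborel (\<lambda>t. exp (- a * t) * indicator {0<..} t) (1 / a)" if a: "0 < a" for a :: real
  proof -
    have "((\<lambda>t. - exp (- a * t) / a) \<longlongrightarrow> 0) at_top" using a by real_asymp
    then have "(\<integral>\<^sup>+t. ennreal (exp (- a * t)) * indicator {0..} t \<partial>lborel) = ennreal (0 - (- exp (- a * 0) / a))"
      using a by (intro nn_integral_FTC_atLeast) (auto intro!: derivative_eq_intros)
    then have "(\<integral>\<^sup>+t. ennreal (exp (- a * t) * indicator {0..} t) \<partial>lborel) = ennreal (1 / a)"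
      by (simp add: ennreal_mult'' ennreal_indicator)
    then have "has_bochner_integral lborel (\<lambda>t. exp (- a * t) * indicator {0..} t) (1 / a)"
      using a by (intro has_bochner_integral_nn_integral) auto
    then show ?thesis
    proof (rule has_bochner_integral_cong_AE[THEN iffD1, rotated -1])
      show "AE t in lborel. exp (- a * t) * indicator {0..} t = exp (- a * t) * indicator {0<..} t"
        using AE_lborel_singleton[of 0] by eventually_elim (auto simp: indicator_def)
    qed auto
  qed
  have int: "0 < a \<Longrightarrow> integrable lborel (\<lambda>t. exp (- a * t) * indicator {0<..} t)" for a :: real
    using hb by (auto simp: has_bochner_integral_iff)
  from this[of a] show "0 < a \<Longrightarrow> integrable lborel (\<lambda>t. exp (- a * t) * indicator {0<..} t)" .
  show "(\<integral>t. exp (- p * of_real t) * of_real (indicator {0<..} t) \<partial>lborel) = 1 / p"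
  proof (rule holomorphic_eq_on_right_half_plane[where g="\<lambda>p. 1 / p" and
        f="\<lambda>p. \<integral>t. exp (- p * complex_of_real t) * of_real (indicator {0<..} t) \<partial>lborel", OF _ _ _ p])
    show "(\<lambda>p. \<integral>t. exp (- p * complex_of_real t) * of_real (indicator {0<..} t) \<partial>lborel) holomorphic_on {p. 0 < Re p}"
      by (rule complex_laplace_holomorphic) (use int in auto)
    show "(\<lambda>p. 1 / p) holomorphic_on {p. 0 < Re p}" by (auto intro!: holomorphic_intros)
    fix x :: real assume "0 < x"
    have "exp (- complex_of_real x * of_real t) * of_real (indicator {0<..} t) = of_real (exp (- x * t) * indicator {0<..} t)" for t
      by (simp add: exp_of_real[symmetric])
    then show "(\<integral>t. exp (- of_real x * complex_of_real t) * of_real (indicator {0<..} t) \<partial>lborel) = 1 / complex_of_real x"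
      using hb[OF \<open>0 < x\<close>] by (simp only: integral_complex_of_real has_bochner_integral_iff) simp
  qed
qed

section \<open>The resolvent\<close>

text \<open>A transform \<open>R(p) = h(p) / (p - p0)\<close> with a single simple pole in the right half-plane, together with an
  integrable decreasing majorant \<open>B(|p|)\<close> for large \<open>|p|\<close>.\<close>
locale laplace_resolvent =
  fixes h :: "complex \<Rightarrow> complex" and B :: "real \<Rightarrow> real" and p0 s0 :: real
  assumes h: "h holomorphic_on {p. 0 < Re p}"
    and p0: "0 < p0" and s0: "p0 < s0"
    and bound: "\<And>p. 0 < Re p \<Longrightarrow> s0 \<le> norm p \<Longrightarrow> norm (h p / (p - of_real p0)) \<le> B (norm p)"
    and B_mono: "\<And>x y. s0 \<le> x \<Longrightarrow> x \<le> y \<Longrightarrow> B y \<le> B x"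
    and B_int: "integrable lborel (\<lambda>y. indicator {s0..} y * B y)"
    and B_lim: "(B \<longlongrightarrow> 0) at_top"
begin

definition R :: "complex \<Rightarrow> complex" where "R p = h p / (p - of_real p0)"

definition D :: "real \<Rightarrow> real" where "D y = (if \<bar>y\<bar> < s0 then B s0 else B \<bar>y\<bar>)"

text \<open>The inversion integral along the line with real part \<open>s0\<close>, which lies to the right of the pole.\<close>
definition resolvent :: "real \<Rightarrow> complex" where
  "resolvent t = (\<integral>y. exp (of_real t * Complex s0 y) * R (Complex s0 y) \<partial>lborel) / (2 * pi)"

lemma s0_pos: "0 < s0" using p0 s0 by simp

lemma norm_exp_line: "norm (exp (of_real t * Complex x y)) = exp (t * x)"
  by simp

lemma B_nonneg: "s0 \<le> x \<Longrightarrow> 0 \<le> B x"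
  using bound[of "of_real x"] s0_pos order_trans[OF norm_ge_zero] by force

lemma R_bound_right:
  assumes "s0 \<le> x"
  shows "norm (R (Complex x y)) \<le> D y"
proof -
  have n: "x \<le> norm (Complex x y)" "\<bar>y\<bar> \<le> norm (Complex x y)"
    using complex_Re_le_cmod[of "Complex x y"] abs_Im_le_cmod[of "Complex x y"] by simp_all
  have "norm (R (Complex x y)) \<le> B (norm (Complex x y))"
    unfolding R_def using assms s0_pos n by (intro bound) auto
  also have "\<dots> \<le> D y" using assms n by (auto simp: D_def intro!: B_mono)
  finally show ?thesis .
qed

lemma R_bound_tail:
  assumes "0 < x" "s0 \<le> \<bar>y\<bar>"
  shows "norm (R (Complex x y)) \<le> B \<bar>y\<bar>"
proof -
  have n: "\<bar>y\<bar> \<le> norm (Complex x y)" using abs_Im_le_cmod[of "Complex x y"] by simp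
  have "norm (R (Complex x y)) \<le> B (norm (Complex x y))"
    unfolding R_def using assms n by (intro bound) auto
  also have "\<dots> \<le> B \<bar>y\<bar>" using assms n by (intro B_mono)
  finally show ?thesis .
qed

lemma B_small:
  assumes "0 < e"
  shows "\<exists>Y. s0 \<le> Y \<and> (\<forall>x. Y \<le> x \<longrightarrow> B x \<le> e)"
proof -
  from order_tendstoD(2)[OF B_lim assms] obtain Y where "\<And>x. Y \<le> x \<Longrightarrow> B x < e"
    by (auto simp: eventually_at_top_linorder)
  then show ?thesis by (intro exI[of _ "max Y s0"]) (auto intro: less_imp_le)
qed

lemma D_int: "integrable lborel D"
  unfolding D_def[abs_def] by (rule integrable_even_tail[OF s0_pos B_int])

lemma D_decay: "0 < e \<Longrightarrow> \<exists>Y. \<forall>y. Y \<le> \<bar>y\<bar> \<longrightarrow> D y \<le> e"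
  using B_small[of e] by (fastforce simp: D_def)

lemma R_holomorphic: "R holomorphic_on {p. 0 < Re p} - {of_real p0}"
  unfolding R_def[abs_def] by (intro holomorphic_intros holomorphic_on_subset[OF h]) auto

lemma R_line_continuous:
  assumes "0 < c" "c \<noteq> p0"
  shows "continuous_on A (\<lambda>y. R (Complex c y))"
  by (rule continuous_on_compose2[OF holomorphic_on_imp_continuous_on[OF R_holomorphic]])
     (use assms in \<open>auto intro!: continuous_intros simp: complex_eq_iff\<close>)

lemma R_line_integrable:
  assumes c: "0 < c" "c \<noteq> p0"
  shows "integrable lborel (\<lambda>y. R (Complex c y))"
proof -
  obtain M where M: "0 \<le> M" "\<And>y. -s0 \<le> y \<Longrightarrow> y \<le> s0 \<Longrightarrow> norm (R (Complex c y)) \<le> M"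
    using continuous_bounded_on_Icc[OF R_line_continuous[OF c], of "-s0" s0] by blast
  show ?thesis
  proof (rule Bochner_Integration.integrable_bound[OF integrable_even_tail[OF s0_pos B_int, of M]])
    show "(\<lambda>y. R (Complex c y)) \<in> borel_measurable lborel"
      using R_line_continuous[OF c, of UNIV] by (simp add: borel_measurable_continuous_onI)
    show "AE y in lborel. norm (R (Complex c y)) \<le> norm (if \<bar>y\<bar> < s0 then M else B \<bar>y\<bar>)"
      using M R_bound_tail[OF c(1)] B_nonneg by (intro AE_I2) auto
  qed
qed

lemma exp_R_line_integrable:
  assumes c: "0 < c" "c \<noteq> p0"
  shows "integrable lborel (\<lambda>y. exp (of_real t * Complex c y) * R (Complex c y))"
proof (rule Bochner_Integration.integrable_bound[OF integrable_mult_right[OF integrable_norm[OF R_line_integrable[OF c]], of "exp (t * c)"]])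
  have "continuous_on UNIV (\<lambda>y. exp (of_real t * Complex c y) * R (Complex c y))"
    by (intro continuous_intros R_line_continuous c)
  then show "(\<lambda>y. exp (of_real t * Complex c y) * R (Complex c y)) \<in> borel_measurable lborel"
    by (simp add: borel_measurable_continuous_onI)
qed (simp add: norm_mult)

text \<open>For negative \<open>t\<close> the factor \<open>exp (t p)\<close> decays as the line moves to the right.\<close>
lemma resolvent_neg:
  assumes t: "t < 0"
  shows "resolvent t = 0"
proof -
  have le1: "exp (t * x) \<le> 1" if "s0 \<le> x" for x
    using t that s0_pos by (simp add: mult_nonpos_nonneg)
  have "(\<integral>y. exp (of_real t * Complex s0 y) * R (Complex s0 y) \<partial>lborel) = 0"
  proof (rule vertical_integral_eq_zero(2)[where \<alpha>=p0 and G="\<lambda>p. exp (of_real t * p) * R p", OF _ s0 _ D_int D_decay])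
    show "(\<lambda>p. exp (of_real t * p) * R p) holomorphic_on {p. p0 < Re p}"
      by (intro holomorphic_intros holomorphic_on_subset[OF R_holomorphic]) (use p0 in auto)
    show "norm (exp (of_real t * Complex x y) * R (Complex x y)) \<le> D y" if "s0 \<le> x" for x y
      unfolding norm_mult norm_exp_line
      using mult_mono[OF le1[OF that] R_bound_right[OF that, of y]] by simp
    show "(\<lambda>n. exp (of_real t * Complex (s0 + real n) y) * R (Complex (s0 + real n) y)) \<longlonglongrightarrow> 0" for y
    proof (rule Lim_null_comparison)
      have "(\<lambda>n. exp (t * (s0 + real n))) \<longlonglongrightarrow> 0" using t by real_asymp
      then show "(\<lambda>n. exp (t * (s0 + real n)) * D y) \<longlonglongrightarrow> 0" by (rule tendsto_mult_left_zero)
      show "\<forall>\<^sub>F n in sequentially. norm (exp (of_real t * Complex (s0 + real n) y) * R (Complex (s0 + real n) y))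
              \<le> exp (t * (s0 + real n)) * D y"
        unfolding norm_mult norm_exp_line
        by (intro always_eventually allI mult_left_mono R_bound_right) auto
    qed
  qed auto
  then show ?thesis by (simp add: resolvent_def)
qed

lemma resolvent_continuous: "continuous_on UNIV resolvent"
proof -
  have [measurable]: "(\<lambda>y. R (Complex s0 y)) \<in> borel_measurable borel"
    using R_line_integrable[of s0] s0_pos s0 by auto
  \<comment> \<open>without the factor \<open>exp (t * s0)\<close> there is a majorant that does not depend on \<open>t\<close>\<close>
  define F where "F = (\<lambda>t. \<integral>y. exp (\<i> * of_real (t * y)) * R (Complex s0 y) \<partial>lborel)"
  have F: "continuous_on UNIV F"
    unfolding continuous_on_sequentially
  proof (intro allI ballI impI)
    fix X :: "nat \<Rightarrow> real" and t assume X: "(\<forall>n. X n \<in> UNIV) \<and> X \<longlonglongrightarrow> t"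
    have "(\<lambda>n. F (X n)) \<longlonglongrightarrow> F t"
      unfolding F_def
    proof (rule integral_dominated_convergence[where w="\<lambda>y. norm (R (Complex s0 y))"])
      show "AE y in lborel. (\<lambda>n. exp (\<i> * of_real (X n * y)) * R (Complex s0 y)) \<longlonglongrightarrow> exp (\<i> * of_real (t * y)) * R (Complex s0 y)"
        using X by (intro AE_I2 tendsto_intros) auto
      show "integrable lborel (\<lambda>y. norm (R (Complex s0 y)))"
        using R_line_integrable[of s0] s0_pos s0 by (intro integrable_norm) auto
    qed (auto simp: norm_mult)
    then show "(F \<circ> X) \<longlonglongrightarrow> F t" by (simp add: o_def)
  qed
  have "resolvent t = exp (of_real (t * s0)) * F t / (2 * pi)" for t
  proof -
    have "exp (of_real t * Complex s0 y) = exp (of_real (t * s0)) * exp (\<i> * of_real (t * y))" for y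
      unfolding exp_add[symmetric] by (simp add: Complex_eq algebra_simps)
    then show ?thesis by (simp add: resolvent_def F_def mult.assoc)
  qed
  then have "resolvent = (\<lambda>t. exp (of_real (t * s0)) * F t / (2 * pi))" by blast
  moreover have "continuous_on UNIV (\<lambda>t. exp (of_real (t * s0)) * F t / (2 * pi))"
    by (intro continuous_intros F) auto
  ultimately show ?thesis by simp
qed

lemma resolvent_nonpos:
  assumes "t \<le> 0"
  shows "resolvent t = 0"
proof -
  have "resolvent t = 0" if "t \<in> closure {..<0}"
    by (rule continuous_constant_on_closure[OF continuous_on_subset[OF resolvent_continuous] _ that])
       (auto intro: resolvent_neg)
  then show ?thesis using assms by simp
qed

lemma resolvent_cross_pole:
  assumes c: "0 < c" "c < p0"
  shows "2 * pi * resolvent t = (\<integral>y. exp (of_real t * Complex c y) * R (Complex c y) \<partial>lborel)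
            + 2 * pi * (exp (of_real (t * p0)) * h (of_real p0))"
proof -
  define g where "g = (\<lambda>p. exp (of_real t * p) * h p)"
  have gR: "g p / (p - of_real p0) = exp (of_real t * p) * R p" for p
    by (simp add: g_def R_def)
  have "(\<integral>y. g (Complex s0 y) / (Complex s0 y - of_real p0) \<partial>lborel) =
        (\<integral>y. g (Complex c y) / (Complex c y - of_real p0) \<partial>lborel) + 2 * pi * g (of_real p0)"
  proof (rule vertical_lines_cross_pole[where S="{p. 0 < Re p}"])
    show "g holomorphic_on {p. 0 < Re p}" unfolding g_def by (intro holomorphic_intros h)
    fix e :: real assume e: "0 < e"
    define E where "E = exp (\<bar>t\<bar> * s0)"
    have E: "0 < E" by (simp add: E_def)
    obtain Y where Y: "s0 \<le> Y" "\<And>x. Y \<le> x \<Longrightarrow> B x \<le> e / E"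
      using B_small[of "e / E"] e E by auto
    show "\<exists>Y. \<forall>x y. c \<le> x \<longrightarrow> x \<le> s0 \<longrightarrow> Y \<le> \<bar>y\<bar> \<longrightarrow> norm (g (Complex x y) / (Complex x y - of_real p0)) \<le> e"
    proof (intro exI allI impI)
      fix x y assume x: "c \<le> x" "x \<le> s0" and y: "Y \<le> \<bar>y\<bar>"
      have "t * x \<le> \<bar>t\<bar> * x" using x c by (intro mult_right_mono) auto
      also have "\<dots> \<le> \<bar>t\<bar> * s0" using x by (intro mult_left_mono) auto
      finally have "exp (t * x) \<le> E" by (simp add: E_def)
      moreover have "norm (R (Complex x y)) \<le> e / E"
        using R_bound_tail[of x y] Y(1) Y(2)[of "\<bar>y\<bar>"] x y c by linarith
      ultimately have "exp (t * x) * norm (R (Complex x y)) \<le> E * (e / E)"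
        using E by (intro mult_mono) auto
      then show "norm (g (Complex x y) / (Complex x y - of_real p0)) \<le> e"
        using E unfolding gR norm_mult norm_exp_line by simp
    qed
  qed (use c s0 p0 in \<open>auto simp: gR convex_halfspace_Re_gt intro: open_right_half_plane exp_R_line_integrable[simplified]\<close>)
  then show ?thesis by (simp add: gR resolvent_def) (simp add: g_def)
qed

text \<open>After crossing the pole the remaining integral has the factor \<open>exp (t p)\<close> of constant modulus \<open>exp (t c)\<close>.\<close>
lemma resolvent_asymptotics:
  assumes c: "0 < c" "c < p0"
  shows "\<exists>M. \<forall>t. norm (resolvent t - exp (of_real (t * p0)) * h (of_real p0)) \<le> M * exp (t * c)"
proof (intro exI allI)
  fix t
  let ?I = "\<integral>y. exp (of_real t * Complex c y) * R (Complex c y) \<partial>lborel"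
  have "resolvent t - exp (of_real (t * p0)) * h (of_real p0) = ?I / (2 * pi)"
    using resolvent_cross_pole[OF c, of t] by (simp add: field_simps)
  also have "norm \<dots> = norm ?I / (2 * pi)" by (simp add: norm_divide norm_mult)
  also have "norm ?I \<le> (\<integral>y. norm (exp (of_real t * Complex c y) * R (Complex c y)) \<partial>lborel)"
    by (rule integral_norm_bound)
  also have "\<dots> = exp (t * c) * (\<integral>y. norm (R (Complex c y)) \<partial>lborel)"
    unfolding norm_mult norm_exp_line by simp
  finally show "norm (resolvent t - exp (of_real (t * p0)) * h (of_real p0))
      \<le> (\<integral>y. norm (R (Complex c y)) \<partial>lborel) / (2 * pi) * exp (t * c)"
    by (simp add: divide_right_mono mult.commute)
qed

text \<open>Since the resolvent vanishes for negative arguments, the convolution with \<open>m\<close> extends over the whole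
  positive axis. Fubini then produces the Laplace transform of \<open>m\<close> under the inversion integral.\<close>
lemma resolvent_kernel_equation:
  fixes m :: "real \<Rightarrow> real" and \<mu> :: real
  assumes m[measurable]: "m \<in> borel_measurable borel" and m0: "\<And>s. s \<le> 0 \<Longrightarrow> m s = 0"
    and int: "integrable lborel (\<lambda>s. exp (- s0 * s) * m s)"
    and mR: "\<And>p. Re p = s0 \<Longrightarrow> (\<integral>s. exp (- p * of_real s) * of_real (m s) \<partial>lborel) * R p = of_real \<mu> / p\<^sup>2"
    and t: "0 \<le> t"
  shows "(\<integral>s. of_real (m s) * resolvent (t - s) \<partial>lborel) = of_real (\<mu> * t)"
proof -
  let ?c = "\<lambda>y. Complex s0 y"
  have RI: "integrable lborel (\<lambda>y. R (?c y))" using R_line_integrable[of s0] s0_pos s0 by auto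
  then have [measurable]: "(\<lambda>y. R (?c y)) \<in> borel_measurable borel" by auto
  have [measurable]: "Complex s0 \<in> borel_measurable borel"
    by (intro borel_measurable_continuous_onI continuous_intros)
  have "(\<integral>s. of_real (m s) * resolvent (t - s) \<partial>lborel)
      = (\<integral>s. (\<integral>y. of_real (m s) * (exp (of_real (t - s) * ?c y) * R (?c y)) \<partial>lborel) / (2 * pi) \<partial>lborel)"
    by (simp add: resolvent_def)
  also have "\<dots> = (\<integral>s. \<integral>y. of_real (m s) * (exp (of_real (t - s) * ?c y) * R (?c y)) \<partial>lborel \<partial>lborel) / (2 * pi)"
    by simp
  also have "(\<integral>s. \<integral>y. of_real (m s) * (exp (of_real (t - s) * ?c y) * R (?c y)) \<partial>lborel \<partial>lborel)
      = (\<integral>y. \<integral>s. of_real (m s) * (exp (of_real (t - s) * ?c y) * R (?c y)) \<partial>lborel \<partial>lborel)"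
  proof (rule fubini_product_bound)
    show "(\<lambda>(s, y). of_real (m s) * (exp (of_real (t - s) * ?c y) * R (?c y))) \<in> borel_measurable (lborel \<Otimes>\<^sub>M lborel)"
      by measurable
    show "integrable lborel (\<lambda>s. norm (exp (- s0 * s) * m s))" by (rule integrable_norm[OF int])
    show "integrable lborel (\<lambda>y. exp (t * s0) * norm (R (?c y)))"
      by (intro integrable_mult_right integrable_norm RI)
    fix s y
    have "exp ((t - s) * s0) = exp (- s0 * s) * exp (t * s0)"
      unfolding exp_add[symmetric] by (simp add: algebra_simps)
    then show "norm (of_real (m s) * (exp (of_real (t - s) * ?c y) * R (?c y)))
        \<le> norm (exp (- s0 * s) * m s) * (exp (t * s0) * norm (R (?c y)))"
      unfolding norm_mult norm_exp_line by (simp add: abs_mult)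
  qed
  also have "\<dots> = (\<integral>y. of_real \<mu> * (exp (of_real t * ?c y) / (?c y)\<^sup>2) \<partial>lborel)"
  proof (rule Bochner_Integration.integral_cong[OF refl])
    fix y
    have "(\<integral>s. of_real (m s) * (exp (of_real (t - s) * ?c y) * R (?c y)) \<partial>lborel)
        = (\<integral>s. (exp (- ?c y * of_real s) * of_real (m s)) * (exp (of_real t * ?c y) * R (?c y)) \<partial>lborel)"
    proof (rule Bochner_Integration.integral_cong[OF refl])
      fix s
      have "exp (of_real (t - s) * ?c y) = exp (- ?c y * of_real s) * exp (of_real t * ?c y)"
        unfolding exp_add[symmetric] by (simp add: algebra_simps)
      then show "of_real (m s) * (exp (of_real (t - s) * ?c y) * R (?c y)) =
        (exp (- ?c y * of_real s) * of_real (m s)) * (exp (of_real t * ?c y) * R (?c y))"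
        by (simp only: mult_ac)
    qed
    also have "\<dots> = (\<integral>s. exp (- ?c y * of_real s) * of_real (m s) \<partial>lborel) * (exp (of_real t * ?c y) * R (?c y))"
      by (rule integral_mult_left_zero)
    also have "\<dots> = exp (of_real t * ?c y) * ((\<integral>s. exp (- ?c y * of_real s) * of_real (m s) \<partial>lborel) * R (?c y))"
      by (simp only: mult_ac)
    also have "\<dots> = of_real \<mu> * (exp (of_real t * ?c y) / (?c y)\<^sup>2)"
      by (subst mR) simp_all
    finally show "(\<integral>s. of_real (m s) * (exp (of_real (t - s) * ?c y) * R (?c y)) \<partial>lborel)
       = of_real \<mu> * (exp (of_real t * ?c y) / (?c y)\<^sup>2)" .
  qed
  also have "\<dots> = complex_of_real \<mu> * complex_of_real (2 * pi * t)"
    by (simp only: integral_mult_right_zero vertical_integral_exp_over_square[OF t s0_pos])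
  finally show ?thesis by simp
qed

end

section \<open>The asymptotics\<close>

theorem mainTheorem2:
  fixes k u \<Phi> :: "real \<Rightarrow> real" and \<mu> p0 :: real
  defines "\<Phi> \<equiv> \<lambda>p. p * laplace k p"
  assumes k_nonneg: "\<And>t. 0 < t \<Longrightarrow> 0 \<le> k t"
    and k_loc_int: "locally_integrable_pos k"
    and k_laplace: "\<And>p. 0 < p \<Longrightarrow> laplace_exists k p"
    and stieltjes: "stieltjes_function (laplace k)"
    and K_at_0: "filterlim (laplace k) at_top (at_right 0)"
    and K_at_top: "(laplace k \<longlongrightarrow> 0) at_top"
    and pK_at_0: "((\<lambda>p. p * laplace k p) \<longlongrightarrow> 0) (at_right 0)"
    and pK_at_top: "filterlim (\<lambda>p. p * laplace k p) at_top at_top"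
    and int_cond: "(\<lambda>s. 1 / (s * \<Phi> s)) absolutely_integrable_on {1..}"
    and mu_pos: "0 < \<mu>"
    and p0_pos: "0 < p0"
    and p0_root: "\<Phi> p0 = \<mu>"
    and solution: "cauchy_solution k \<mu> u"
  shows "(\<lambda>t. u t - \<mu> / (deriv \<Phi> p0 * p0) * exp (p0 * t)) \<in> o(\<lambda>t. exp (p0 * t))"
proof -
  obtain \<sigma> where \<sigma>: "stieltjes_measure \<sigma>" and K: "\<And>z. 0 < z \<Longrightarrow> laplace k z = (\<integral>t. 1 / (z + t) \<partial>\<sigma>)"
    by (rule stieltjes_representation[OF stieltjes K_at_top pK_at_0]) blast
  interpret stieltjes_measure \<sigma> by (rule \<sigma>)
  define T where "T = transform (\<lambda>_. 1)"
  define w where "w = (\<lambda>s. s / (p0 + s))"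
  define Q where "Q = transform w"
  have w: "w \<in> borel_measurable borel" "\<And>s. 0 \<le> s \<Longrightarrow> 0 \<le> w s \<and> w s \<le> 1"
    using p0_pos by (auto simp: w_def)
  have T_real: "T (of_real x) = of_real (laplace k x)" if "0 < x" for x
    unfolding T_def using integrable_real_transform(2)[of "\<lambda>_. 1", OF _ _ that] K[OF that] by simp
  have T_hol: "T holomorphic_on {p. 0 < Re p}"
    unfolding T_def by (rule transform_holomorphic) auto
  have Q_hol: "Q holomorphic_on {p. 0 < Re p}"
    unfolding Q_def by (rule transform_holomorphic[OF w])
  have TQ: "p * T p - of_real \<mu> = (p - of_real p0) * Q p" if "0 < Re p" for p
    using Phi_difference[OF p0_pos that] T_real[OF p0_pos] p0_root
    unfolding T_def[symmetric] Q_def w_def \<Phi>_def by (simp flip: of_real_mult)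
  have \<Phi>Q: "\<Phi> x - \<mu> = (x - p0) * Re (Q (of_real x))" if "0 < x" for x
  proof -
    have "complex_of_real (\<Phi> x - \<mu>) = of_real (x - p0) * Q (of_real x)"
      using TQ[of "of_real x"] T_real[OF that] that by (simp add: \<Phi>_def)
    from arg_cong[OF this, of Re] show ?thesis by simp
  qed
  \<comment> \<open>otherwise \<open>\<sigma>\<close> is concentrated at \<open>0\<close> and \<open>\<Phi>\<close> is constant\<close>
  have nz: "\<not> (AE s in \<sigma>. w s = 0)"
  proof
    assume ae: "AE s in \<sigma>. w s = 0"
    have "Q p = 0" for p
      unfolding Q_def transform_def by (rule integral_eq_zero_AE) (use ae in \<open>auto elim: eventually_mono\<close>)
    then have const: "\<And>x. 0 < x \<Longrightarrow> \<Phi> x = \<mu>" using \<Phi>Q by simp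
    have "\<forall>\<^sub>F x in at_top. \<mu> + 1 \<le> \<Phi> x"
      using pK_at_top unfolding \<Phi>_def filterlim_at_top by blast
    then obtain X where "\<And>x. X \<le> x \<Longrightarrow> \<mu> + 1 \<le> \<Phi> x" by (auto simp: eventually_at_top_linorder)
    from this[of "max X 1"] const[of "max X 1"] show False by simp
  qed
  have Re_Q: "0 < Re (Q p)" if "0 < Re p" for p
    unfolding Q_def by (rule Re_transform_pos[OF w that nz])
  have \<Phi>_mono: "\<Phi> x \<le> \<Phi> y" if xy: "0 < x" "x \<le> y" for x y
  proof -
    let ?v = "\<lambda>s. s / (x + s)"
    have v: "?v \<in> borel_measurable borel" "\<And>s. 0 \<le> s \<Longrightarrow> 0 \<le> ?v s \<and> ?v s \<le> 1" using xy by auto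
    have y: "0 < y" using xy by simp
    have "complex_of_real (\<Phi> y - \<Phi> x) = of_real ((y - x) * (\<integral>s. ?v s / (y + s) \<partial>\<sigma>))"
      using Phi_difference[OF xy(1), of "of_real y"] T_real[OF xy(1)] T_real[OF y] y
        integrable_real_transform(2)[OF v y]
      unfolding T_def[symmetric] \<Phi>_def by simp
    then have "\<Phi> y - \<Phi> x = (y - x) * (\<integral>s. ?v s / (y + s) \<partial>\<sigma>)" by (simp only: of_real_eq_iff)
    moreover have "0 \<le> (\<integral>s. ?v s / (y + s) \<partial>\<sigma>)"
      using xy by (intro integral_nonneg_AE AE_I2) (auto simp: space_\<sigma>)
    ultimately show ?thesis using xy by (metis diff_ge_0_iff_ge mult_nonneg_nonneg)
  qed
  have D\<Phi>: "(\<Phi> has_real_derivative Re (Q (of_real p0))) (at p0)"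
    unfolding has_field_derivative_iff
  proof (rule Lim_transform_eventually)
    have "isCont (\<lambda>x. Re (Q (of_real x))) p0"
    proof -
      have "isCont Q (of_real p0)"
        using Q_hol p0_pos open_right_half_plane
        by (metis (no_types, lifting) Re_complex_of_real continuous_on_eq_continuous_at holomorphic_on_imp_continuous_on mem_Collect_eq)
      then show ?thesis by (intro continuous_intros isCont_o2[of _ of_real]) auto
    qed
    then show "((\<lambda>x. Re (Q (of_real x))) \<longlongrightarrow> Re (Q (of_real p0))) (at p0)" by (rule isContD)
    have "\<forall>\<^sub>F x in at p0. 0 < x" using p0_pos by (intro order_tendstoD(1)[OF tendsto_ident_at])
    moreover have "\<forall>\<^sub>F x in at p0. x \<noteq> p0" by (rule eventually_neq_at_within)
    ultimately show "\<forall>\<^sub>F x in at p0. Re (Q (of_real x)) = (\<Phi> x - \<Phi> p0) / (x - p0)"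
      by eventually_elim (use \<Phi>Q p0_root in auto)
  qed
  then have deriv: "deriv \<Phi> p0 = Re (Q (of_real p0))" by (rule DERIV_imp_deriv)
  have Q_p0: "Q (of_real p0) = of_real (deriv \<Phi> p0)"
    unfolding deriv unfolding Q_def using integrable_real_transform(2)[OF w p0_pos] by simp
  define h where "h = (\<lambda>p. of_real \<mu> / (p * Q p))"
  define B where "B = (\<lambda>x. 4 * \<mu> * (1 / (x * \<Phi> x)))"
  \<comment> \<open>where \<open>\<Phi> \<ge> 4 \<mu>\<close>, subtracting \<open>\<mu>\<close> from \<open>|\<Phi>(p)| \<ge> \<Phi>(|p|) / 2\<close> still leaves \<open>\<Phi>(|p|) / 4\<close>\<close>
  have "\<forall>\<^sub>F x in at_top. 4 * \<mu> \<le> \<Phi> x"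
    using pK_at_top unfolding \<Phi>_def filterlim_at_top by blast
  then obtain N where N: "\<And>x. N \<le> x \<Longrightarrow> 4 * \<mu> \<le> \<Phi> x" by (auto simp: eventually_at_top_linorder)
  define s0 where "s0 = max N (p0 + 1)"
  have s0: "p0 < s0" "1 \<le> s0" "N \<le> s0" using p0_pos by (auto simp: s0_def)
  have \<Phi>_ge: "4 * \<mu> \<le> \<Phi> x" if "s0 \<le> x" for x using N that s0 by simp
  interpret laplace_resolvent h B p0 s0
  proof
    show "h holomorphic_on {p. 0 < Re p}"
      unfolding h_def using Re_Q by (intro holomorphic_intros Q_hol) force
    show "0 < p0" "p0 < s0" using p0_pos s0 by auto
    fix p assume p: "0 < Re p" "s0 \<le> norm p"
    have np: "0 < norm p" using p s0 by linarith
    have "\<Phi> (norm p) \<le> 2 * norm (p * T p)"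
      using mult_left_mono[OF norm_transform_ge[OF p(1)], of "norm p"] K[OF np]
      by (simp add: \<Phi>_def T_def norm_mult)
    moreover have "norm (p * T p) - norm (of_real \<mu> :: complex) \<le> norm (p * T p - of_real \<mu>)"
      by (rule norm_triangle_ineq2)
    ultimately have ge: "\<Phi> (norm p) / 4 \<le> norm (p * T p - of_real \<mu>)"
      using \<Phi>_ge[OF p(2)] mu_pos by simp
    have "h p / (p - of_real p0) = of_real \<mu> / (p * ((p - of_real p0) * Q p))"
      by (simp add: h_def mult_ac)
    also have "\<dots> = of_real \<mu> / (p * (p * T p - of_real \<mu>))" by (simp only: TQ[OF p(1)])
    also have "norm \<dots> = \<mu> / (norm p * norm (p * T p - of_real \<mu>))"
      using mu_pos by (simp add: norm_divide norm_mult)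
    also have "\<dots> \<le> \<mu> / (norm p * (\<Phi> (norm p) / 4))"
      using mu_pos np ge \<Phi>_ge[OF p(2)] by (intro divide_left_mono mult_left_mono mult_pos_pos) auto
    also have "\<dots> = B (norm p)" by (simp add: B_def)
    finally show "norm (h p / (p - of_real p0)) \<le> B (norm p)" .
  next
    fix x y assume xy: "s0 \<le> x" "x \<le> y"
    have "0 < x" "0 < \<Phi> x" using xy s0 \<Phi>_ge[OF xy(1)] mu_pos by auto
    moreover have "\<Phi> x \<le> \<Phi> y" using xy s0 by (intro \<Phi>_mono) auto
    ultimately show "B y \<le> B x"
      unfolding B_def using xy mu_pos by (intro mult_left_mono frac_le mult_mono) auto
  next
    let ?f = "\<lambda>s. 1 / (s * \<Phi> s)"
    have cont: "continuous_on {s0..} ?f"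
    proof -
      have "continuous_on {s0..} (\<lambda>s. Re (T (of_real s)))"
        by (intro continuous_intros continuous_on_compose2[OF holomorphic_on_imp_continuous_on[OF T_hol]]) (use s0 in auto)
      moreover have "Re (T (of_real s)) = laplace k s" if "s \<in> {s0..}" for s using that s0 by (simp add: T_real)
      ultimately have "continuous_on {s0..} (laplace k)" by (rule continuous_on_eq)
      moreover have "s * \<Phi> s \<noteq> 0" if "s \<in> {s0..}" for s using \<Phi>_ge[of s] that mu_pos s0 by auto
      ultimately show ?thesis unfolding \<Phi>_def by (intro continuous_intros) (auto simp: \<Phi>_def)
    qed
    have meas: "(\<lambda>s. indicator {s0..} s *\<^sub>R ?f s) \<in> borel_measurable lborel"
      using borel_measurable_continuous_on_indicator[OF _ cont] by simp
    have "set_integrable lebesgue {s0..} ?f"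
      by (rule set_integrable_subset[OF int_cond]) (use s0 in auto)
    then have "integrable lborel (\<lambda>s. indicator {s0..} s *\<^sub>R ?f s)"
      unfolding set_integrable_def integrable_completion[OF meas] .
    from integrable_mult_right[OF this, of "4 * \<mu>"]
    show "integrable lborel (\<lambda>y. indicator {s0..} y * B y)" by (simp add: B_def mult_ac)
  next
    show "(B \<longlongrightarrow> 0) at_top"
    proof (rule Lim_null_comparison)
      show "((\<lambda>x::real. 1 / x) \<longlongrightarrow> 0) at_top" by real_asymp
      show "\<forall>\<^sub>F x in at_top. norm (B x) \<le> 1 / x"
        using eventually_ge_at_top[of s0]
      proof eventually_elim
        case (elim x)
        have x: "0 < x" "0 < \<Phi> x" using elim s0 \<Phi>_ge[OF elim] mu_pos by auto
        have "4 * \<mu> / \<Phi> x \<le> 1" using \<Phi>_ge[OF elim] x by simp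
        then have "4 * \<mu> / \<Phi> x * (1 / x) \<le> 1 * (1 / x)" using x by (intro mult_right_mono) auto
        then show ?case using x mu_pos by (simp add: B_def mult_ac)
      qed
    qed
  qed
  obtain \<kappa> where \<kappa>[measurable]: "\<kappa> \<in> borel_measurable borel" and \<kappa>_nonneg: "\<And>t. 0 \<le> \<kappa> t"
    and \<kappa>0: "\<And>t. t \<le> 0 \<Longrightarrow> \<kappa> t = 0" and \<kappa>_ae: "AE t in lborel. 0 < t \<longrightarrow> k t = \<kappa> t"
    and \<kappa>_int: "\<And>p. 0 < p \<Longrightarrow> integrable lborel (\<lambda>t. exp (- p * t) * \<kappa> t)"
    and \<kappa>_lap: "\<And>p. 0 < p \<Longrightarrow> (\<integral>t. exp (- p * t) * \<kappa> t \<partial>lborel) = laplace k p"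
    using borel_version_of_kernel[OF k_nonneg k_laplace] by blast
  have \<kappa>_loc: "integrable lborel (\<lambda>s. indicator {0<..<b} s * \<kappa> s)" for b
    by (rule integrable_laplace_local[OF \<kappa>_int \<kappa>_nonneg \<kappa>]) simp
  have \<kappa>_T: "(\<integral>s. exp (- p * of_real s) * of_real (\<kappa> s) \<partial>lborel) = T p" if p: "0 < Re p" for p
  proof (rule holomorphic_eq_on_right_half_plane[where g=T and f="\<lambda>p. \<integral>s. exp (- p * of_real s) * of_real (\<kappa> s) \<partial>lborel", OF _ T_hol _ p])
    show "(\<lambda>p. \<integral>s. exp (- p * of_real s) * of_real (\<kappa> s) \<partial>lborel) holomorphic_on {p. 0 < Re p}"
      by (rule complex_laplace_holomorphic[OF \<kappa> \<kappa>0 \<kappa>_nonneg \<kappa>_int])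
    fix x :: real assume x: "0 < x"
    have "exp (- complex_of_real x * of_real s) * of_real (\<kappa> s) = of_real (exp (- x * s) * \<kappa> s)" for s
      by (simp add: exp_of_real[symmetric])
    then show "(\<integral>s. exp (- complex_of_real x * of_real s) * of_real (\<kappa> s) \<partial>lborel) = T (of_real x)"
      by (simp only: integral_complex_of_real \<kappa>_lap[OF x] T_real[OF x])
  qed
  define m where "m = (\<lambda>s. \<kappa> s - \<mu> * indicator {0<..} s)"
  have m[measurable]: "m \<in> borel_measurable borel" unfolding m_def by measurable
  have m0: "m s = 0" if "s \<le> 0" for s using that \<kappa>0 by (simp add: m_def)
  have m_loc: "integrable lborel (\<lambda>s. indicator {0<..<b} s * m s)" for b
  proof -
    have "integrable lborel (\<lambda>s. indicator {0<..<b} s * \<kappa> s - indicator {0<..<b} s * \<mu>)"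
      using emeasure_bounded_finite[of "{0<..<b}"]
      by (intro Bochner_Integration.integrable_diff \<kappa>_loc integrable_mult_left integrable_real_indicator) auto
    then show ?thesis
      by (rule back_subst[of "integrable lborel"]) (auto simp: m_def indicator_def)
  qed
  have m_int: "integrable lborel (\<lambda>s. exp (- s0 * s) * m s)"
  proof -
    have "integrable lborel (\<lambda>s. exp (- s0 * s) * \<kappa> s - \<mu> * (exp (- s0 * s) * indicator {0<..} s))"
      using s0_pos by (intro Bochner_Integration.integrable_diff integrable_mult_right \<kappa>_int complex_laplace_one(2)[of 1]) auto
    then show ?thesis by (simp add: m_def algebra_simps)
  qed
  have mR: "(\<integral>s. exp (- p * of_real s) * of_real (m s) \<partial>lborel) * R p = of_real \<mu> / p\<^sup>2" if p: "Re p = s0" for p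
  proof -
    have Rep: "0 < Re p" "p \<noteq> 0" "p \<noteq> of_real p0" using p s0 s0_pos by auto
    have i1: "integrable lborel (\<lambda>s. exp (- p * of_real s) * of_real (\<kappa> s))"
      by (rule integrable_complex_laplace[OF \<kappa> \<kappa>0 \<kappa>_int[OF Rep(1)]])
    have i2: "integrable lborel (\<lambda>s. exp (- p * of_real s) * of_real (indicator {0<..} s))"
      by (rule integrable_complex_laplace) (use complex_laplace_one(2)[OF Rep(1) Rep(1)] in auto)
    have "(\<integral>s. exp (- p * of_real s) * of_real (m s) \<partial>lborel) =
        (\<integral>s. exp (- p * of_real s) * of_real (\<kappa> s) - of_real \<mu> * (exp (- p * of_real s) * of_real (indicator {0<..} s)) \<partial>lborel)"
      by (simp add: m_def algebra_simps)
    also have "\<dots> = (\<integral>s. exp (- p * of_real s) * of_real (\<kappa> s) \<partial>lborel) -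
        (\<integral>s. of_real \<mu> * (exp (- p * of_real s) * of_real (indicator {0<..} s)) \<partial>lborel)"
      by (rule Bochner_Integration.integral_diff[OF i1 integrable_mult_right[OF i2]])
    also have "\<dots> = T p - of_real \<mu> * (1 / p)"
      by (simp only: integral_mult_right_zero \<kappa>_T[OF Rep(1)] complex_laplace_one(1)[OF Rep(1)])
    also have "\<dots> = (p - of_real p0) * Q p / p"
      using Rep(2) by (simp add: TQ[OF Rep(1), symmetric] diff_divide_distrib)
    finally have L: "(\<integral>s. exp (- p * of_real s) * of_real (m s) \<partial>lborel) = (p - of_real p0) * Q p / p" .
    have "Q p \<noteq> 0" using Re_Q[OF Rep(1)] by auto
    then show ?thesis
      unfolding L R_def unfolding h_def using Rep by (simp add: power2_eq_square)
  qed
  define z where "z = (\<lambda>t. u (max 0 t) - 1)"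
  have z: "continuous_on UNIV z" "\<And>t. t \<le> 0 \<Longrightarrow> z t = 0"
    "\<And>t. 0 < t \<Longrightarrow> (\<integral>s. \<kappa> s * z (t - s) \<partial>lborel) = \<mu> * (\<integral>s. indicator {0<..} s * z (t - s) \<partial>lborel) + \<mu> * t"
    unfolding z_def
    using integrated_cauchy_equation[OF \<kappa> \<kappa>_nonneg \<kappa>0 \<kappa>_ae \<kappa>_loc solution] by blast+
  have eq_z: "(\<integral>s. of_real (m s) * of_real (z (t - s)) \<partial>lborel) = complex_of_real (\<mu> * t)" if t: "0 < t" for t
  proof -
    have zc: "continuous_on UNIV (\<lambda>s. z (t - s))"
      by (rule continuous_on_compose2[OF z(1)]) (auto intro!: continuous_intros)
    have supp: "indicator {0<..<t} s * g s * z (t - s) = g s * z (t - s)" if "\<And>s. s \<le> 0 \<Longrightarrow> g s = 0" for g :: "real \<Rightarrow> real" and s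
      using that[of s] z(2)[of "t - s"] by (cases "s \<le> 0"; cases "t \<le> s") auto
    have "(\<lambda>s. indicator {0<..<t} s * \<kappa> s * z (t - s)) = (\<lambda>s. \<kappa> s * z (t - s))"
      by (intro ext supp \<kappa>0)
    with integrable_mult_continuous[OF \<kappa>_loc zc, of t]
    have i1: "integrable lborel (\<lambda>s. \<kappa> s * z (t - s))" by (simp only:)
    have ind: "integrable lborel (\<lambda>s. indicator {0<..<t} s * (indicator {0<..} s :: real))"
      using emeasure_bounded_finite[of "{0<..<t}"]
      by (simp add: indicator_inter_arith[symmetric] Int_absorb2 subset_iff)
    have "(\<lambda>s. indicator {0<..<t} s * indicator {0<..} s * z (t - s)) = (\<lambda>s. indicator {0<..} s * z (t - s))"
      by (intro ext supp) simp
    with integrable_mult_continuous[OF ind zc]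
    have i2: "integrable lborel (\<lambda>s. indicator {0<..} s * z (t - s))" by (simp only:)
    have "(\<integral>s. m s * z (t - s) \<partial>lborel) = (\<integral>s. \<kappa> s * z (t - s) - \<mu> * (indicator {0<..} s * z (t - s)) \<partial>lborel)"
      by (simp add: m_def algebra_simps)
    also have "\<dots> = (\<integral>s. \<kappa> s * z (t - s) \<partial>lborel) - \<mu> * (\<integral>s. indicator {0<..} s * z (t - s) \<partial>lborel)"
      using i1 i2 by simp
    also have "\<dots> = \<mu> * t" using z(3)[OF t] by simp
    finally show ?thesis by (simp flip: of_real_mult)
  qed
  have "(\<lambda>t. complex_of_real (z t)) = resolvent"
  proof (rule first_kind_solution_unique[OF m m0 m_loc])
    show "continuous_on UNIV (\<lambda>t. complex_of_real (z t))" by (intro continuous_intros z)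
    show "(\<integral>s. of_real (m s) * resolvent (t - s) \<partial>lborel) = of_real (\<mu> * t)" if "0 < t" for t
      by (rule resolvent_kernel_equation[OF m m0 m_int mR]) (use that in auto)
  qed (use z eq_z resolvent_continuous resolvent_nonpos mu_pos in auto)
  then have zr: "resolvent t = of_real (z t)" for t by metis
  define C where "C = \<mu> / (deriv \<Phi> p0 * p0)"
  have h_p0: "h (of_real p0) = of_real C"
    unfolding h_def C_def Q_p0 by (simp add: mult.commute)
  obtain M where M: "\<And>t. norm (resolvent t - exp (of_real (t * p0)) * h (of_real p0)) \<le> M * exp (t * (p0 / 2))"
    using resolvent_asymptotics[of "p0 / 2"] p0_pos by auto
  have "(\<lambda>t. u t - C * exp (p0 * t)) \<in> O(\<lambda>t. exp (p0 / 2 * t))"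
  proof (rule bigoI)
    show "\<forall>\<^sub>F t in at_top. norm (u t - C * exp (p0 * t)) \<le> (M + 1) * norm (exp (p0 / 2 * t))"
      using eventually_ge_at_top[of 0]
    proof eventually_elim
      case (elim t)
      have "complex_of_real (z t - C * exp (p0 * t)) = resolvent t - exp (of_real (t * p0)) * h (of_real p0)"
        by (simp add: zr h_p0 exp_of_real[symmetric] mult_ac)
      then have "\<bar>z t - C * exp (p0 * t)\<bar> \<le> M * exp (p0 / 2 * t)"
        using M[of t] by (metis mult.commute norm_of_real)
      moreover have "u t = z t + 1" using elim by (simp add: z_def)
      moreover have "1 \<le> exp (p0 / 2 * t)" using elim p0_pos by simp
      ultimately have "\<bar>u t - C * exp (p0 * t)\<bar> \<le> M * exp (p0 / 2 * t) + exp (p0 / 2 * t)" by linarith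
      then show ?case by (simp add: algebra_simps)
    qed
  qed
  moreover have "(\<lambda>t. exp (p0 / 2 * t)) \<in> o(\<lambda>t. exp (p0 * t))" using p0_pos by real_asymp
  ultimately show ?thesis unfolding C_def by (rule landau_o.big_small_trans)
qed

end
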